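(* Let $B:=\frac{\sqrt{3}}{\pi}$ and let $\gamma$ be the Euler--Mascheroni constant. For every $v \in \mathbb{R}$, $$ \lim_{n \to \infty} \mathbf{P}_{n}\left(\frac{{\rm PK}-B\sqrt{n}\log\left(2B\sqrt{n}\right)}{B\sqrt{n}} \leq v \right)=e^{-e^{-v}}. $$ Moreover, writing $\mathbf{E}_n$ for expectation under $\mathbf{P}_n$, $$ \mathbf{E}_n({\rm PK}) = B\sqrt{n}\log\left(2B\sqrt{n}\right)+B\gamma \sqrt{n}(1+o(1)) \qquad (n\to\infty). $$
   Context: A unimodal sequence $\lambda$ of size $n$ is a finite sequence of positive integers $\lambda_{1}^{[L]} \leq \dots \leq \lambda_{r}^{[L]} \leq \lambda_{\mathrm{PK}} \geq \lambda_{s}^{[R]} \geq \dots \geq \lambda_{1}^{[R]}$ ($r,s\ge 0$) with a distinguished entry $\lambda_{\mathrm{PK}}$ (the peak), such that $\lambda_{\mathrm{PK}}+\sum_{k=1}^r\lambda_k^{[L]}+\sum_{k=1}^s\lambda_k^{[R]}=n$; two such sequences are equal when their left parts, peak and right parts coincide. Let $\mathcal{U}_n$ be the (finite) set of unimodal sequences of size $n$ and $\mathbf{P}_n$ the uniform probability measure on $\mathcal{U}_n$. The random variable ${\rm PK}(\lambda):=\lambda_{\mathrm{PK}}$ is the peak. *)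

theory Defs
  imports "HOL-Probability.Probability" "HOL-Library.Landau_Symbols"
begin

text \<open>Left part, peak and right part, each list in the left-to-right order of the sequence; so
  the right part is listed outwards from the peak.\<close>

datatype peaked_seq = Peaked_Seq (left_part: "nat list") (peak: nat) (right_part: "nat list")

definition unimodal :: "peaked_seq \<Rightarrow> bool" where
  "unimodal l \<longleftrightarrow>
     sorted_wrt (\<le>) (left_part l @ [peak l]) \<and>
     sorted_wrt (\<ge>) (peak l # right_part l) \<and>
     (\<forall>x \<in> set (left_part l @ peak l # right_part l). x > 0)"

definition seq_size :: "peaked_seq \<Rightarrow> nat" where
  "seq_size l = peak l + sum_list (left_part l) + sum_list (right_part l)"

definition unimodal_seqs :: "nat \<Rightarrow> peaked_seq set" where
  "unimodal_seqs n = {l. unimodal l \<and> seq_size l = n}"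

lemma length_le_sum_list_pos:
  "(\<forall>x \<in> set xs. x > 0) \<Longrightarrow> length xs \<le> sum_list xs" for xs :: "nat list"
  by (induction xs) (auto simp: Suc_le_eq)

lemma finite_unimodal_seqs: "finite (unimodal_seqs n)"
proof -
  let ?X = "{xs. set xs \<subseteq> {..n} \<and> length xs \<le> n}"
  have fin: "finite ?X"
    by (rule finite_lists_length_le) simp
  have lists: "xs \<in> ?X" if "\<forall>x \<in> set xs. x > 0" "sum_list xs \<le> n" for xs
    using that length_le_sum_list_pos[OF that(1)] by (auto dest: member_le_sum_list)
  have "unimodal_seqs n \<subseteq> (\<lambda>(a, p, b). Peaked_Seq a p b) ` (?X \<times> {..n} \<times> ?X)"
  proof
    fix l assume l: "l \<in> unimodal_seqs n"
    then have "left_part l \<in> ?X" and "right_part l \<in> ?X"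
      by (intro lists; force simp: unimodal_seqs_def unimodal_def seq_size_def)+
    moreover from l have "peak l \<in> {..n}"
      by (auto simp: unimodal_seqs_def seq_size_def)
    ultimately show "l \<in> (\<lambda>(a, p, b). Peaked_Seq a p b) ` (?X \<times> {..n} \<times> ?X)"
      by (intro image_eqI[of _ _ "(left_part l, peak l, right_part l)"]) auto
  qed
  then show ?thesis
    using fin by (auto intro: finite_subset)
qed

lemma unimodal_seqs_nonempty: "n > 0 \<Longrightarrow> unimodal_seqs n \<noteq> {}"
  by (auto simp: unimodal_seqs_def unimodal_def seq_size_def intro!: exI[of _ "Peaked_Seq [] n []"])

text \<open>For \<open>n = 0\<close> the set is empty and this is an unspecified distribution.\<close>

definition unimodal_pmf :: "nat \<Rightarrow> peaked_seq pmf" where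
  "unimodal_pmf n = pmf_of_set (unimodal_seqs n)"

end

theory Submission
  imports Defs "HOL-Real_Asymp.Real_Asymp"
begin

text \<open>Let \<open>A\<^sub>m(j)\<close> be the number of pairs of partitions with parts at most \<open>m\<close> and total size \<open>j\<close>. Sequences
  of size \<open>n\<close> with peak \<open>m\<close> are counted by \<open>A\<^sub>m(n - m)\<close>, and
  \<open>2 A\<^sub>m(n - m) = A\<^sub>m(n) - A\<^sub>m\<^sub>-\<^sub>1(n) + A\<^sub>m(n - 2m)\<close>, so that the number of sequences with peak at most \<open>x\<close> is
  half of \<open>A\<^sub>x(n)\<close> up to a correction that turns out to be negligible. The problem thus becomes one about the
  largest part of a random pair of partitions of \<open>n\<close>.

  Put \<open>t = 1 / (B sqrt n)\<close>. Writing \<open>A\<^sub>m(n)\<close> as a Fourier integral over the circle of radius \<open>exp (-t)\<close> shows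
  that \<open>A\<^sub>m(n) / A\<^sub>n(n)\<close> is asymptotically \<open>\<Prod>\<^sub>m\<^sub><\<^sub>k\<^sub>\<le>\<^sub>n (1 - exp (- k t))\<^sup>2\<close>, because for the relevant \<open>m\<close> the larger
  parts have little influence on the local probabilities of the total size; the latter are of exact order
  \<open>t powr (3/2)\<close>. For \<open>m = (ln (2 / t) + v) / t\<close> the product tends to \<open>exp (- exp (- v))\<close>. The same estimates
  give exponential tail bounds, uniform in \<open>n\<close>, for the normalised peak, so its mean converges to that of the
  Gumbel distribution, which is \<open>\<gamma>\<close>.\<close>

section \<open>Counting unimodal sequences\<close>

text \<open>The total size has mean 2 * (sum of k / (exp (k t) - 1)), which is pi^2 / (3 t^2) to
  leading order; equating this with n gives t and hence B. The factor 2 comes from the two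
  partitions. It also makes the exponent of the product over k > m close to 2 exp (- m t) / t, which
  is exp (- v) when m t = ln (2 / t) + v; this is the 2 inside the logarithm. The obstacle is the
  local probability of the size n: its exact asymptotics would require a full local limit theorem
  with a sharp variance. Only a quotient of two such probabilities is needed. Their difference is
  estimated directly through the characteristic functions and is O(t powr (7/4)) at the Gumbel
  cutoff, so a lower bound of order t powr (3/2) for the denominator suffices, and for that only
  upper bounds on the second and third order terms are required. The correction A_m(n - 2m), summed
  over m, is negligible for two different reasons: for m below a threshold already A_m(n) is tiny,
  and above it the weights exp (- 2 m t) have a small sum.\<close>

definition partition_lists :: "nat \<Rightarrow> nat \<Rightarrow> nat list set" where
  "partition_lists m j = {xs. sorted xs \<and> set xs \<subseteq> {1..m} \<and> sum_list xs = j}"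

definition partition_count :: "nat \<Rightarrow> nat \<Rightarrow> nat" where
  "partition_count m j = card (partition_lists m j)"

definition pair_count :: "nat \<Rightarrow> nat \<Rightarrow> nat" where
  "pair_count m j = (\<Sum>i\<le>j. partition_count m i * partition_count m (j - i))"

lemma finite_partition_lists: "finite (partition_lists m j)"
proof (rule finite_subset)
  show "partition_lists m j \<subseteq> {xs. set xs \<subseteq> {1..m} \<and> length xs \<le> j}"
    using length_le_sum_list_pos by (fastforce simp: partition_lists_def)
  show "finite {xs. set xs \<subseteq> {1..m} \<and> length xs \<le> j}"
    by (rule finite_lists_length_le) simp
qed

lemma partition_lists_0: "partition_lists 0 j = (if j = 0 then {[]} else {})"
  by (auto simp: partition_lists_def)

lemma partition_count_0: "partition_count 0 j = (if j = 0 then 1 else 0)"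
  by (simp add: partition_count_def partition_lists_0)

lemma partition_count_zero: "partition_count m 0 = 1"
proof -
  have "xs = []" if "sum_list xs = 0" "set xs \<subseteq> {1..m}" for xs :: "nat list"
    using that by (cases xs) auto
  then have "partition_lists m 0 = {[]}"
    by (auto simp: partition_lists_def)
  then show ?thesis
    by (simp add: partition_count_def)
qed

lemma partition_count_mono: "m \<le> m' \<Longrightarrow> partition_count m j \<le> partition_count m' j"
  unfolding partition_count_def
  by (intro card_mono finite_partition_lists) (auto simp: partition_lists_def)

text \<open>In a sorted list an occurrence of the largest admissible part is the last entry.
  Removing it may leave further copies, hence \<open>partition_lists (Suc m)\<close> again in the
  second set.\<close>

lemma partition_lists_Suc:
  "partition_lists (Suc m) j = partition_lists m j \<union>
     (if Suc m \<le> j then (\<lambda>xs. xs @ [Suc m]) ` partition_lists (Suc m) (j - Suc m) else {})"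
  (is "?L = ?R")
proof (rule subset_antisym; rule subsetI)
  fix xs assume xs: "xs \<in> ?L"
  show "xs \<in> ?R"
  proof (cases "Suc m \<in> set xs")
    case False
    with xs have "xs \<in> partition_lists m j"
      by (auto simp: partition_lists_def subset_iff) (metis le_SucE)
    then show ?thesis by simp
  next
    case True
    then have ne: "xs \<noteq> []" by auto
    define ys where "ys = butlast xs"
    from ne have xs_eq: "xs = ys @ [last xs]" by (simp add: ys_def)
    have srt: "sorted (ys @ [last xs])" and sub: "set xs \<subseteq> {1..Suc m}" and sm: "sum_list xs = j"
      using xs xs_eq by (auto simp: partition_lists_def)
    have "Suc m \<le> last xs"
      using True srt xs_eq by (metis Un_iff empty_iff empty_set insert_iff list.simps(15) order_refl set_append sorted_wrt_append)
    moreover have "last xs \<le> Suc m" using sub ne last_in_set[OF ne] by (auto simp del: last_in_set)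
    ultimately have l: "last xs = Suc m" by simp
    from xs_eq l have e: "xs = ys @ [Suc m]" by simp
    have "ys \<in> partition_lists (Suc m) (j - Suc m)" "Suc m \<le> j"
      using srt sub sm l unfolding e by (auto simp: partition_lists_def sorted_append)
    then show ?thesis using e by auto
  qed
next
  fix xs assume "xs \<in> ?R"
  then show "xs \<in> ?L"
    by (auto simp: partition_lists_def sorted_append subset_iff split: if_splits)
qed

lemma partition_count_Suc:
  "partition_count (Suc m) j =
     partition_count m j + (if Suc m \<le> j then partition_count (Suc m) (j - Suc m) else 0)"
proof -
  let ?B = "(\<lambda>xs. xs @ [Suc m]) ` partition_lists (Suc m) (j - Suc m)"
  have "Suc m \<notin> set xs" if "xs \<in> partition_lists m j" for xs
    using that by (auto simp: partition_lists_def)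
  then have "partition_lists m j \<inter> ?B = {}"
    by fastforce
  moreover have "card ?B = partition_count (Suc m) (j - Suc m)"
    unfolding partition_count_def by (intro card_image) (auto simp: inj_on_def)
  moreover have "card (partition_lists (Suc m) j) = card (partition_lists m j \<union> (if Suc m \<le> j then ?B else {}))"
    by (simp only: partition_lists_Suc[of m j])
  ultimately show ?thesis
    by (cases "Suc m \<le> j") (simp_all add: partition_count_def card_Un_disjoint finite_partition_lists)
qed

definition partition_fps :: "nat \<Rightarrow> real fps" where
  "partition_fps m = Abs_fps (\<lambda>j. real (partition_count m j))"

text \<open>Kept free of division, so that relations between consecutive generating functions are
  plain ring identities, open to \<open>algebra\<close>.\<close>

lemma partition_fps_Suc: "(1 - fps_X ^ Suc m) * partition_fps (Suc m) = partition_fps m"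
  by (rule fps_ext)
     (simp add: partition_fps_def left_diff_distrib fps_X_power_mult_nth partition_count_Suc
           del: power_Suc)

lemma partition_fps_square_nth: "fps_nth ((partition_fps m)\<^sup>2) j = real (pair_count m j)"
  by (simp add: power2_eq_square fps_mult_nth partition_fps_def pair_count_def atLeast0AtMost)

lemma pair_count_mono:
  assumes "m \<le> m'"
  shows "pair_count m j \<le> pair_count m' j"
  unfolding pair_count_def by (intro sum_mono mult_mono partition_count_mono assms) auto

text \<open>The coefficients of \<open>q\<^sup>s P(q)\<^sup>2\<close>; the test avoids the truncated subtraction \<open>j - s\<close>.\<close>

definition shifted_pair_count :: "nat \<Rightarrow> nat \<Rightarrow> nat \<Rightarrow> nat" where
  "shifted_pair_count m j s = (if s \<le> j then pair_count m (j - s) else 0)"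

text \<open>With \<open>P\<close> the generating function of partitions into parts at most \<open>m + 1\<close> and
  \<open>x = q ^ (m + 1)\<close>, this compares coefficients in \<open>P\<^sup>2 - ((1 - x) P)\<^sup>2 = 2 x P\<^sup>2 - x\<^sup>2 P\<^sup>2\<close>.\<close>

lemma pair_count_peak:
  "2 * real (shifted_pair_count (Suc m) n (Suc m)) =
     real (pair_count (Suc m) n) - real (pair_count m n)
     + real (shifted_pair_count (Suc m) n (2 * Suc m))"
proof -
  let ?X = "fps_X :: real fps" and ?P = "partition_fps (Suc m)"
  have "(partition_fps m)\<^sup>2 = ?P\<^sup>2 - ?X ^ Suc m * (2 * ?P\<^sup>2) + ?X ^ (2 * Suc m) * ?P\<^sup>2"
    unfolding partition_fps_Suc[of m, symmetric] power_mult[of _ 2] mult.commute[of 2 "Suc m"] power_mult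
    by algebra
  then have "fps_nth ((partition_fps m)\<^sup>2) n = fps_nth (?P\<^sup>2 - ?X ^ Suc m * (2 * ?P\<^sup>2) + ?X ^ (2 * Suc m) * ?P\<^sup>2) n"
    by simp
  moreover have "fps_nth (2 * ?P\<^sup>2) k = 2 * fps_nth (?P\<^sup>2) k" for k
    by (simp add: fps_numeral_fps_const)
  ultimately show ?thesis
    by (simp add: fps_X_power_mult_nth partition_fps_square_nth shifted_pair_count_def
             del: power_Suc mult_Suc_right split: if_splits)
qed

text \<open>With P and Q the generating functions for parts at most m + 1 and m, (1 - X^(m+1)) P^2 =
  P Q has nonnegative coefficients, so the coefficients of P^2 do not decrease along steps of length
  m + 1.\<close>

lemma shifted_pair_count_double_le:
  "shifted_pair_count (Suc m) n (2 * Suc m) \<le> shifted_pair_count (Suc m) n (Suc m)"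
proof (cases "2 * Suc m \<le> n")
  case True
  let ?X = "fps_X :: real fps" and ?P = "partition_fps (Suc m)"
  have "?P\<^sup>2 - ?X ^ Suc m * ?P\<^sup>2 = ?P * partition_fps m"
    unfolding partition_fps_Suc[of m, symmetric] by algebra
  moreover obtain d where d: "n = 2 * Suc m + d"
    using True le_Suc_ex by blast
  ultimately have "fps_nth (?P\<^sup>2) (Suc m + d) - fps_nth (?P\<^sup>2) d = fps_nth (?P * partition_fps m) (Suc m + d)"
    by (metis fps_sub_nth fps_X_power_mult_nth add_diff_cancel_left' not_add_less1)
  moreover have "fps_nth (?P * partition_fps m) (Suc m + d) \<ge> 0"
    unfolding fps_mult_nth partition_fps_def by (intro sum_nonneg) simp
  ultimately have "real (pair_count (Suc m) d) \<le> real (pair_count (Suc m) (Suc m + d))"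
    by (simp add: partition_fps_square_nth)
  moreover have "n - Suc m = Suc m + d" "n - 2 * Suc m = d" using d by simp_all
  ultimately have "pair_count (Suc m) (n - 2 * Suc m) \<le> pair_count (Suc m) (n - Suc m)"
    by (simp only: of_nat_le_iff)
  then show ?thesis
    using True by (simp add: shifted_pair_count_def)
qed (simp add: shifted_pair_count_def)

section \<open>Sequences with a given peak\<close>

definition peak_count :: "nat \<Rightarrow> nat \<Rightarrow> nat" where
  "peak_count n m = card {l \<in> unimodal_seqs n. peak l = m}"

text \<open>Reversing the right part turns both sides of the peak into increasing lists with entries
  in {1..m}; the index \<open>i\<close> of the disjoint union records how the size n - m is split
  between them.\<close>

lemma peak_count_eq:
  assumes "m > 0"
  shows "peak_count n m = shifted_pair_count m n m"
proof -
  let ?S = "{l \<in> unimodal_seqs n. peak l = m}"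
  have mem: "l \<in> ?S \<longleftrightarrow> (sorted (left_part l) \<and> set (left_part l) \<subseteq> {1..m}) \<and>
      (sorted (rev (right_part l)) \<and> set (right_part l) \<subseteq> {1..m}) \<and> peak l = m \<and>
      m + sum_list (left_part l) + sum_list (right_part l) = n" for l
    using assms
    by (auto simp: unimodal_seqs_def unimodal_def seq_size_def sorted_append sorted_wrt_append
        sorted_wrt_rev subset_iff Suc_le_eq)
  show ?thesis
  proof (cases "m \<le> n")
    case False
    then have "l \<notin> ?S" for l using mem[of l] by auto
    then have "?S = {}" by blast
    then have "peak_count n m = 0" by (simp only: peak_count_def card.empty)
    then show ?thesis using False by (simp add: shifted_pair_count_def)
  next
    case True
    let ?Q = "SIGMA i:{..n - m}. partition_lists m i \<times> partition_lists m (n - m - i)"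
    have "bij_betw (\<lambda>l. (sum_list (left_part l), left_part l, rev (right_part l))) ?S ?Q"
    proof (rule bij_betw_byWitness[where f' = "\<lambda>(i, a, b). Peaked_Seq a m (rev b)"], goal_cases)
      case 1
      show ?case unfolding Ball_def mem by (auto intro: peaked_seq.expand)
    next
      case 2
      show ?case by (auto simp: partition_lists_def)
    next
      case 3
      show ?case unfolding image_subset_iff Ball_def mem
        by (auto simp: partition_lists_def sum_list_rev)
    next
      case 4
      show ?case unfolding image_subset_iff
      proof
        fix z assume z: "z \<in> ?Q"
        then obtain i a b where "z = (i, a, b)" "i \<le> n - m" "a \<in> partition_lists m i"
          "b \<in> partition_lists m (n - m - i)"
          by auto
        then show "(case z of (i, a, b) \<Rightarrow> Peaked_Seq a m (rev b)) \<in> ?S"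
          using True unfolding mem by (auto simp: partition_lists_def sum_list_rev)
      qed
    qed
    then have "peak_count n m = card ?Q"
      unfolding peak_count_def by (rule bij_betw_same_card)
    also have "\<dots> = pair_count m (n - m)"
      by (simp add: finite_partition_lists card_cartesian_product pair_count_def partition_count_def)
    finally show ?thesis
      using True by (simp add: shifted_pair_count_def)
  qed
qed

lemma card_peak_le: "card {l \<in> unimodal_seqs n. peak l \<le> x} = (\<Sum>m=1..x. peak_count n m)"
proof -
  have pos: "peak l \<ge> 1" if "l \<in> unimodal_seqs n" for l
    using that by (auto simp: unimodal_seqs_def unimodal_def Suc_le_eq)
  have "{l \<in> unimodal_seqs n. peak l \<le> x} = (\<Union>m\<in>{1..x}. {l \<in> unimodal_seqs n. peak l = m})"
    using pos by auto
  also have "card \<dots> = (\<Sum>m=1..x. card {l \<in> unimodal_seqs n. peak l = m})"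
    by (intro card_UN_disjoint) (auto simp: finite_unimodal_seqs)
  finally show ?thesis by (simp add: peak_count_def)
qed

text \<open>Counts the pairs of partitions of total size \<open>n\<close> with equal largest parts, of size at most \<open>x\<close>.\<close>

definition tie_count :: "nat \<Rightarrow> nat \<Rightarrow> nat" where
  "tie_count n x = (\<Sum>m=1..x. shifted_pair_count m n (2 * m))"

lemma pair_count_0: "pair_count 0 n = (if n = 0 then 1 else 0)"
  by (auto simp: pair_count_def partition_count_0 if_distrib[of "\<lambda>x. x * _"] sum.delta cong: if_cong)

text \<open>\<open>pair_count_peak\<close> telescopes over the peaks 1..x. The sum starts from
  \<open>pair_count 0 n\<close>, which vanishes because n > 0.\<close>

lemma two_peak_le:
  assumes "n > 0"
  shows "2 * real (card {l \<in> unimodal_seqs n. peak l \<le> x}) = real (pair_count x n) + real (tie_count n x)"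
proof -
  have "2 * real (\<Sum>m=1..x. shifted_pair_count m n m) = real (pair_count x n) + real (tie_count n x)"
  proof (induction x)
    case 0
    then show ?case using assms by (simp add: pair_count_0 tie_count_def)
  next
    case (Suc x)
    then show ?case using pair_count_peak[of x n] by (simp add: tie_count_def)
  qed
  then show ?thesis
    unfolding card_peak_le by (simp add: peak_count_eq)
qed

text \<open>Write N for the number of sequences with peak at most x, A for the pair count and T for
  the ties. Termwise comparison gives T \<le> N, and 2 N = A + T then yields T \<le> A.\<close>

lemma tie_count_le:
  assumes "n > 0"
  shows "tie_count n x \<le> pair_count x n"
proof -
  have "tie_count n x \<le> (\<Sum>m=1..x. shifted_pair_count m n m)"
    unfolding tie_count_def
  proof (intro sum_mono)
    fix m assume "m \<in> {1..x}"
    then obtain k where "m = Suc k" by (cases m) auto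
    then show "shifted_pair_count m n (2 * m) \<le> shifted_pair_count m n m"
      using shifted_pair_count_double_le by blast
  qed
  also have "\<dots> = card {l \<in> unimodal_seqs n. peak l \<le> x}"
    unfolding card_peak_le by (simp add: peak_count_eq)
  finally show ?thesis
    using two_peak_le[OF assms, of x] by linarith
qed

lemma tie_count_mono: "x \<le> y \<Longrightarrow> tie_count n x \<le> tie_count n y"
  unfolding tie_count_def by (intro sum_mono2) auto

lemma pair_count_pos:
  assumes "m > 0"
  shows "pair_count m j > 0"
proof -
  have "partition_count m j > 0"
  proof -
    have "replicate j 1 \<in> partition_lists m j"
      using assms by (auto simp: partition_lists_def sum_list_replicate)
    then show ?thesis
      by (auto simp: partition_count_def card_gt_0_iff finite_partition_lists)
  qed
  then have "0 < partition_count m j * partition_count m (j - j)"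
    by (simp add: partition_count_zero)
  also have "\<dots> \<le> pair_count m j"
    unfolding pair_count_def by (rule member_le_sum) auto
  finally show ?thesis .
qed

section \<open>Generating functions\<close>

text \<open>By the recurrence a partial sum S for m + 1 satisfies S \<le> (sum for m) + r^(m+1) S,
  so the partial sums are bounded.\<close>

lemma partition_count_summable:
  fixes r :: real
  assumes r: "0 \<le> r" "r < 1"
  shows "summable (\<lambda>j. real (partition_count m j) * r ^ j)"
proof (induction m)
  case 0
  show ?case
    by (rule summable_finite[of "{0}"]) (auto simp: partition_count_0)
next
  case (Suc m)
  let ?f = "\<lambda>m j. real (partition_count m j) * r ^ j"
  have lt: "r ^ Suc m < 1" using r by (simp add: power_Suc_less_one power_less_one_iff del: power_Suc)
  have "(\<Sum>j<N. ?f (Suc m) j) \<le> suminf (?f m) / (1 - r ^ Suc m)" for N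
  proof -
    let ?S = "\<Sum>j<N. ?f (Suc m) j"
    have "?S = (\<Sum>j<N. ?f m j) + (\<Sum>j\<in>{..<N} \<inter> {j. Suc m \<le> j}. real (partition_count (Suc m) (j - Suc m)) * r ^ j)"
      by (subst sum.inter_restrict, simp, subst sum.distrib[symmetric], rule sum.cong)
         (auto simp: partition_count_Suc[of m] distrib_right)
    also have "(\<Sum>j\<in>{..<N} \<inter> {j. Suc m \<le> j}. real (partition_count (Suc m) (j - Suc m)) * r ^ j)
       = (\<Sum>j<N - Suc m. r ^ Suc m * ?f (Suc m) j)"
      by (rule sum.reindex_bij_witness[of _ "\<lambda>j. j + Suc m" "\<lambda>j. j - Suc m"])
         (auto simp: power_add[symmetric] simp del: power_Suc)
    also have "\<dots> \<le> r ^ Suc m * ?S"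
      unfolding sum_distrib_left[symmetric] using r
      by (intro mult_left_mono sum_mono2) auto
    also have "(\<Sum>j<N. ?f m j) \<le> suminf (?f m)"
      using r by (intro sum_le_suminf Suc) auto
    finally have "?S * (1 - r ^ Suc m) \<le> suminf (?f m)" by (simp add: algebra_simps)
    then show ?thesis using lt by (simp add: pos_le_divide_eq)
  qed
  then show ?case
    using r by (intro summableI_nonneg_bounded) auto
qed

lemma partition_count_norm_summable:
  fixes z :: complex
  assumes "norm z < 1"
  shows "summable (\<lambda>j. norm (of_nat (partition_count m j) * z ^ j))"
  using partition_count_summable[of "norm z" m] assms by (simp add: norm_mult norm_power)

text \<open>The recurrence only provides a linear equation for the sum; it determines the value
  because convergence is already known and z^(m+1) differs from 1.\<close>

lemma partition_count_sums:
  fixes z :: complex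
  assumes z: "norm z < 1"
  shows "(\<lambda>j. of_nat (partition_count m j) * z ^ j) sums (\<Prod>k=1..m. 1 / (1 - z ^ k))"
proof (induction m)
  case 0
  show ?case using sums_finite[of "{0}" "\<lambda>j. of_nat (partition_count 0 j) * z ^ j"]
    by (simp add: partition_count_0)
next
  case (Suc m)
  let ?f = "\<lambda>m j. of_nat (partition_count m j) * z ^ j"
  have "norm (z ^ Suc m) < 1"
    using z by (simp add: norm_power power_Suc_less_one power_less_one_iff del: power_Suc)
  then have ne: "z ^ Suc m \<noteq> 1" by (metis norm_one less_irrefl)
  have "?f (Suc m) sums suminf (?f (Suc m))"
    by (rule summable_sums[OF summable_norm_cancel[OF partition_count_norm_summable[OF z]]])
  then have "(\<lambda>j. z ^ Suc m * ?f (Suc m) j) sums (z ^ Suc m * suminf (?f (Suc m)))"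
    by (rule sums_mult)
  moreover define g where "g j = (if Suc m \<le> j then z ^ Suc m * ?f (Suc m) (j - Suc m) else 0)" for j
  have "g (j + Suc m) = z ^ Suc m * ?f (Suc m) j" for j
    by (simp add: g_def del: power_Suc)
  moreover have "(\<Sum>j<Suc m. g j) = 0"
    by (intro sum.neutral) (auto simp: g_def)
  ultimately have "g sums (z ^ Suc m * suminf (?f (Suc m)))"
    using sums_iff_shift[of g "Suc m" "z ^ Suc m * suminf (?f (Suc m))"] by (simp only: add_0_right)
  from sums_add[OF Suc this]
  have "?f (Suc m) sums ((\<Prod>k=1..m. 1 / (1 - z ^ k)) + z ^ Suc m * suminf (?f (Suc m)))"
  proof (rule sums_cong[THEN iffD1, rotated])
    fix j
    show "?f m j + g j = ?f (Suc m) j"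
      by (cases "Suc m \<le> j")
         (simp_all only: g_def partition_count_Suc[of m j] of_nat_add distrib_right if_True if_False
            le_add_diff_inverse mult.left_commute[of _ "of_nat _"] power_add[symmetric] of_nat_0 add_0_right)
  qed
  moreover from this have "suminf (?f (Suc m)) = (\<Prod>k=1..m. 1 / (1 - z ^ k)) + z ^ Suc m * suminf (?f (Suc m))"
    by (simp only: sums_iff)
  then have "suminf (?f (Suc m)) = (\<Prod>k=1..Suc m. 1 / (1 - z ^ k))"
    using ne by (simp add: field_simps del: power_Suc)
  ultimately show ?case by (simp only: sums_iff)
qed

lemma pair_count_sums:
  fixes z :: complex
  assumes z: "norm z < 1"
  shows "(\<lambda>j. of_nat (pair_count m j) * z ^ j) sums (\<Prod>k=1..m. 1 / (1 - z ^ k))\<^sup>2"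
proof -
  let ?f = "\<lambda>j. of_nat (partition_count m j) * z ^ j"
  have "(\<lambda>j. \<Sum>i\<le>j. ?f i * ?f (j - i)) sums ((\<Sum>j. ?f j) * (\<Sum>j. ?f j))"
    by (intro Cauchy_product_sums partition_count_norm_summable z)
  moreover have "(\<Sum>i\<le>j. ?f i * ?f (j - i)) = of_nat (pair_count m j) * z ^ j" for j
  proof -
    have "?f i * ?f (j - i) = of_nat (partition_count m i * partition_count m (j - i)) * z ^ j"
      if "i \<le> j" for i
      using that power_add[of z i "j - i"] by (simp add: mult_ac)
    then show ?thesis
      by (simp add: pair_count_def sum_distrib_right del: of_nat_mult)
  qed
  moreover have "suminf ?f = (\<Prod>k=1..m. 1 / (1 - z ^ k))"
    using partition_count_sums[OF z] by (simp add: sums_iff)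
  ultimately show ?thesis by (simp add: power2_eq_square)
qed

section \<open>The size of a random pair of partitions\<close>

text \<open>Weight a pair of partitions with parts at most \<open>M\<close> and total size \<open>j\<close> by \<open>exp (- j t)\<close>. Then
  \<open>size_prob t M\<close> is the law of the total size, and the multiplicities of the parts are independent
  geometric variables, that of \<open>k\<close> having mean \<open>occupation t k\<close>.\<close>

definition occupation :: "real \<Rightarrow> nat \<Rightarrow> real" where
  "occupation t k = 1 / (exp (real k * t) - 1)"

definition pair_weight :: "real \<Rightarrow> nat \<Rightarrow> real" where
  "pair_weight t M = (\<Prod>k=1..M. 1 / (1 - exp (- (real k * t))))\<^sup>2"

definition size_prob :: "real \<Rightarrow> nat \<Rightarrow> nat \<Rightarrow> real" where
  "size_prob t M j = real (pair_count M j) * exp (- (real j * t)) / pair_weight t M"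

text \<open>The characteristic function, at the point k \<theta>, of a geometric variable on the
  nonnegative integers with mean rho. Parametrised by the mean, the denominator has modulus at least
  1.\<close>

definition size_cf_factor :: "real \<Rightarrow> nat \<Rightarrow> real \<Rightarrow> complex" where
  "size_cf_factor t k \<theta> = 1 / (1 - of_real (occupation t k) * (cis (real k * \<theta>) - 1))"

definition size_cf :: "real \<Rightarrow> nat \<Rightarrow> real \<Rightarrow> complex" where
  "size_cf t M \<theta> = (\<Prod>k=1..M. size_cf_factor t k \<theta>)\<^sup>2"

lemma occupation_pos: "t > 0 \<Longrightarrow> k \<ge> 1 \<Longrightarrow> occupation t k > 0"
  by (simp add: occupation_def)

lemma pair_weight_pos: "t > 0 \<Longrightarrow> pair_weight t M > 0"
  unfolding pair_weight_def by (intro zero_less_power prod_pos) auto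

lemma size_prob_nonneg: "t > 0 \<Longrightarrow> size_prob t M j \<ge> 0"
  using pair_weight_pos[of t M] by (simp add: size_prob_def)

lemma size_cf_denominator_norm:
  "(cmod (1 - of_real \<rho> * (cis x - 1)))\<^sup>2 = 1 + 2 * \<rho> * (1 + \<rho>) * (1 - cos x)"
proof -
  have "(cmod (1 - of_real \<rho> * (cis x - 1)))\<^sup>2 = (1 + \<rho> - \<rho> * cos x)\<^sup>2 + \<rho>\<^sup>2 * (sin x)\<^sup>2"
    by (simp add: cmod_power2 power_mult_distrib algebra_simps)
  also have "\<dots> = 1 + 2 * \<rho> * (1 + \<rho>) * (1 - cos x)"
    unfolding sin_squared_eq by (simp add: power2_eq_square algebra_simps)
  finally show ?thesis .
qed

lemma size_cf_denominator_ge_1: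
  assumes "\<rho> \<ge> 0"
  shows "cmod (1 - of_real \<rho> * (cis x - 1)) \<ge> 1"
proof -
  have "(cmod (1 - of_real \<rho> * (cis x - 1)))\<^sup>2 \<ge> 1\<^sup>2"
    unfolding size_cf_denominator_norm using assms by (simp add: mult_nonneg_nonneg)
  then show ?thesis
    by (rule power2_le_imp_le) simp
qed

lemma size_cf_factor_eq:
  assumes t: "t > 0" and k: "k \<ge> 1"
  shows "1 / (1 - (of_real (exp (- t)) * cis \<theta>) ^ k)
           = of_real (1 / (1 - exp (- (real k * t)))) * size_cf_factor t k \<theta>"
proof -
  define E where "E = exp (real k * t)"
  have E: "E > 1" using t k by (simp add: E_def)
  have z: "(of_real (exp (- t)) * cis \<theta>) ^ k = of_real (1 / E) * cis (real k * \<theta>)"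
  proof -
    have "exp (- t) ^ k = 1 / E"
      by (simp add: E_def exp_minus inverse_eq_divide power_divide exp_of_nat_mult)
    then show ?thesis
      by (simp only: power_mult_distrib Complex.DeMoivre flip: of_real_power)
  qed
  have "1 - of_real (1 / E) * cis (real k * \<theta>)
      = of_real (1 - 1 / E) * (1 - of_real (1 / (E - 1)) * (cis (real k * \<theta>) - 1))"
    using E by (simp add: field_simps)
  then show ?thesis
    unfolding z size_cf_factor_def occupation_def
    by (simp add: E_def[symmetric] exp_minus inverse_eq_divide)
qed

lemma size_cf_sums:
  assumes t: "t > 0"
  shows "(\<lambda>j. of_real (size_prob t M j) * cis (real j * \<theta>)) sums size_cf t M \<theta>"
proof -
  let ?z = "of_real (exp (- t)) * cis \<theta>"
  have "cmod ?z < 1" using t by (simp add: norm_mult)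
  from pair_count_sums[OF this, of M]
  have "(\<lambda>j. of_nat (pair_count M j) * ?z ^ j) sums (\<Prod>k=1..M. 1 / (1 - ?z ^ k))\<^sup>2" .
  also have "(\<Prod>k=1..M. 1 / (1 - ?z ^ k))\<^sup>2 = of_real (pair_weight t M) * size_cf t M \<theta>"
    unfolding pair_weight_def size_cf_def
    by (subst prod.cong[OF refl size_cf_factor_eq[OF t]])
       (simp_all only: prod.distrib power_mult_distrib of_real_prod of_real_power atLeastAtMost_iff)
  finally have "(\<lambda>j. of_nat (pair_count M j) * ?z ^ j / of_real (pair_weight t M)) sums
     (of_real (pair_weight t M) * size_cf t M \<theta> / of_real (pair_weight t M))"
    by (rule sums_divide)
  moreover have "of_nat (pair_count M j) * ?z ^ j / of_real (pair_weight t M)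
      = of_real (size_prob t M j) * cis (real j * \<theta>)" for j
    by (simp add: size_prob_def power_mult_distrib Complex.DeMoivre exp_of_nat_mult[symmetric] flip: of_real_power)
  ultimately show ?thesis
    using pair_weight_pos[OF t, of M] by simp
qed

lemma integral_cis:
  "(LBINT \<theta>:{-pi..pi}. cis (of_int n * \<theta>)) = (if n = 0 then 2 * pi else 0)"
proof (cases "n = 0")
  case True
  then show ?thesis by (simp add: set_lebesgue_integral_def scaleR_conv_of_real)
next
  case False
  have d: "((\<lambda>\<theta>. cis (of_int n * \<theta>) / (\<i> * of_int n)) has_vector_derivative cis (of_int n * x)) (at x within {-pi..pi})" for x
    using False
    by (auto intro!: derivative_eq_intros simp: has_vector_derivative_def scaleR_conv_of_real field_simps)
  have "has_bochner_integral lborel (\<lambda>x. indicator {- pi..pi} x *\<^sub>R cis (of_int n * x))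
      (cis (of_int n * pi) / (\<i> * of_int n) - cis (of_int n * (- pi)) / (\<i> * of_int n))"
    by (rule has_bochner_integral_FTC_Icc[OF _ d]) (auto intro!: continuous_intros)
  moreover have "cis (of_int n * pi) = cis (of_int n * (- pi))"
  proof -
    have "cis (of_int n * pi) = cis (of_int n * (- pi)) * cis (2 * pi * of_int n)"
      unfolding cis_mult by (simp add: algebra_simps)
    then show ?thesis by (simp add: cis_multiple_2pi)
  qed
  ultimately show ?thesis
    using False by (simp add: set_lebesgue_integral_def has_bochner_integral_iff)
qed

lemma size_prob_fourier:
  assumes t: "t > 0"
  shows "(LBINT \<theta>:{-pi..pi}. size_cf t M \<theta> * cis (- (real j * \<theta>))) = 2 * pi * size_prob t M j"
proof -
  define f where "f i \<theta> = indicator {-pi..pi} \<theta> *\<^sub>R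
     (of_real (size_prob t M i) * (cis (of_int (int i - int j) * \<theta>)))" for i \<theta>
  \<comment> \<open>At angle 0 the characteristic series is the series of the probabilities
    themselves. Its summability justifies the termwise integration.\<close>
  have summ: "summable (size_prob t M)"
    using size_cf_sums[OF t, of M 0] by (simp add: sums_iff summable_complex_of_real)
  have f_int: "integral\<^sup>L lborel (f i) = of_real (size_prob t M i) * (if i = j then 2 * pi else 0)" for i
  proof -
    have "integral\<^sup>L lborel (f i) = of_real (size_prob t M i) * (LBINT \<theta>:{-pi..pi}. cis (of_int (int i - int j) * \<theta>))"
      unfolding f_def set_lebesgue_integral_def by (simp add: mult.left_commute scaleR_conv_of_real)
    then show ?thesis unfolding integral_cis by simp
  qed
  have nrm: "norm (f i \<theta>) = indicator {-pi..pi} \<theta> * size_prob t M i" for i \<theta>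
    using size_prob_nonneg[OF t] by (simp add: f_def norm_mult)
  have "(\<lambda>i. integral\<^sup>L lborel (f i)) sums (\<integral>\<theta>. (\<Sum>i. f i \<theta>) \<partial>lborel)"
  proof (rule sums_integral)
    show "integrable lborel (f i)" for i
    proof -
      have "set_integrable lborel {-pi..pi} (\<lambda>\<theta>. of_real (size_prob t M i) * cis (of_int (int i - int j) * \<theta>))"
        by (intro borel_integrable_atLeastAtMost' continuous_intros)
      then show ?thesis by (simp only: set_integrable_def f_def[abs_def])
    qed
    show "AE \<theta> in lborel. summable (\<lambda>i. norm (f i \<theta>))"
      unfolding nrm using summ by (auto intro: summable_mult)
    have "(\<integral>\<theta>. norm (f i \<theta>) \<partial>lborel) = 2 * pi * size_prob t M i" for i
      unfolding nrm by simp
    then show "summable (\<lambda>i. \<integral>\<theta>. norm (f i \<theta>) \<partial>lborel)"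
      using summ by (auto intro: summable_mult)
  qed
  moreover have "(\<Sum>i. f i \<theta>) = indicator {-pi..pi} \<theta> *\<^sub>R (size_cf t M \<theta> * cis (- (real j * \<theta>)))" for \<theta>
  proof -
    have "(\<lambda>i. f i \<theta>) sums (indicator {-pi..pi} \<theta> *\<^sub>R (size_cf t M \<theta> * cis (- (real j * \<theta>))))"
    proof (unfold f_def, rule sums_scaleR_right)
      have "(\<lambda>i. of_real (size_prob t M i) * cis (real i * \<theta>) * cis (- (real j * \<theta>)))
          sums (size_cf t M \<theta> * cis (- (real j * \<theta>)))"
        by (intro sums_mult2 size_cf_sums t)
      then show "(\<lambda>i. of_real (size_prob t M i) * (cis (of_int (int i - int j) * \<theta>)))
          sums (size_cf t M \<theta> * cis (- (real j * \<theta>)))"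
        by (simp add: mult.assoc cis_mult left_diff_distrib)
    qed
    then show ?thesis by (simp add: sums_iff)
  qed
  ultimately have "(\<lambda>i. of_real (size_prob t M i) * (if i = j then 2 * pi else 0)) sums
      (LBINT \<theta>:{-pi..pi}. size_cf t M \<theta> * cis (- (real j * \<theta>)))"
    by (simp add: f_int set_lebesgue_integral_def)
  moreover have "(\<lambda>i. of_real (size_prob t M i) * (if i = j then 2 * pi else 0)) sums
      (of_real (size_prob t M j) * (2 * pi) :: complex)"
    using sums_single[of j "\<lambda>i. of_real (size_prob t M i) * (2 * pi) :: complex"]
    by (simp add: if_distrib cong: if_cong)
  ultimately show ?thesis
    by (simp add: sums_iff mult.commute)
qed

section \<open>Decay of the characteristic function\<close>

lemma norm_size_cf_factor_le_1: "t > 0 \<Longrightarrow> k \<ge> 1 \<Longrightarrow> norm (size_cf_factor t k \<theta>) \<le> 1"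
  using size_cf_denominator_ge_1[of "occupation t k" "real k * \<theta>"] occupation_pos[of t k]
  by (simp add: size_cf_factor_def norm_divide divide_le_eq_1)

lemma norm_size_cf:
  "norm (size_cf t M \<theta>) = (\<Prod>k=1..M. (norm (size_cf_factor t k \<theta>))\<^sup>2)"
  unfolding size_cf_def norm_power prod_norm[symmetric] prod_power_distrib ..

lemma norm_size_cf_antimono:
  assumes "t > 0" "N \<le> M"
  shows "norm (size_cf t M \<theta>) \<le> norm (size_cf t N \<theta>)"
  unfolding norm_size_cf
proof -
  have "(\<Prod>k\<in>{1..N} \<union> {N<..M}. (norm (size_cf_factor t k \<theta>))\<^sup>2)
      = (\<Prod>k=1..N. (norm (size_cf_factor t k \<theta>))\<^sup>2) * (\<Prod>k\<in>{N<..M}. (norm (size_cf_factor t k \<theta>))\<^sup>2)"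
    by (rule prod.union_disjoint) auto
  moreover have "{1..N} \<union> {N<..M} = {1..M}" using assms by auto
  moreover have "(\<Prod>k\<in>{N<..M}. (norm (size_cf_factor t k \<theta>))\<^sup>2) \<le> 1"
    using assms norm_size_cf_factor_le_1 by (intro prod_le_1) (auto simp: power_le_one)
  ultimately show "(\<Prod>k=1..M. (norm (size_cf_factor t k \<theta>))\<^sup>2) \<le> (\<Prod>k=1..N. (norm (size_cf_factor t k \<theta>))\<^sup>2)"
    by (simp add: mult_left_le prod_nonneg)
qed

text \<open>The cubic Taylor error is at most half of the linear term because (pi/2)^2 < 3.\<close>

lemma abs_sin_ge:
  fixes y :: real
  assumes "\<bar>y\<bar> \<le> pi / 2"
  shows "\<bar>sin y\<bar> \<ge> \<bar>y\<bar> / 2"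
proof -
  have "\<bar>sin y - (\<Sum>m<3. sin_coeff m * y ^ m)\<bar> \<le> inverse (fact 3) * \<bar>y\<bar> ^ 3"
    by (rule Maclaurin_sin_bound)
  then have "\<bar>sin y - y\<bar> \<le> \<bar>y\<bar> ^ 3 / 6"
    by (simp add: sin_coeff_def numeral_3_eq_3 fact_numeral)
  moreover have "\<bar>y\<bar> ^ 3 / 6 \<le> \<bar>y\<bar> / 2"
  proof -
    have "\<bar>y\<bar> \<le> 8 / 5" using assms pi_approx by simp
    then have "\<bar>y\<bar>\<^sup>2 \<le> (8 / 5)\<^sup>2" by (intro power_mono) auto
    then have "\<bar>y\<bar>\<^sup>2 \<le> 3" by (simp add: power2_eq_square)
    then have "\<bar>y\<bar> * \<bar>y\<bar>\<^sup>2 \<le> \<bar>y\<bar> * 3" by (intro mult_left_mono) auto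
    then show ?thesis by (simp add: power2_eq_square power3_eq_cube)
  qed
  ultimately show ?thesis by linarith
qed

text \<open>The Dirichlet kernel, multiplied out so that zeros of the sine need no separate
  treatment.\<close>

lemma sum_cos_dirichlet:
  fixes \<theta> :: real
  shows "2 * sin (\<theta> / 2) * (\<Sum>k=1..N. cos (real k * \<theta>)) = sin (real N * \<theta> + \<theta> / 2) - sin (\<theta> / 2)"
proof (induction N)
  case (Suc N)
  have "2 * sin (\<theta> / 2) * cos (real (Suc N) * \<theta>)
      = sin (real (Suc N) * \<theta> + \<theta> / 2) - sin (real (Suc N) * \<theta> - \<theta> / 2)"
    unfolding sin_add sin_diff by simp
  moreover have "real (Suc N) * \<theta> - \<theta> / 2 = real N * \<theta> + \<theta> / 2" by (simp add: field_simps)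
  moreover have "(\<Sum>k=1..Suc N. cos (real k * \<theta>)) = (\<Sum>k=1..N. cos (real k * \<theta>)) + cos (real (Suc N) * \<theta>)"
    by simp
  ultimately show ?case using Suc by (simp only: distrib_left)
qed simp

text \<open>As long as N |\<theta>| \<le> pi no angle wraps around: 1 - cos (k \<theta>) = 2 sin^2
  (k \<theta> / 2) is at least k^2 \<theta>^2 / 8, and the squares sum to at least N^3 / 3. Beyond
  that point the Dirichlet kernel bounds the sum of the cosines by 2 N / 3.14 + 1/2, which for N
  \<ge> 2 leaves at least N / 10.\<close>

lemma sum_one_minus_cos_ge:
  fixes \<theta> :: real
  assumes N: "N \<ge> 2" and \<theta>: "\<bar>\<theta>\<bar> \<le> pi"
  shows "(\<Sum>k=1..N. 1 - cos (real k * \<theta>)) \<ge> (if real N * \<bar>\<theta>\<bar> \<le> pi then real N ^ 3 * \<theta>\<^sup>2 / 24 else real N / 10)"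
proof (cases "real N * \<bar>\<theta>\<bar> \<le> pi")
  case True
  have "1 - cos (real k * \<theta>) \<ge> (real k)\<^sup>2 * \<theta>\<^sup>2 / 8" if "k \<in> {1..N}" for k
  proof -
    have "real k * \<bar>\<theta>\<bar> \<le> real N * \<bar>\<theta>\<bar>" using that by (intro mult_right_mono) auto
    with True have "\<bar>real k * \<theta> / 2\<bar> \<le> pi / 2" by (simp add: abs_mult)
    then have "\<bar>real k * \<theta> / 2\<bar> / 2 \<le> \<bar>sin (real k * \<theta> / 2)\<bar>" by (rule abs_sin_ge)
    then have "(\<bar>real k * \<theta> / 2\<bar> / 2)\<^sup>2 \<le> \<bar>sin (real k * \<theta> / 2)\<bar>\<^sup>2" by (intro power_mono) auto
    moreover have "1 - cos (real k * \<theta>) = 2 * (sin (real k * \<theta> / 2))\<^sup>2"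
      using cos_double_sin[of "real k * \<theta> / 2"] by simp
    ultimately show ?thesis by (simp add: power_divide power_mult_distrib)
  qed
  then have "(\<Sum>k=1..N. (real k)\<^sup>2 * \<theta>\<^sup>2 / 8) \<le> (\<Sum>k=1..N. 1 - cos (real k * \<theta>))"
    by (intro sum_mono)
  moreover have "(\<Sum>k=1..N. (real k)\<^sup>2 * \<theta>\<^sup>2 / 8) = (\<Sum>k=1..N. (real k)\<^sup>2) * (\<theta>\<^sup>2 / 8)"
    by (simp add: sum_distrib_right)
  moreover have "(\<Sum>k=1..n. (real k)\<^sup>2) \<ge> real n ^ 3 / 3" for n
    by (induction n) (auto simp: power2_eq_square power3_eq_cube field_simps)
  from mult_right_mono[OF this[of N], of "\<theta>\<^sup>2 / 8"]
  have "real N ^ 3 * \<theta>\<^sup>2 / 24 \<le> (\<Sum>k=1..N. (real k)\<^sup>2) * (\<theta>\<^sup>2 / 8)" by simp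
  ultimately have "real N ^ 3 * \<theta>\<^sup>2 / 24 \<le> (\<Sum>k=1..N. 1 - cos (real k * \<theta>))" by linarith
  then show ?thesis using True by simp
next
  case False
  let ?D = "\<Sum>k=1..N. cos (real k * \<theta>)" and ?s = "sin (\<theta> / 2)"
  have th: "\<bar>\<theta>\<bar> > 0" using False by (auto intro: ccontr)
  have s: "\<bar>?s\<bar> \<ge> \<bar>\<theta>\<bar> / 4" using abs_sin_ge[of "\<theta> / 2"] \<theta> by simp
  have "2 * \<bar>?s\<bar> * ?D \<le> 1 + \<bar>?s\<bar>"
  proof -
    have "2 * \<bar>?s\<bar> * ?D \<le> \<bar>2 * ?s * ?D\<bar>" by (simp add: abs_mult mult_left_mono)
    also have "\<dots> \<le> 1 + \<bar>?s\<bar>"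
      unfolding sum_cos_dirichlet using abs_sin_le_one[of "real N * \<theta> + \<theta> / 2"] by linarith
    finally show ?thesis .
  qed
  then have "?D \<le> 1 / (2 * \<bar>?s\<bar>) + 1 / 2"
    using s th by (simp add: field_simps)
  also have "1 / (2 * \<bar>?s\<bar>) \<le> 1 / (\<bar>\<theta>\<bar> / 2)"
    using s th by (intro divide_left_mono) (auto intro!: mult_pos_pos)
  also have "1 / (\<bar>\<theta>\<bar> / 2) \<le> 2 * real N / pi"
    using False th by (simp add: field_simps)
  also have "2 * real N / pi \<le> 2 * real N / 3.14"
    using pi_approx by (intro divide_left_mono) auto
  finally have "?D \<le> 2 * real N / 3.14 + 1 / 2" by simp
  moreover have "(\<Sum>k=1..N. 1 - cos (real k * \<theta>)) = real N - ?D"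
    by (simp add: sum_subtractf)
  ultimately show ?thesis using False N by simp
qed

text \<open>With c = 1 - cos (k \<theta>) the squared modulus is 1 / (1 + 2 rho (1 + rho) c). For k
  t \<le> 1 the variance rho (1 + rho) of the multiplicity is at least 1/3, and 1 + 2 c / 3
  dominates exp (c / 3) for 0 \<le> c \<le> 2.\<close>

lemma norm_size_cf_factor_small:
  assumes t: "t > 0" and k: "k \<ge> 1" "real k * t \<le> 1"
  shows "(norm (size_cf_factor t k \<theta>))\<^sup>2 \<le> exp (- (1 - cos (real k * \<theta>)) / 3)"
proof -
  define x where "x = real k * t"
  have x: "0 < x" "x \<le> 1" using t k by (auto simp: x_def)
  define c where "c = 1 - cos (real k * \<theta>)"
  have c: "0 \<le> c" "c \<le> 2" using cos_ge_minus_one[of "real k * \<theta>"] by (auto simp: c_def)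
  let ?\<rho> = "occupation t k"
  have "exp x - 1 \<le> x * exp x"
    using exp_ge_add_one_self[of "-x"] by (simp add: exp_minus field_simps)
  then have "(exp x - 1)\<^sup>2 \<le> (x * exp x)\<^sup>2" using x by (intro power_mono) auto
  also have "\<dots> \<le> (exp x)\<^sup>2" using x by (auto simp: power_mult_distrib power_le_one mult_left_le_one_le)
  also have "\<dots> = exp x * exp x" by (simp add: power2_eq_square)
  also have "\<dots> \<le> 3 * exp x"
    using x exp_le by (intro mult_right_mono) (auto intro: order_trans[OF _ exp_le])
  finally have "1 / 3 \<le> exp x / (exp x - 1)\<^sup>2" using x by (simp add: divide_simps mult.commute)
  moreover have "?\<rho> = 1 / (exp x - 1)" by (simp add: occupation_def x_def)
  moreover have "1 / (exp x - 1) * (1 + 1 / (exp x - 1)) = exp x / (exp x - 1)\<^sup>2"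
  proof -
    have "1 + 1 / (exp x - 1) = exp x / (exp x - 1)" using x by (simp add: field_simps)
    then show ?thesis by (simp add: power2_eq_square)
  qed
  ultimately have rho: "?\<rho> * (1 + ?\<rho>) \<ge> 1 / 3"
    by (simp only:)
  have "exp (c / 3) \<le> 1 + c / 3 + (c / 3)\<^sup>2" using c by (intro exp_bound) auto
  also have "\<dots> \<le> 1 + 2 * c / 3"
    using mult_left_mono[OF c(2) c(1)] c by (simp add: power2_eq_square)
  also have "\<dots> \<le> 1 + 2 * (?\<rho> * (1 + ?\<rho>)) * c"
    using mult_right_mono[OF rho c(1)] unfolding mult.assoc by linarith
  finally have e: "exp (c / 3) \<le> 1 + 2 * ?\<rho> * (1 + ?\<rho>) * c" by (simp only: mult.assoc)
  have "(norm (size_cf_factor t k \<theta>))\<^sup>2 = 1 / (1 + 2 * ?\<rho> * (1 + ?\<rho>) * c)"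
    unfolding size_cf_factor_def norm_divide power_divide size_cf_denominator_norm c_def by simp
  also have "\<dots> \<le> 1 / exp (c / 3)"
    by (rule divide_left_mono[OF e zero_le_one mult_pos_pos[OF less_le_trans[OF exp_gt_zero e] exp_gt_zero]])
  also have "1 / exp (c / 3) = exp (- c / 3)"
    by (simp add: exp_minus inverse_eq_divide)
  finally show ?thesis unfolding c_def .
qed

text \<open>Only the factors with \<open>k \<le> 1 / t\<close> are used, so that the bound is uniform in \<open>M\<close>.\<close>

lemma norm_size_cf_decay:
  obtains C where "C > 0"
    "\<And>t M \<theta>. 0 < t \<Longrightarrow> t \<le> 1 / 2 \<Longrightarrow> 1 / t \<le> real M \<Longrightarrow> \<bar>\<theta>\<bar> \<le> pi \<Longrightarrow>
       norm (size_cf t M \<theta>) \<le> C / (1 + \<theta>\<^sup>2 / t ^ 3)\<^sup>2"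
proof
  \<comment> \<open>One summand for each regime of \<open>sum_one_minus_cos_ge\<close>. Small
    angles: N \<ge> 1 / (2 t) turns N^3 \<theta>^2 / 24 into w / 192, and 576 = 3 * 192. Large
    angles: (1 + w)^2 is at most 121 / t^6, which is absorbed by the sixth power of exp (1 / (360
    t)).\<close>
  define C :: real where "C = 121 * 360 ^ 6 + 2 * 576\<^sup>2"
  show "C > 0" by (simp add: C_def)
  fix t :: real and M :: nat and \<theta> :: real
  assume t: "0 < t" "t \<le> 1 / 2" and M: "1 / t \<le> real M" and \<theta>: "\<bar>\<theta>\<bar> \<le> pi"
  define N where "N = nat \<lfloor>1 / t\<rfloor>"
  define w where "w = \<theta>\<^sup>2 / t ^ 3"
  have w: "w \<ge> 0" using t by (simp add: w_def)
  have t2: "1 / t \<ge> 2" using t by (simp add: field_simps)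
  have N2: "N \<ge> 2" and NM: "N \<le> M" and Nt: "real N * t \<le> 1" and Ng: "real N \<ge> 1 / (2 * t)"
  proof -
    have "\<lfloor>1 / t\<rfloor> \<ge> 2" using t2 by (simp add: le_floor_iff)
    then show "N \<ge> 2" unfolding N_def by linarith
    have N: "real N = of_int \<lfloor>1 / t\<rfloor>" using t by (simp add: N_def)
    then have "real N \<le> 1 / t" by (simp only: of_int_floor_le)
    then show "real N * t \<le> 1" using t by (simp add: field_simps)
    have "real N \<le> real M" using \<open>real N \<le> 1 / t\<close> M by linarith
    then show "N \<le> M" by simp
    have "real N > 1 / t - 1" unfolding N using floor_correct[of "1 / t"] by linarith
    then show "real N \<ge> 1 / (2 * t)" using t2 by simp
  qed
  let ?S = "\<Sum>k=1..N. 1 - cos (real k * \<theta>)"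
  have "norm (size_cf t M \<theta>) \<le> norm (size_cf t N \<theta>)"
    by (rule norm_size_cf_antimono) (use t NM in auto)
  also have "\<dots> \<le> (\<Prod>k=1..N. exp (- (1 - cos (real k * \<theta>)) / 3))"
    unfolding norm_size_cf
  proof (intro prod_mono conjI norm_size_cf_factor_small)
    fix k assume "k \<in> {1..N}"
    then have "real k * t \<le> real N * t" using t by (intro mult_right_mono) auto
    then show "real k * t \<le> 1" using Nt by linarith
  qed (use t in auto)
  also have "\<dots> = exp (- ?S / 3)"
    by (simp add: exp_sum[symmetric] sum_negf sum_divide_distrib[symmetric] del: minus_diff_eq)
  finally have n: "norm (size_cf t M \<theta>) \<le> exp (- ?S / 3)" .
  have "(1 + w)\<^sup>2 \<le> C * exp (?S / 3)"
  proof (cases "real N * \<bar>\<theta>\<bar> \<le> pi")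
    case True
    have "w / 192 = (1 / (2 * t)) ^ 3 * \<theta>\<^sup>2 / 24" by (simp add: w_def power_mult_distrib power_divide)
    also have "\<dots> \<le> real N ^ 3 * \<theta>\<^sup>2 / 24"
      using Ng t by (intro divide_right_mono mult_right_mono power_mono) auto
    also have "\<dots> \<le> ?S" using sum_one_minus_cos_ge[OF N2 \<theta>] True by simp
    finally have S: "w / 576 \<le> ?S / 3" by simp
    have "(1 + w)\<^sup>2 \<le> 2 * 576\<^sup>2 * (1 + w / 576 + (w / 576)\<^sup>2 / 2)"
      using w by (simp add: power2_eq_square algebra_simps)
    also have "\<dots> \<le> 2 * 576\<^sup>2 * exp (w / 576)"
      using w by (intro mult_left_mono exp_lower_Taylor_quadratic) auto
    also have "\<dots> \<le> C * exp (?S / 3)"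
      using S by (intro mult_mono) (auto simp: C_def)
    finally show ?thesis .
  next
    case False
    have "1 / (20 * t) \<le> real N / 10" using Ng by simp
    also have "\<dots> \<le> ?S" using sum_one_minus_cos_ge[OF N2 \<theta>] False by simp
    finally have S: "1 / (60 * t) \<le> ?S / 3" by simp
    have "\<theta>\<^sup>2 \<le> pi\<^sup>2" using power_mono[OF \<theta>, of 2] by simp
    also have "\<dots> \<le> (3.15)\<^sup>2" using pi_approx by (intro power_mono) auto
    finally have "\<theta>\<^sup>2 \<le> 10" by (simp add: power2_eq_square)
    then have "w \<le> 10 / t ^ 3" unfolding w_def using t by (intro divide_right_mono) auto
    moreover have "1 \<le> 1 / t ^ 3" using t by (simp add: power_le_one)
    ultimately have "1 + w \<le> 11 / t ^ 3" by simp
    then have "(1 + w)\<^sup>2 \<le> (11 / t ^ 3)\<^sup>2" using w by (intro power_mono) auto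
    also have "\<dots> = 121 * 360 ^ 6 * (1 / (60 * t) / 6) ^ 6"
      using t by (simp add: power_divide power_mult_distrib flip: power_mult)
    also have "\<dots> \<le> 121 * 360 ^ 6 * exp (1 / (60 * t) / 6) ^ 6"
    proof (intro mult_left_mono power_mono)
      show "1 / (60 * t) / 6 \<le> exp (1 / (60 * t) / 6)"
        using exp_ge_add_one_self[of "1 / (60 * t) / 6"] by linarith
    qed (use t in auto)
    also have "exp (1 / (60 * t) / 6) ^ 6 = exp (1 / (60 * t))"
      by (simp flip: exp_of_nat_mult)
    also have "121 * 360 ^ 6 * exp (1 / (60 * t)) \<le> C * exp (?S / 3)"
      using S by (intro mult_mono) (auto simp: C_def)
    finally show ?thesis .
  qed
  then have "exp (- ?S / 3) \<le> C / (1 + w)\<^sup>2"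
    using w by (simp add: exp_minus field_simps)
  with n show "norm (size_cf t M \<theta>) \<le> C / (1 + \<theta>\<^sup>2 / t ^ 3)\<^sup>2"
    unfolding w_def by linarith
qed

section \<open>Integrals against the Cauchy kernel\<close>

lemma integrable_inverse_1_plus_sq: "integrable lborel (\<lambda>u::real. 1 / (1 + u\<^sup>2))"
  using integrable_inverse_1_plus_square
  by (simp add: set_integrable_def inverse_eq_divide)

lemma integral_inverse_1_plus_sq: "(\<integral>u. 1 / (1 + u\<^sup>2) \<partial>lborel) = pi"
  using LBINT_inverse_1_plus_square
  by (simp add: interval_lebesgue_integral_def set_lebesgue_integral_def inverse_eq_divide)

lemma one_plus_sq_gt_0: "1 + (u::real)\<^sup>2 > 0"
  by (simp add: add_pos_nonneg)

text \<open>The decay of \<open>size_cf\<close> has a square to spare: the second bound pays for a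
  factor |u|, which appears when two truncations are compared, and still ends at an integrable
  kernel.\<close>

lemma kernel_le:
  "1 / (1 + (u::real)\<^sup>2)\<^sup>2 \<le> 1 / (1 + u\<^sup>2)" "\<bar>u\<bar> / (1 + (u::real)\<^sup>2)\<^sup>2 \<le> 1 / (1 + u\<^sup>2)"
proof -
  have a: "1 + u\<^sup>2 \<ge> 1" by simp
  have "0 \<le> (\<bar>u\<bar> - 1)\<^sup>2" by simp
  then have b: "\<bar>u\<bar> \<le> 1 + u\<^sup>2" by (simp add: power2_eq_square algebra_simps)
  have e: "1 / (1 + u\<^sup>2) = (1 + u\<^sup>2) / (1 + u\<^sup>2)\<^sup>2"
    using one_plus_sq_gt_0[of u] by (simp add: power2_eq_square[of "1 + u\<^sup>2"])
  show "1 / (1 + (u::real)\<^sup>2)\<^sup>2 \<le> 1 / (1 + u\<^sup>2)"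
    unfolding e using a by (intro divide_right_mono) auto
  show "\<bar>u\<bar> / (1 + (u::real)\<^sup>2)\<^sup>2 \<le> 1 / (1 + u\<^sup>2)"
    unfolding e using b by (intro divide_right_mono) auto
qed

lemma norm_integral_le_kernel:
  fixes F :: "real \<Rightarrow> complex"
  assumes s: "s > 0" and A: "A \<ge> 0"
    and F: "\<And>\<theta>. \<bar>\<theta>\<bar> \<le> pi \<Longrightarrow> norm (F \<theta>) \<le> A / (1 + (\<theta> / s)\<^sup>2)"
  shows "norm (LBINT \<theta>:{-pi..pi}. F \<theta>) \<le> pi * A * s"
proof -
  let ?g = "\<lambda>\<theta>. A * (1 / (1 + (0 + (1 / s) * \<theta>)\<^sup>2))"
  have int: "integrable lborel ?g"
    using s by (intro integrable_mult_right lborel_integrable_real_affine integrable_inverse_1_plus_sq) auto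
  have "(\<integral>u. 1 / (1 + u\<^sup>2) \<partial>lborel) = \<bar>1 / s\<bar> *\<^sub>R (\<integral>\<theta>. 1 / (1 + (0 + (1 / s) * \<theta>)\<^sup>2) \<partial>lborel)"
    using s by (intro lborel_integral_real_affine) auto
  then have "(\<integral>\<theta>. 1 / (1 + (0 + (1 / s) * \<theta>)\<^sup>2) \<partial>lborel) = pi * s"
    using s unfolding integral_inverse_1_plus_sq by (simp only: real_scaleR_def) (simp add: divide_simps mult_ac)
  then have g: "(\<integral>\<theta>. ?g \<theta> \<partial>lborel) = pi * A * s"
    by (simp only: integral_mult_right_zero) simp
  show ?thesis
  proof (cases "set_integrable lborel {-pi..pi} F")
    case True
    have "norm (\<integral>\<theta>. indicator {-pi..pi} \<theta> *\<^sub>R F \<theta> \<partial>lborel) \<le> (\<integral>\<theta>. ?g \<theta> \<partial>lborel)"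
    proof (rule Bochner_Integration.integral_norm_bound_integral)
      fix \<theta> :: real
      show "norm (indicator {-pi..pi} \<theta> *\<^sub>R F \<theta>) \<le> ?g \<theta>"
        using F[of \<theta>] A one_plus_sq_gt_0[of "\<theta> / s"] by (auto simp: indicator_def)
    qed (use True int in \<open>auto simp: set_integrable_def\<close>)
    then show ?thesis unfolding g by (simp add: set_lebesgue_integral_def)
  next
    \<comment> \<open>A function that is not integrable has Bochner integral 0, so the lemma needs
      no integrability hypothesis.\<close>
    case False
    then have "(LBINT \<theta>:{-pi..pi}. F \<theta>) = 0"
      by (simp add: set_integrable_def set_lebesgue_integral_def not_integrable_integral_eq)
    then show ?thesis using A s by simp
  qed
qed

lemma continuous_on_size_cf:
  assumes "t > 0"
  shows "continuous_on UNIV (size_cf t M)"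
proof -
  have "1 - of_real (occupation t k) * (cis (real k * \<theta>) - 1) \<noteq> 0" if "k \<in> {1..M}" for k \<theta>
    using size_cf_denominator_ge_1[of "occupation t k" "real k * \<theta>"] occupation_pos[of t k] that assms
    by auto
  then show ?thesis
    unfolding size_cf_def size_cf_factor_def by (intro continuous_intros) auto
qed

lemma set_integrable_size_cf:
  assumes "t > 0"
  shows "set_integrable lborel {-pi..pi} (\<lambda>\<theta>. size_cf t M \<theta> * cis (- (real j * \<theta>)))"
  by (intro borel_integrable_atLeastAtMost' continuous_intros
      continuous_on_subset[OF continuous_on_size_cf[OF assms]]) auto

text \<open>The inverse of the order of the standard deviation of the total size.\<close>

abbreviation size_scale :: "real \<Rightarrow> real" where
  "size_scale t \<equiv> t * sqrt t"

lemma size_scale_sq: "t \<ge> 0 \<Longrightarrow> (size_scale t)\<^sup>2 = t ^ 3"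
  by (simp add: power_mult_distrib power3_eq_cube power2_eq_square)

lemma size_cf_decay_scaled:
  obtains C where "C > 0"
    "\<And>t M \<theta>. 0 < t \<Longrightarrow> t \<le> 1 / 2 \<Longrightarrow> 1 / t \<le> real M \<Longrightarrow> \<bar>\<theta>\<bar> \<le> pi \<Longrightarrow>
       norm (size_cf t M \<theta>) \<le> C / (1 + (\<theta> / size_scale t)\<^sup>2)\<^sup>2"
  using norm_size_cf_decay by (auto simp: power_divide size_scale_sq)

lemma size_prob_upper:
  obtains C where "C > 0"
    "\<And>t M j. 0 < t \<Longrightarrow> t \<le> 1 / 2 \<Longrightarrow> 1 / t \<le> real M \<Longrightarrow> size_prob t M j \<le> C * size_scale t"
proof -
  obtain C where C: "C > 0" and dec:
    "\<And>t M \<theta>. 0 < t \<Longrightarrow> t \<le> 1 / 2 \<Longrightarrow> 1 / t \<le> real M \<Longrightarrow> \<bar>\<theta>\<bar> \<le> pi \<Longrightarrow>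
       norm (size_cf t M \<theta>) \<le> C / (1 + (\<theta> / size_scale t)\<^sup>2)\<^sup>2"
    using size_cf_decay_scaled by blast
  show ?thesis
  proof (rule that[of C])
    fix t :: real and M j :: nat
    assume t: "0 < t" "t \<le> 1 / 2" "1 / t \<le> real M"
    have "norm (LBINT \<theta>:{-pi..pi}. size_cf t M \<theta> * cis (- (real j * \<theta>))) \<le> pi * C * size_scale t"
    proof (rule norm_integral_le_kernel)
      fix \<theta> :: real assume "\<bar>\<theta>\<bar> \<le> pi"
      have "norm (size_cf t M \<theta> * cis (- (real j * \<theta>))) \<le> C / (1 + (\<theta> / size_scale t)\<^sup>2)\<^sup>2"
        using dec[OF t \<open>\<bar>\<theta>\<bar> \<le> pi\<close>] by (simp add: norm_mult)
      also have "\<dots> \<le> C * (1 / (1 + (\<theta> / size_scale t)\<^sup>2))"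
        using mult_left_mono[OF kernel_le(1), of C "\<theta> / size_scale t"] C by simp
      finally show "norm (size_cf t M \<theta> * cis (- (real j * \<theta>))) \<le> C / (1 + (\<theta> / size_scale t)\<^sup>2)"
        by simp
    qed (use t C in auto)
    then have "2 * pi * size_prob t M j \<le> pi * C * size_scale t"
      unfolding size_prob_fourier[OF t(1)] using size_prob_nonneg[OF t(1), of M j] by (simp add: norm_mult)
    then have "pi * (2 * size_prob t M j) \<le> pi * (C * size_scale t)"
      by (simp only: mult_ac)
    then have "2 * size_prob t M j \<le> C * size_scale t"
      by (rule mult_left_le_imp_le) simp
    then show "size_prob t M j \<le> C * size_scale t"
      using size_prob_nonneg[OF t(1), of M j] by linarith
  qed (rule C)
qed

section \<open>Effect of truncating the parts\<close>

lemma norm_cis_minus_1_le: "norm (cis x - 1) \<le> \<bar>x\<bar>"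
  using iexp_approx1[of x 0] by (simp add: cis_conv_exp)

lemma norm_one_minus_factor_le:
  assumes "t > 0" "k \<ge> 1"
  shows "norm (1 - size_cf_factor t k \<theta>) \<le> real k * occupation t k * \<bar>\<theta>\<bar>"
proof -
  let ?\<rho> = "occupation t k" and ?c = "cis (real k * \<theta>) - 1"
  let ?D = "1 - of_real ?\<rho> * ?c"
  have rho: "?\<rho> > 0" by (rule occupation_pos[OF assms])
  then have D: "norm ?D \<ge> 1" by (intro size_cf_denominator_ge_1) auto
  then have ne: "?D \<noteq> 0" by auto
  have "1 - size_cf_factor t k \<theta> = - (of_real ?\<rho> * ?c) / ?D"
    using ne by (simp add: size_cf_factor_def diff_divide_eq_iff)
  then have "norm (1 - size_cf_factor t k \<theta>) = ?\<rho> * norm ?c / norm ?D"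
    using rho by (simp add: norm_divide norm_mult)
  also have "\<dots> \<le> ?\<rho> * norm ?c"
  proof -
    have le: "x / d \<le> x" if "1 \<le> d" "0 \<le> x" for x d :: real
      using that by (simp add: divide_le_eq mult_le_cancel_left1)
    show ?thesis by (rule le[OF D]) (use rho in simp)
  qed
  also have "\<dots> \<le> ?\<rho> * \<bar>real k * \<theta>\<bar>"
    using rho by (intro mult_left_mono norm_cis_minus_1_le) auto
  finally show ?thesis by (simp add: abs_mult mult_ac)
qed

text \<open>The common factors are pulled out, which preserves the decay in \<theta>; the remaining
  ones lie in the unit disc, where a product differs from 1 by at most the sum of the differences of
  its factors. The 2 comes from the square in \<open>size_cf\<close>.\<close>

lemma norm_size_cf_diff_le:
  assumes t: "t > 0" and M: "M \<le> M'"
  shows "norm (size_cf t M \<theta> - size_cf t M' \<theta>)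
           \<le> norm (size_cf t M \<theta>) * (2 * \<bar>\<theta>\<bar> * (\<Sum>k\<in>{M<..M'}. real k * occupation t k))"
proof -
  let ?f = "\<lambda>k. size_cf_factor t k \<theta>"
  have "prod ?f ({1..M} \<union> {M<..M'}) = prod ?f {1..M} * prod ?f {M<..M'}"
    by (rule prod.union_disjoint) auto
  moreover have "{1..M} \<union> {M<..M'} = {1..M'}" using M by auto
  ultimately have "size_cf t M' \<theta> = size_cf t M \<theta> * (\<Prod>k\<in>{M<..M'}. (?f k)\<^sup>2)"
    by (simp add: size_cf_def power_mult_distrib prod_power_distrib)
  then have "size_cf t M \<theta> - size_cf t M' \<theta> = size_cf t M \<theta> * ((\<Prod>k\<in>{M<..M'}. 1) - (\<Prod>k\<in>{M<..M'}. (?f k)\<^sup>2))"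
    by (simp add: right_diff_distrib)
  then have "norm (size_cf t M \<theta> - size_cf t M' \<theta>)
      = norm (size_cf t M \<theta>) * norm ((\<Prod>k\<in>{M<..M'}. 1) - (\<Prod>k\<in>{M<..M'}. (?f k)\<^sup>2))"
    by (simp add: norm_mult)
  also have "norm ((\<Prod>k\<in>{M<..M'}. 1) - (\<Prod>k\<in>{M<..M'}. (?f k)\<^sup>2)) \<le> (\<Sum>k\<in>{M<..M'}. norm (1 - (?f k)\<^sup>2))"
    using norm_size_cf_factor_le_1[OF t] by (intro norm_prod_diff) (auto simp: norm_power power_le_one)
  also have "\<dots> \<le> (\<Sum>k\<in>{M<..M'}. 2 * \<bar>\<theta>\<bar> * (real k * occupation t k))"
  proof (intro sum_mono)
    fix k assume k: "k \<in> {M<..M'}"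
    have "1 - (?f k)\<^sup>2 = (1 - ?f k) * (1 + ?f k)" by (simp add: power2_eq_square algebra_simps)
    then have "norm (1 - (?f k)\<^sup>2) = norm (1 - ?f k) * norm (1 + ?f k)" by (simp add: norm_mult)
    also have "\<dots> \<le> (real k * occupation t k * \<bar>\<theta>\<bar>) * 2"
      using norm_one_minus_factor_le[OF t, of k \<theta>] norm_size_cf_factor_le_1[OF t, of k \<theta>] k
        norm_triangle_ineq[of 1 "?f k"]
      occupation_pos[OF t, of k]
      by (intro mult_mono) auto
    finally show "norm (1 - (?f k)\<^sup>2) \<le> 2 * \<bar>\<theta>\<bar> * (real k * occupation t k)" by (simp add: mult_ac)
  qed
  finally show ?thesis by (simp add: sum_distrib_left mult_left_mono)
qed

text \<open>The factors that distinguish \<open>M\<close> from \<open>M'\<close> are \<open>1 + O(k \<rho> \<bar>\<theta>\<bar>)\<close>, and \<open>\<theta>\<close> is of the order of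
  \<open>size_scale t\<close>; hence truncating the parts needs no expansion of the local probabilities.\<close>

lemma size_prob_diff:
  obtains C where "C > 0"
    "\<And>t M M' j. 0 < t \<Longrightarrow> t \<le> 1 / 2 \<Longrightarrow> 1 / t \<le> real M \<Longrightarrow> M \<le> M' \<Longrightarrow>
       \<bar>size_prob t M j - size_prob t M' j\<bar> \<le> C * t ^ 3 * (\<Sum>k\<in>{M<..M'}. real k * occupation t k)"
proof -
  obtain C where C: "C > 0" and dec:
    "\<And>t M \<theta>. 0 < t \<Longrightarrow> t \<le> 1 / 2 \<Longrightarrow> 1 / t \<le> real M \<Longrightarrow> \<bar>\<theta>\<bar> \<le> pi \<Longrightarrow>
       norm (size_cf t M \<theta>) \<le> C / (1 + (\<theta> / size_scale t)\<^sup>2)\<^sup>2"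
    using size_cf_decay_scaled by blast
  show ?thesis
  proof (rule that[of C])
    fix t :: real and M M' j :: nat
    assume t: "0 < t" "t \<le> 1 / 2" "1 / t \<le> real M" and M: "M \<le> M'"
    let ?S = "\<Sum>k\<in>{M<..M'}. real k * occupation t k"
    let ?F = "\<lambda>M \<theta>. size_cf t M \<theta> * cis (- (real j * \<theta>))"
    have S: "?S \<ge> 0" using occupation_pos[OF t(1)] by (intro sum_nonneg mult_nonneg_nonneg less_imp_le) auto
    have "(LBINT \<theta>:{-pi..pi}. ?F M \<theta>) - (LBINT \<theta>:{-pi..pi}. ?F M' \<theta>)
        = (LBINT \<theta>:{-pi..pi}. ?F M \<theta> - ?F M' \<theta>)"
      by (intro set_integral_diff(2)[symmetric] set_integrable_size_cf t)
    moreover have "norm (LBINT \<theta>:{-pi..pi}. ?F M \<theta> - ?F M' \<theta>) \<le> pi * (2 * C * size_scale t * ?S) * size_scale t"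
    proof (rule norm_integral_le_kernel)
      fix \<theta> :: real assume th: "\<bar>\<theta>\<bar> \<le> pi"
      let ?u = "\<theta> / size_scale t"
      have "norm (?F M \<theta> - ?F M' \<theta>) = norm (size_cf t M \<theta> - size_cf t M' \<theta>)"
        by (simp add: norm_mult flip: left_diff_distrib)
      also have "\<dots> \<le> norm (size_cf t M \<theta>) * (2 * \<bar>\<theta>\<bar> * ?S)"
        by (rule norm_size_cf_diff_le[OF t(1) M])
      also have "\<dots> \<le> C / (1 + ?u\<^sup>2)\<^sup>2 * (2 * \<bar>\<theta>\<bar> * ?S)"
        using S by (intro mult_right_mono dec t th) auto
      also have "\<dots> = (2 * C * size_scale t * ?S) * (\<bar>?u\<bar> / (1 + ?u\<^sup>2)\<^sup>2)"
        using t by (simp add: abs_mult abs_divide)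
      also have "\<dots> \<le> (2 * C * size_scale t * ?S) * (1 / (1 + ?u\<^sup>2))"
        using t C S by (intro mult_left_mono kernel_le(2)) auto
      finally show "norm (?F M \<theta> - ?F M' \<theta>) \<le> (2 * C * size_scale t * ?S) / (1 + ?u\<^sup>2)" by simp
    qed (use t C S in auto)
    ultimately have "norm (2 * pi * of_real (size_prob t M j) - 2 * pi * of_real (size_prob t M' j) :: complex)
       \<le> pi * (2 * C * size_scale t * ?S) * size_scale t"
      unfolding size_prob_fourier[OF t(1)] by (simp del: of_real_mult)
    also have "(2 * pi * of_real (size_prob t M j) - 2 * pi * of_real (size_prob t M' j) :: complex)
       = of_real (2 * pi * (size_prob t M j - size_prob t M' j))"
      by (simp add: right_diff_distrib)
    also have "pi * (2 * C * size_scale t * ?S) * size_scale t = 2 * pi * (C * (size_scale t)\<^sup>2 * ?S)"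
      by (simp add: power2_eq_square)
    finally have "(2 * pi) * \<bar>size_prob t M j - size_prob t M' j\<bar> \<le> (2 * pi) * (C * t ^ 3 * ?S)"
      using t by (simp only: norm_of_real abs_mult size_scale_sq less_imp_le) simp
    then show "\<bar>size_prob t M j - size_prob t M' j\<bar> \<le> C * t ^ 3 * ?S"
      by (rule mult_left_le_imp_le) simp
  qed (rule C)
qed

section \<open>Second order expansion of the characteristic function\<close>

text \<open>Taylor expansion of \<open>- Ln D\<close> with \<open>D = 1 - \<rho> (exp (\<i> y) - 1)\<close>, whose real part is at least 1 on
  the real line. All derivatives are polynomials in \<open>g = 1 / D\<close>, since \<open>g' = \<i> ((1 + \<rho>) g\<^sup>2 - g)\<close>.\<close>

lemma geometric_cf_expansion:
  fixes \<rho> y :: real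
  assumes rho: "\<rho> \<ge> 0"
  obtains R :: complex where "norm R \<le> 3 / 2 * (\<rho> * (1 + \<rho>)\<^sup>2) * \<bar>y\<bar> ^ 3"
    "1 / (1 - of_real \<rho> * (cis y - 1)) = exp (\<i> * of_real (\<rho> * y) - of_real (\<rho> * (1 + \<rho>) * y\<^sup>2 / 2) + R)"
proof -
  define D where "D z = 1 - of_real \<rho> * (exp (\<i> * z) - 1)" for z :: complex
  define p :: complex where "p = of_real \<rho>"
  define g where "g z = inverse (D z)" for z
  \<comment> \<open>For n \<le> 3 this is the n-th derivative of - Ln (D z) - \<i> p z. Subtracting
    the mean term makes the values of orders 0 and 1 vanish at 0, so only the quadratic Taylor term
    survives.\<close>
  define f where "f n z = (if n = 0 then - Ln (D z) - \<i> * p * z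
      else if n = 1 then \<i> * (1 + p) * (g z - 1)
      else if n = 2 then \<i> * (1 + p) * (\<i> * ((1 + p) * (g z)\<^sup>2 - g z))
      else \<i> * (1 + p) * (\<i> * ((2 * (1 + p) * g z - 1) * (\<i> * ((1 + p) * (g z)\<^sup>2 - g z)))))" for n :: nat and z
  have Dreal: "D (of_real x) = 1 - of_real \<rho> * (cis x - 1)" for x
    by (simp add: D_def cis_conv_exp)
  have Re1: "Re (D z) \<ge> 1" if "z \<in> \<real>" for z
  proof -
    from that obtain x where x: "z = of_real x" by (auto elim: Reals_cases)
    have "\<rho> * cos x \<le> \<rho> * 1" using rho by (intro mult_left_mono) auto
    then show ?thesis unfolding x Dreal by (simp add: algebra_simps)
  qed
  have ne: "D z \<noteq> 0" if "z \<in> \<real>" for z using Re1[OF that] by auto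
  have pos: "D z \<notin> \<real>\<^sub>\<le>\<^sub>0" if "z \<in> \<real>" for z
    using Re1[OF that] by (auto simp: complex_nonpos_Reals_iff)
  have dD: "(D has_field_derivative - \<i> * (1 + p - D z)) (at z within \<real>)" for z
    unfolding D_def p_def by (auto intro!: derivative_eq_intros simp: algebra_simps)
  have poly: "\<i> * (1 + p) * (\<i> * ((1 + p) * (of_nat 2 * (E * G ^ (2 - Suc 0))) - E)) =
      \<i> * (1 + p) * (\<i> * ((2 * (1 + p) * G - 1) * E))" for E G :: complex
    by (simp add: algebra_simps)
  have gD: "(1 + p) * (g z)\<^sup>2 - g z = (1 + p - D z) * (g z)\<^sup>2" if "z \<in> \<real>" for z
    using ne[OF that] by (simp add: g_def power2_eq_square left_diff_distrib)
  have dg: "(g has_field_derivative \<i> * ((1 + p) * (g z)\<^sup>2 - g z)) (at z within \<real>)" if "z \<in> \<real>" for z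
    unfolding gD[OF that] unfolding g_def using ne[OF that] dD[of z]
    by (auto intro!: derivative_eq_intros simp: power2_eq_square)
  \<comment> \<open>Taylor's theorem is applied within the real line as a convex subset of the
    complex plane, because D may vanish on the imaginary axis. Its remainder has denominator
    \<open>fact 2\<close>, whence the constant 3/2.\<close>
  have "norm (f 0 (of_real y) - (\<Sum>i\<le>2. f i 0 * (of_real y - 0) ^ i / fact i))
      \<le> (3 * (\<rho> * (1 + \<rho>)\<^sup>2)) * norm (of_real y - 0 :: complex) ^ Suc 2 / fact 2"
  proof (rule field_Taylor[OF convex_Reals])
    fix i :: nat and z :: complex assume z: "z \<in> \<real>" and i: "i \<le> 2"
    consider "i = 0" | "i = 1" | "i = 2" using i by linarith
    then show "(f i has_field_derivative f (Suc i) z) (at z within \<real>)"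
    proof cases
      case 1
      have "((\<lambda>z. - Ln (D z) - \<i> * p * z) has_field_derivative \<i> * (1 + p) * (g z - 1)) (at z within \<real>)"
        using ne[OF z] pos[OF z] dD[of z] unfolding g_def by (auto intro!: derivative_eq_intros simp: field_simps)
      with 1 show ?thesis by (simp add: f_def[abs_def])
    next
      case 2
      have "((\<lambda>z. \<i> * (1 + p) * (g z - 1)) has_field_derivative \<i> * (1 + p) * (\<i> * ((1 + p) * (g z)\<^sup>2 - g z))) (at z within \<real>)"
        by (rule DERIV_cong[OF DERIV_cmult[OF DERIV_diff[OF dg[OF z] DERIV_const]]]) simp
      with 2 show ?thesis by (simp add: f_def[abs_def])
    next
      case 3
      have "((\<lambda>z. \<i> * (1 + p) * (\<i> * ((1 + p) * (g z)\<^sup>2 - g z))) has_field_derivative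
          \<i> * (1 + p) * (\<i> * ((2 * (1 + p) * g z - 1) * (\<i> * ((1 + p) * (g z)\<^sup>2 - g z))))) (at z within \<real>)"
      proof (rule DERIV_cong)
        show "((\<lambda>z. \<i> * (1 + p) * (\<i> * ((1 + p) * (g z)\<^sup>2 - g z))) has_field_derivative
          \<i> * (1 + p) * (\<i> * ((1 + p) * (of_nat 2 * (\<i> * ((1 + p) * (g z)\<^sup>2 - g z) * g z ^ (2 - Suc 0)))
             - (\<i> * ((1 + p) * (g z)\<^sup>2 - g z))))) (at z within \<real>)"
          by (intro DERIV_cmult DERIV_diff DERIV_power dg z)
        show "\<i> * (1 + p) * (\<i> * ((1 + p) * (of_nat 2 * (\<i> * ((1 + p) * (g z)\<^sup>2 - g z) * g z ^ (2 - Suc 0)))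
             - (\<i> * ((1 + p) * (g z)\<^sup>2 - g z)))) =
          \<i> * (1 + p) * (\<i> * ((2 * (1 + p) * g z - 1) * (\<i> * ((1 + p) * (g z)\<^sup>2 - g z))))"
          by (fact poly)
      qed
      with 3 show ?thesis by (simp add: f_def[abs_def])
    qed
  next
    fix z :: complex assume "z \<in> \<real>"
    then obtain x where x: "z = of_real x" by (auto elim: Reals_cases)
    have D1: "norm (D z) \<ge> 1" unfolding x Dreal using rho by (rule size_cf_denominator_ge_1)
    have n1: "norm (1 + p) = 1 + \<rho>"
    proof -
      have "1 + p = of_real (1 + \<rho>)" by (simp add: p_def)
      then show ?thesis using rho by (simp only: norm_of_real)
    qed
    have "1 + p - D z = p * cis x" unfolding x Dreal p_def by (simp add: algebra_simps)
    then have n2: "norm (1 + p - D z) = \<rho>" using rho by (simp add: norm_mult p_def)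
    have g1: "norm (g z) \<le> 1" using D1 by (simp add: g_def norm_inverse inverse_le_1_iff)
    have "norm (2 * (1 + p) * g z - 1) \<le> norm (2 * (1 + p) * g z) + norm (1 :: complex)"
      by (rule norm_triangle_ineq4)
    also have "\<dots> \<le> 2 * (1 + \<rho>) + 1"
      using mult_left_mono[OF g1, of "2 * (1 + \<rho>)"] rho unfolding norm_mult n1 by simp
    also have "\<dots> \<le> 3 * (1 + \<rho>)" using rho by simp
    finally have n3: "norm (2 * (1 + p) * g z - 1) \<le> 3 * (1 + \<rho>)" .
    have n4: "norm ((1 + p) * (g z)\<^sup>2 - g z) \<le> \<rho>"
      unfolding gD[OF \<open>z \<in> \<real>\<close>] norm_mult norm_power n2
      using g1 rho by (simp add: mult_left_le power_le_one)
    have "norm (f (Suc 2) z) = (1 + \<rho>) * (norm (2 * (1 + p) * g z - 1) * norm ((1 + p) * (g z)\<^sup>2 - g z))"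
      by (simp add: f_def norm_mult n1)
    also have "\<dots> \<le> (1 + \<rho>) * (3 * (1 + \<rho>) * \<rho>)"
      using rho by (intro mult_mono mult_left_mono n3 n4) auto
    finally show "norm (f (Suc 2) z) \<le> 3 * (\<rho> * (1 + \<rho>)\<^sup>2)"
      by (simp add: power2_eq_square mult_ac)
  qed auto
  also have "(\<Sum>i\<le>2. f i 0 * (of_real y - 0) ^ i / fact i) = - of_real (\<rho> * (1 + \<rho>) * y\<^sup>2 / 2)"
    by (simp add: numeral_2_eq_2 f_def g_def D_def p_def power2_eq_square algebra_simps)
  finally have R: "norm (f 0 (of_real y) + of_real (\<rho> * (1 + \<rho>) * y\<^sup>2 / 2)) \<le> 3 / 2 * (\<rho> * (1 + \<rho>)\<^sup>2) * \<bar>y\<bar> ^ 3"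
    by (simp add: eval_nat_numeral algebra_simps)
  show ?thesis
  proof (rule that[OF R])
    have "exp (\<i> * of_real (\<rho> * y) + f 0 (of_real y)) = exp (- Ln (D (of_real y)))"
      by (simp add: f_def p_def algebra_simps)
    also have "\<dots> = 1 / D (of_real y)"
      using ne[of "of_real y"] by (simp add: exp_minus inverse_eq_divide)
    finally show "1 / (1 - of_real \<rho> * (cis y - 1)) = exp (\<i> * of_real (\<rho> * y) - of_real (\<rho> * (1 + \<rho>) * y\<^sup>2 / 2)
       + (f 0 (of_real y) + of_real (\<rho> * (1 + \<rho>) * y\<^sup>2 / 2)))"
      by (simp add: Dreal add_diff_eq)
  qed
qed

definition size_mean :: "real \<Rightarrow> nat \<Rightarrow> real" where
  "size_mean t M = 2 * (\<Sum>k=1..M. real k * occupation t k)"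

definition size_var :: "real \<Rightarrow> nat \<Rightarrow> real" where
  "size_var t M = 2 * (\<Sum>k=1..M. (real k)\<^sup>2 * (occupation t k * (1 + occupation t k)))"

text \<open>Controls the third order remainder and is not a centred moment. Unlike mean and variance
  it carries no factor 2 for the pair; that factor is in the constant 3 = 2 * 3/2 of
  \<open>size_cf_expansion\<close>.\<close>

definition size_third :: "real \<Rightarrow> nat \<Rightarrow> real" where
  "size_third t M = (\<Sum>k=1..M. (real k) ^ 3 * (occupation t k * (1 + occupation t k)\<^sup>2))"

lemma size_cf_expansion:
  assumes t: "t > 0"
  obtains R :: complex where "norm R \<le> 3 * size_third t M * \<bar>\<theta>\<bar> ^ 3"
    "size_cf t M \<theta> = exp (\<i> * of_real (size_mean t M * \<theta>) - of_real (size_var t M * \<theta>\<^sup>2 / 2) + R)"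
proof -
  let ?\<rho> = "occupation t"
  have "\<exists>R. norm R \<le> 3 / 2 * (?\<rho> k * (1 + ?\<rho> k)\<^sup>2) * \<bar>real k * \<theta>\<bar> ^ 3 \<and>
     size_cf_factor t k \<theta> = exp (\<i> * of_real (?\<rho> k * (real k * \<theta>)) - of_real (?\<rho> k * (1 + ?\<rho> k) * (real k * \<theta>)\<^sup>2 / 2) + R)"
    if "k \<in> {1..M}" for k
  proof -
    have "?\<rho> k \<ge> 0" using occupation_pos[OF t, of k] that by simp
    from geometric_cf_expansion[OF this, of "real k * \<theta>"] show ?thesis
      unfolding size_cf_factor_def by metis
  qed
  then obtain R where R: "\<And>k. k \<in> {1..M} \<Longrightarrow> norm (R k) \<le> 3 / 2 * (?\<rho> k * (1 + ?\<rho> k)\<^sup>2) * \<bar>real k * \<theta>\<bar> ^ 3"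
    "\<And>k. k \<in> {1..M} \<Longrightarrow> size_cf_factor t k \<theta> = exp (\<i> * of_real (?\<rho> k * (real k * \<theta>)) - of_real (?\<rho> k * (1 + ?\<rho> k) * (real k * \<theta>)\<^sup>2 / 2) + R k)"
    by metis
  show ?thesis
  proof (rule that[of "2 * (\<Sum>k=1..M. R k)"])
    have "norm (2 * (\<Sum>k=1..M. R k)) \<le> 2 * (\<Sum>k=1..M. norm (R k))"
      by (simp add: norm_mult norm_sum)
    also have "\<dots> \<le> 2 * (\<Sum>k=1..M. 3 / 2 * (?\<rho> k * (1 + ?\<rho> k)\<^sup>2) * \<bar>real k * \<theta>\<bar> ^ 3)"
      by (intro mult_left_mono sum_mono R(1)) auto
    also have "\<dots> = 3 * size_third t M * \<bar>\<theta>\<bar> ^ 3"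
      by (simp add: size_third_def sum_distrib_left sum_distrib_right abs_mult power_mult_distrib mult_ac)
    finally show "norm (2 * (\<Sum>k=1..M. R k)) \<le> 3 * size_third t M * \<bar>\<theta>\<bar> ^ 3" .
    have "size_cf t M \<theta> = (exp (\<Sum>k=1..M. \<i> * of_real (?\<rho> k * (real k * \<theta>)) - of_real (?\<rho> k * (1 + ?\<rho> k) * (real k * \<theta>)\<^sup>2 / 2) + R k))\<^sup>2"
      unfolding size_cf_def by (simp only: exp_sum[OF finite_atLeastAtMost] R(2) cong: prod.cong)
    also have "\<dots> = exp (2 * (\<Sum>k=1..M. \<i> * of_real (?\<rho> k * (real k * \<theta>)) - of_real (?\<rho> k * (1 + ?\<rho> k) * (real k * \<theta>)\<^sup>2 / 2) + R k))"
      by (simp only: exp_double)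
    also have "2 * (\<Sum>k=1..M. \<i> * of_real (?\<rho> k * (real k * \<theta>)) - of_real (?\<rho> k * (1 + ?\<rho> k) * (real k * \<theta>)\<^sup>2 / 2) + R k)
       = \<i> * of_real (size_mean t M * \<theta>) - of_real (size_var t M * \<theta>\<^sup>2 / 2) + 2 * (\<Sum>k=1..M. R k)"
    proof -
      have "size_mean t M * \<theta> = 2 * (\<Sum>k=1..M. ?\<rho> k * (real k * \<theta>))"
        unfolding size_mean_def sum_distrib_left sum_distrib_right by (intro sum.cong) simp_all
      moreover have "size_var t M * \<theta>\<^sup>2 / 2 = 2 * (\<Sum>k=1..M. ?\<rho> k * (1 + ?\<rho> k) * (real k * \<theta>)\<^sup>2 / 2)"
        unfolding size_var_def sum_distrib_left sum_distrib_right sum_divide_distrib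
        by (intro sum.cong) (simp_all add: power_mult_distrib)
      ultimately show ?thesis
        by (simp only: sum.distrib sum_subtractf sum_distrib_left[symmetric] of_real_mult[of 2]
            of_real_numeral of_real_sum distrib_left right_diff_distrib mult.left_commute[of 2 \<i>])
    qed
    finally show "size_cf t M \<theta> = exp (\<i> * of_real (size_mean t M * \<theta>) - of_real (size_var t M * \<theta>\<^sup>2 / 2) + 2 * (\<Sum>k=1..M. R k))" .
  qed
qed

section \<open>Moments\<close>

text \<open>For x = k t one has x rho \<le> 2 exp (- x / 2) and x (1 + rho) \<le> x + 2. Half of
  this decay pays for (x + 2)^2 \<le> 64 exp (x / 4); the other half makes the bound geometric in
  k.\<close>

lemma occupation_moment_bounds:
  assumes t: "t > 0" and k: "k \<ge> 1"
  defines "\<rho> \<equiv> occupation t k"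
  shows "t\<^sup>2 * ((real k)\<^sup>2 * (\<rho> * (1 + \<rho>))) \<le> 128 * exp (- (t / 4)) ^ k" (is "?A \<le> _")
    and "t ^ 3 * ((real k) ^ 3 * (\<rho> * (1 + \<rho>)\<^sup>2)) \<le> 128 * exp (- (t / 4)) ^ k" (is "?B \<le> _")
proof -
  define x where "x = real k * t"
  have x: "x > 0" using t k by (simp add: x_def)
  have rho0: "\<rho> > 0" unfolding \<rho>_def by (rule occupation_pos[OF t k])
  have rho: "\<rho> = 1 / (exp x - 1)" by (simp add: \<rho>_def occupation_def x_def)
  have "exp (x / 2) - 1 \<ge> x / 2" using exp_ge_add_one_self[of "x / 2"] by linarith
  then have "(x / 2) * exp (x / 2) \<le> (exp (x / 2) - 1) * (exp (x / 2) + 1)"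
    using x by (intro mult_mono) auto
  also have "\<dots> = exp x - 1" by (simp add: algebra_simps flip: exp_add)
  finally have "x \<le> 2 * exp (- (x / 2)) * (exp x - 1)"
    by (simp add: exp_minus field_simps)
  then have a: "x * \<rho> \<le> 2 * exp (- (x / 2))"
    using x by (simp add: rho divide_le_eq)
  have "exp (- (x / 2)) \<le> 1" using x by simp
  then have b: "x * (1 + \<rho>) \<le> x + 2" using a unfolding distrib_left by linarith
  have "1 + x / 4 + (x / 4)\<^sup>2 / 2 \<le> exp (x / 4)"
    using x by (intro exp_lower_Taylor_quadratic) auto
  then have c: "(x + 2)\<^sup>2 \<le> 64 * exp (x / 4)"
  proof -
    have "(x + 2)\<^sup>2 = x\<^sup>2 + 4 * x + 4" "(x / 4)\<^sup>2 / 2 = x\<^sup>2 / 32"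
      by (simp_all add: power2_eq_square algebra_simps)
    with \<open>1 + x / 4 + (x / 4)\<^sup>2 / 2 \<le> exp (x / 4)\<close> show ?thesis
      using x zero_le_power2[of x] by linarith
  qed
  have e: "exp (- (t / 4)) ^ k = exp (- (x / 4))" by (simp add: x_def mult_ac flip: exp_of_nat_mult)
  have d: "2 * exp (- (x / 2)) * (x + 2)\<^sup>2 \<le> 128 * exp (- (t / 4)) ^ k"
  proof -
    have "2 * exp (- (x / 2)) * (x + 2)\<^sup>2 \<le> 2 * exp (- (x / 2)) * (64 * exp (x / 4))"
      using c by (intro mult_left_mono) auto
    also have "\<dots> = 128 * exp (- (x / 4))" by (simp add: field_simps flip: exp_add)
    finally show ?thesis unfolding e .
  qed
  have "?B = (x * \<rho>) * (x * (1 + \<rho>))\<^sup>2"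
    by (simp add: x_def power2_eq_square power3_eq_cube mult_ac)
  also have "\<dots> \<le> (2 * exp (- (x / 2))) * (x + 2)\<^sup>2"
    by (rule mult_mono[OF a power_mono[OF b]]) (use x rho0 in auto)
  finally show "?B \<le> 128 * exp (- (t / 4)) ^ k" using d by linarith
  have "?A = (x * \<rho>) * (x * (1 + \<rho>))"
    by (simp add: x_def power2_eq_square mult_ac)
  also have "\<dots> \<le> (2 * exp (- (x / 2))) * (x + 2)"
    by (rule mult_mono[OF a b]) (use x rho0 in auto)
  also have "\<dots> \<le> (2 * exp (- (x / 2))) * (x + 2)\<^sup>2"
    using x by (intro mult_left_mono) (auto simp: power2_eq_square algebra_simps)
  finally show "?A \<le> 128 * exp (- (t / 4)) ^ k" using d by linarith
qed

lemma sum_exp_le: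
  assumes y: "y > (0::real)"
  shows "(\<Sum>k=1..M. exp (- y) ^ k) \<le> 1 / y"
proof -
  have q: "0 < exp (- y)" "exp (- y) < 1" using y by auto
  have "(\<Sum>k=1..M. exp (- y) ^ k) = exp (- y) * (\<Sum>k<M. exp (- y) ^ k)"
    unfolding sum_distrib_left by (rule sum.reindex_bij_witness[of _ Suc "\<lambda>k. k - 1"]) (auto simp flip: power_Suc)
  also have "(\<Sum>k<M. exp (- y) ^ k) = (1 - exp (- y) ^ M) / (1 - exp (- y))"
    using q by (simp add: sum_gp_strict)
  also have "exp (- y) * \<dots> \<le> exp (- y) * (1 / (1 - exp (- y)))"
    using q by (intro mult_left_mono divide_right_mono) auto
  also have "\<dots> = 1 / (exp y - 1)" using y by (simp add: exp_minus field_simps)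
  also have "\<dots> \<le> 1 / y"
  proof (intro divide_left_mono mult_pos_pos)
    show "y \<le> exp y - 1" using exp_ge_add_one_self[of y] by linarith
  qed (use y in auto)
  finally show ?thesis .
qed

text \<open>An upper bound suffices: the local lower bound only requires that the characteristic
  function does not fall too fast near 0.\<close>

lemma size_var_le:
  assumes t: "t > 0"
  shows "size_var t M \<le> 1024 / t ^ 3"
proof -
  have "t\<^sup>2 * size_var t M = 2 * (\<Sum>k=1..M. t\<^sup>2 * ((real k)\<^sup>2 * (occupation t k * (1 + occupation t k))))"
    by (simp add: size_var_def sum_distrib_left mult_ac)
  also have "\<dots> \<le> 2 * (\<Sum>k=1..M. 128 * exp (- (t / 4)) ^ k)"
    by (intro mult_left_mono sum_mono occupation_moment_bounds(1) t) auto
  also have "\<dots> = 256 * (\<Sum>k=1..M. exp (- (t / 4)) ^ k)" by (simp add: sum_distrib_left)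
  also have "\<dots> \<le> 256 * (1 / (t / 4))" using t by (intro mult_left_mono sum_exp_le) auto
  finally have "t\<^sup>2 * size_var t M \<le> 1024 / t" by simp
  then have "t * (t\<^sup>2 * size_var t M) \<le> t * (1024 / t)" using t by (intro mult_left_mono) auto
  then show ?thesis using t by (simp add: pos_le_divide_eq power2_eq_square power3_eq_cube mult_ac)
qed

lemma size_third_le:
  assumes t: "t > 0"
  shows "size_third t M \<le> 512 / t ^ 4"
proof -
  have "t ^ 3 * size_third t M = (\<Sum>k=1..M. t ^ 3 * ((real k) ^ 3 * (occupation t k * (1 + occupation t k)\<^sup>2)))"
    by (simp add: size_third_def sum_distrib_left mult_ac)
  also have "\<dots> \<le> (\<Sum>k=1..M. 128 * exp (- (t / 4)) ^ k)"
    by (intro sum_mono occupation_moment_bounds(2) t) auto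
  also have "\<dots> = 128 * (\<Sum>k=1..M. exp (- (t / 4)) ^ k)" by (simp add: sum_distrib_left)
  also have "\<dots> \<le> 128 * (1 / (t / 4))" using t by (intro mult_left_mono sum_exp_le) auto
  finally have "t ^ 3 * size_third t M \<le> 512 / t" by simp
  then have "t * (t ^ 3 * size_third t M) \<le> t * (512 / t)" using t by (intro mult_left_mono) auto
  then show ?thesis using t by (simp add: pos_le_divide_eq eval_nat_numeral mult_ac)
qed

text \<open>This is sinh (y / 2) \<ge> y / 2 in disguise. Its sharpness is what makes the bound 1 /
  y^2 below, and then the upper bound of the mean, free of error terms.\<close>

lemma exp_minus_1_ge:
  fixes y :: real
  assumes "y \<ge> 0"
  shows "y * exp (y / 2) \<le> exp y - 1"
proof -
  define f :: "real \<Rightarrow> real" where "f x = exp x - 1 - x * exp (x / 2)" for x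
  have "f 0 \<le> f y"
  proof (rule DERIV_nonneg_imp_nondecreasing[OF assms], intro exI conjI)
    fix x :: real
    have e: "exp x = exp (x / 2) * exp (x / 2)" by (simp flip: exp_add)
    show "DERIV f x :> exp (x / 2) * (exp (x / 2) - 1 - x / 2)"
      unfolding f_def by (rule derivative_eq_intros refl | simp)+ (simp add: e algebra_simps)
    show "exp (x / 2) * (exp (x / 2) - 1 - x / 2) \<ge> 0"
    proof (rule mult_nonneg_nonneg)
      show "0 \<le> exp (x / 2) - 1 - x / 2" using exp_ge_add_one_self[of "x / 2"] by linarith
    qed simp
  qed
  then show ?thesis by (simp add: f_def)
qed

text \<open>The error \<open>min (1 / y) (1 / y\<^sup>2)\<close> is relaxed to a power of \<open>y\<close> with exponent between \<open>-3/2\<close> and \<open>-1\<close>: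
  summed over \<open>y = t, 2 t, 3 t, \<dots>\<close> it still converges and is negligible against \<open>t powr (-3/2)\<close>.\<close>

lemma geometric_mean_bounds:
  fixes y :: real
  assumes y: "y > 0"
  defines "q \<equiv> exp (- y)"
  shows "q / (1 - q)\<^sup>2 \<le> 1 / y\<^sup>2" and "1 / y\<^sup>2 - y powr (- 5 / 4) \<le> q / (1 - q)\<^sup>2"
proof -
  define E where "E = exp y"
  have E: "E > 1" using y by (simp add: E_def)
  have q: "q = 1 / E" by (simp add: q_def E_def exp_minus inverse_eq_divide)
  have eq: "q / (1 - q)\<^sup>2 = E / (E - 1)\<^sup>2"
    using E by (simp add: q power2_eq_square divide_simps)
  have "(y * exp (y / 2))\<^sup>2 \<le> (E - 1)\<^sup>2"
    using exp_minus_1_ge[of y] y by (intro power_mono) (auto simp: E_def)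
  also have "(y * exp (y / 2))\<^sup>2 = y\<^sup>2 * E"
    by (simp add: power_mult_distrib E_def power2_eq_square flip: exp_add)
  finally show "q / (1 - q)\<^sup>2 \<le> 1 / y\<^sup>2"
    unfolding eq using E y by (simp add: divide_simps mult.commute)
  have "E - 1 \<le> y * E"
    using exp_ge_add_one_self[of "-y"] E by (simp add: E_def exp_minus field_simps)
  then have "(E - 1)\<^sup>2 \<le> (y * E)\<^sup>2" using E by (intro power_mono) auto
  then have "E / (y * E)\<^sup>2 \<le> E / (E - 1)\<^sup>2"
    using E y by (intro divide_left_mono mult_pos_pos) auto
  moreover have "E / (y * E)\<^sup>2 = q / y\<^sup>2" using E by (simp add: q power2_eq_square)
  moreover have "(1 - y) / y\<^sup>2 \<le> q / y\<^sup>2"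
    using exp_ge_add_one_self[of "-y"] by (intro divide_right_mono) (auto simp: q_def)
  moreover have "(1 - y) / y\<^sup>2 = 1 / y\<^sup>2 - 1 / y" using y by (simp add: field_simps power2_eq_square)
  ultimately have low: "1 / y\<^sup>2 - 1 / y \<le> E / (E - 1)\<^sup>2" by linarith
  show "1 / y\<^sup>2 - y powr (- 5 / 4) \<le> q / (1 - q)\<^sup>2"
  proof (cases "y \<le> 1")
    case True
    have "y powr (-1) \<le> y powr (- 5 / 4)" using y True by (intro powr_mono') auto
    then show ?thesis unfolding eq using low y by (simp add: powr_minus_divide)
  next
    case False
    have "y powr (-2) \<le> y powr (- 5 / 4)" using False by (intro powr_mono) auto
    moreover have "y powr (-2) = 1 / y\<^sup>2" using y by (simp add: powr_minus_divide powr_numeral)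
    moreover have "E / (E - 1)\<^sup>2 \<ge> 0" using E by simp
    ultimately show ?thesis unfolding eq by linarith
  qed
qed

lemma weighted_geometric:
  fixes q :: real
  assumes q: "0 \<le> q" "q < 1"
  shows "(\<Sum>k=1..M. real k * q ^ k) \<le> q / (1 - q)\<^sup>2"
    and "(\<lambda>M. \<Sum>k=1..M. real k * q ^ k) \<longlonglongrightarrow> q / (1 - q)\<^sup>2"
proof -
  have "(\<lambda>n. of_nat (Suc n) * q ^ n) sums (1 / (1 - q)\<^sup>2)"
    using q by (intro geometric_deriv_sums) auto
  from sums_mult[OF this, of q] have s: "(\<lambda>n. real (Suc n) * q ^ Suc n) sums (q / (1 - q)\<^sup>2)"
    by (simp add: mult_ac)
  have e: "(\<Sum>k=1..M. real k * q ^ k) = (\<Sum>n<M. real (Suc n) * q ^ Suc n)" for M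
    by (rule sum.reindex_bij_witness[of _ Suc "\<lambda>k. k - 1"]) auto
  show "(\<Sum>k=1..M. real k * q ^ k) \<le> q / (1 - q)\<^sup>2"
    unfolding e sums_unique[OF s] using q s by (intro sum_le_suminf) (auto simp: sums_iff)
  show "(\<lambda>M. \<Sum>k=1..M. real k * q ^ k) \<longlonglongrightarrow> q / (1 - q)\<^sup>2"
    unfolding e using s by (simp only: sums_def)
qed

text \<open>With this expansion the mean can be summed over k first: for fixed j the result is q /
  (1 - q)^2 with q = exp (- (j + 1) t), close to 1 / ((j + 1) t)^2. The sum over j then produces the
  pi^2 / 6 in the mean.\<close>

lemma occupation_sums:
  assumes "t > 0" "k \<ge> 1"
  shows "(\<lambda>j. exp (- (real (Suc j) * t)) ^ k) sums occupation t k"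
proof -
  let ?q = "exp (- (real k * t))"
  have q: "?q < 1" using assms by simp
  have "(\<lambda>j. ?q * ?q ^ j) sums (?q * (1 / (1 - ?q)))"
    by (intro sums_mult geometric_sums) (use q in auto)
  moreover have "?q * (1 / (1 - ?q)) = occupation t k"
    using assms by (simp add: occupation_def exp_minus field_simps)
  moreover have "?q * ?q ^ j = exp (- (real (Suc j) * t)) ^ k" for j
  proof -
    have "?q * ?q ^ j = ?q ^ Suc j" by simp
    also have "\<dots> = exp (- (real (Suc j) * t)) ^ k"
      unfolding exp_of_nat_mult[symmetric] by (simp only: mult_minus_right mult_ac)
    finally show ?thesis .
  qed
  ultimately show ?thesis by (simp only:)
qed

lemma sums_inverse_squares_scaled:
  assumes "t > (0::real)"
  shows "(\<lambda>j. 1 / (real (Suc j) * t)\<^sup>2) sums (pi\<^sup>2 / (6 * t\<^sup>2))"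
  using sums_divide[OF inverse_squares_sums, of "t\<^sup>2"] by (simp add: power_mult_distrib add_ac)

lemma size_mean_upper:
  assumes t: "t > 0"
  shows "size_mean t M \<le> pi\<^sup>2 / (3 * t\<^sup>2)"
proof -
  have "(\<lambda>j. \<Sum>k=1..M. real k * exp (- (real (Suc j) * t)) ^ k) sums (\<Sum>k=1..M. real k * occupation t k)"
    using t by (intro sums_sum sums_mult occupation_sums) auto
  moreover have "(\<Sum>k=1..M. real k * exp (- (real (Suc j) * t)) ^ k) \<le> 1 / (real (Suc j) * t)\<^sup>2" for j
    by (rule order_trans[OF weighted_geometric(1) geometric_mean_bounds(1)]) (use t in \<open>auto simp: add_pos_nonneg\<close>)
  ultimately have "(\<Sum>k=1..M. real k * occupation t k) \<le> pi\<^sup>2 / (6 * t\<^sup>2)"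
    by (rule sums_le[OF _ _ sums_inverse_squares_scaled[OF t], rotated])
  then show ?thesis by (simp add: size_mean_def field_simps)
qed

text \<open>Since k t \<ge> 1, the occupation is at most 2 exp (- k t). One quarter of the exponent
  makes the sum over k converge, to at most 16 / t^2, and three quarters are evaluated at M. In
  \<open>size_prob_ratio_tendsto\<close>, where exp (- M t) is O(t), any share above one half would
  beat \<open>size_scale\<close>.\<close>

lemma occupation_tail:
  assumes t: "t > 0" and M: "1 \<le> real M * t"
  shows "(\<Sum>k\<in>{M<..M'}. real k * occupation t k) \<le> 32 * exp (- (3 / 4 * (real M * t))) / t\<^sup>2"
proof -
  let ?e = "exp (- (3 / 4 * (real M * t)))" and ?q = "exp (- (t / 4))"
  have "(\<Sum>k\<in>{M<..M'}. real k * occupation t k) \<le> (\<Sum>k\<in>{M<..M'}. 2 * ?e * (real k * ?q ^ k))"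
  proof (intro sum_mono)
    fix k assume k: "k \<in> {M<..M'}"
    define x where "x = real k * t"
    have Mx: "real M * t \<le> x" using k t by (auto simp: x_def)
    then have "exp x \<ge> 2" using M exp_ge_add_one_self[of x] by linarith
    then have "1 * exp x \<le> 2 * (exp x - 1)" by simp
    then have "1 / (exp x - 1) \<le> 2 / exp x"
      using \<open>exp x \<ge> 2\<close> Mx M by (subst frac_le_eq) (auto intro!: divide_nonpos_nonneg mult_nonneg_nonneg)
    moreover have "occupation t k = 1 / (exp x - 1)" by (simp add: occupation_def x_def)
    ultimately have "occupation t k \<le> 2 * exp (- x)" by (simp add: exp_minus inverse_eq_divide)
    also have "exp (- x) = exp (- (3 / 4 * x)) * ?q ^ k"
    proof -
      have "?q ^ k = exp (- (x / 4))" unfolding exp_of_nat_mult[symmetric] by (simp add: x_def)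
      then show ?thesis by (simp add: field_simps flip: exp_add)
    qed
    also have "\<dots> \<le> ?e * ?q ^ k" using Mx by (intro mult_right_mono) (auto simp: mult.commute)
    finally have "occupation t k \<le> 2 * (?e * ?q ^ k)" by simp
    then have "real k * occupation t k \<le> real k * (2 * (?e * ?q ^ k))" by (intro mult_left_mono) auto
    then show "real k * occupation t k \<le> 2 * ?e * (real k * ?q ^ k)" by (simp add: mult_ac)
  qed
  also have "\<dots> = 2 * ?e * (\<Sum>k\<in>{M<..M'}. real k * ?q ^ k)" by (simp add: sum_distrib_left)
  also have "(\<Sum>k\<in>{M<..M'}. real k * ?q ^ k) \<le> (\<Sum>k=1..M'. real k * ?q ^ k)"
    by (intro sum_mono2) auto
  also have "\<dots> \<le> 1 / (t / 4)\<^sup>2"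
    by (rule order_trans[OF weighted_geometric(1) geometric_mean_bounds(1)]) (use t in \<open>auto simp: add_pos_nonneg\<close>)
  finally show ?thesis by (simp add: power_divide)
qed

lemma summable_powr_shift: "summable (\<lambda>j. real (Suc j) powr (- 5 / 4))"
  using summable_real_powr_iff[of "- 5 / 4"] summable_Suc_iff[of "\<lambda>j. real j powr (- 5 / 4)"] by simp

text \<open>The sums over k and j are exchanged on finite rectangles, followed by M' to infinity and
  then J to infinity; the parts beyond M are charged to \<open>occupation_tail\<close>.\<close>

lemma size_mean_lower:
  obtains Z where "\<And>t M. 0 < t \<Longrightarrow> 1 \<le> real M * t \<Longrightarrow>
    pi\<^sup>2 / (3 * t\<^sup>2) - Z * t powr (- 5 / 4) - 64 * exp (- (3 / 4 * (real M * t))) / t\<^sup>2 \<le> size_mean t M"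
proof
  define Z where "Z = suminf (\<lambda>j. real (Suc j) powr (- 5 / 4))"
  fix t :: real and M :: nat
  assume t: "t > 0" and M: "1 \<le> real M * t"
  define q where "q j = exp (- (real (Suc j) * t))" for j
  have q: "0 \<le> q j" "q j < 1" for j using t by (auto simp: q_def add_pos_nonneg)
  let ?T = "32 * exp (- (3 / 4 * (real M * t))) / t\<^sup>2"
  let ?S = "\<lambda>M. \<Sum>k=1..M. real k * occupation t k"
  have a: "(\<Sum>j<J. 1 / (real (Suc j) * t)\<^sup>2 - (real (Suc j) * t) powr (- 5 / 4)) \<le> ?S M + ?T" for J
  proof -
    have "(\<Sum>j<J. \<Sum>k=1..M'. real k * q j ^ k) \<le> ?S M + ?T" for M'
    proof -
      have "(\<Sum>j<J. \<Sum>k=1..M'. real k * q j ^ k) = (\<Sum>k=1..M'. real k * (\<Sum>j<J. q j ^ k))"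
        by (subst sum.swap) (simp add: sum_distrib_left)
      also have "\<dots> \<le> ?S M'"
      proof (intro sum_mono mult_left_mono)
        fix k assume "k \<in> {1..M'}"
        then have s: "(\<lambda>j. q j ^ k) sums occupation t k"
          unfolding q_def using t by (intro occupation_sums) auto
        show "(\<Sum>j<J. q j ^ k) \<le> occupation t k"
          unfolding sums_unique[OF s] using s q by (intro sum_le_suminf) (auto simp: sums_iff)
      qed auto
      also have "?S M' \<le> ?S (max M M')"
      proof (rule sum_mono2)
        fix k assume "k \<in> {1..max M M'} - {1..M'}"
        then show "0 \<le> real k * occupation t k"
          using occupation_pos[OF t, of k] by (intro mult_nonneg_nonneg) auto
      qed auto
      also have "\<dots> = ?S M + (\<Sum>k\<in>{M<..max M M'}. real k * occupation t k)"
      proof -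
        have "{1..max M M'} = {1..M} \<union> {M<..max M M'}" by auto
        then show ?thesis by (simp only:) (rule sum.union_disjoint, auto)
      qed
      also have "\<dots> \<le> ?S M + ?T" using occupation_tail[OF t M] by (intro add_left_mono)
      finally show ?thesis .
    qed
    moreover have "(\<lambda>M'. \<Sum>j<J. \<Sum>k=1..M'. real k * q j ^ k) \<longlonglongrightarrow> (\<Sum>j<J. q j / (1 - q j)\<^sup>2)"
      by (intro tendsto_sum weighted_geometric(2) q)
    ultimately have "(\<Sum>j<J. q j / (1 - q j)\<^sup>2) \<le> ?S M + ?T"
      by (intro LIMSEQ_le_const2) auto
    moreover have "(\<Sum>j<J. 1 / (real (Suc j) * t)\<^sup>2 - (real (Suc j) * t) powr (- 5 / 4)) \<le> (\<Sum>j<J. q j / (1 - q j)\<^sup>2)"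
      unfolding q_def using t by (intro sum_mono geometric_mean_bounds(2)) auto
    ultimately show ?thesis by linarith
  qed
  have "(\<lambda>j. real (Suc j) powr (- 5 / 4) * t powr (- 5 / 4)) sums (Z * t powr (- 5 / 4))"
    unfolding Z_def by (intro sums_mult2 summable_sums summable_powr_shift)
  then have "(\<lambda>j. 1 / (real (Suc j) * t)\<^sup>2 - (real (Suc j) * t) powr (- 5 / 4)) sums (pi\<^sup>2 / (6 * t\<^sup>2) - Z * t powr (- 5 / 4))"
    using t by (intro sums_diff sums_inverse_squares_scaled) (auto simp: powr_mult)
  then have "pi\<^sup>2 / (6 * t\<^sup>2) - Z * t powr (- 5 / 4) \<le> ?S M + ?T"
    unfolding sums_def by (rule LIMSEQ_le_const2) (use a in auto)
  then show "pi\<^sup>2 / (3 * t\<^sup>2) - (2 * Z) * t powr (- 5 / 4) - 64 * exp (- (3 / 4 * (real M * t))) / t\<^sup>2 \<le> size_mean t M"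
    unfolding size_mean_def using t by (simp add: field_simps)
qed

section \<open>A local lower bound\<close>

text \<open>In the Fourier integral, the part \<open>\<bar>\<theta>\<bar> \<le> s\<close> contributes at least a constant times the scale \<open>s\<close>, the
  part up to \<open>K s\<close> is nonnegative because the phase stays below 1, and the rest is small for large \<open>K\<close>.\<close>

lemma size_prob_lower:
  obtains c \<delta> where "c > 0" "\<delta> > 0"
    "\<And>t M j. 0 < t \<Longrightarrow> t < \<delta> \<Longrightarrow> 1 / t \<le> real M \<Longrightarrow> \<bar>size_mean t M - real j\<bar> * size_scale t \<le> \<delta> \<Longrightarrow>
       size_prob t M j \<ge> c * size_scale t"
proof -
  obtain C where C: "C > 0" and dec:
    "\<And>t M \<theta>. 0 < t \<Longrightarrow> t \<le> 1 / 2 \<Longrightarrow> 1 / t \<le> real M \<Longrightarrow> \<bar>\<theta>\<bar> \<le> pi \<Longrightarrow>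
       norm (size_cf t M \<theta>) \<le> C / (1 + (\<theta> / size_scale t)\<^sup>2)\<^sup>2"
    using size_cf_decay_scaled by blast
  \<comment> \<open>A lower bound for the real part of the integrand when |\<theta>| \<le> s: 512 is
    half the variance constant 1024, one more unit covers Re R, and the phase, including Im R, stays
    below 1.\<close>
  define c1 :: real where "c1 = exp (- 513) * cos 1"
  have cos1: "cos (1::real) > 0" using pi_gt3 by (intro cos_gt_zero) auto
  then have c1: "c1 > 0" by (simp add: c1_def)
  \<comment> \<open>Chosen so large that the tail beyond K s, bounded by the kernel with constant D,
    costs at most D * pi \<le> c1, half of what the central interval contributes.\<close>
  define K where "K = 1 + C * pi / c1"
  have K: "K > 1" using C c1 by (simp add: K_def)
  define D where "D = C / (1 + K\<^sup>2)"
  have D: "D > 0" using C by (simp add: D_def add_pos_nonneg)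
  have "D * pi \<le> c1"
  proof -
    have "C * pi \<le> c1 * K" using c1 by (simp add: K_def field_simps)
    also have "\<dots> \<le> c1 * (1 + K\<^sup>2)"
    proof (intro mult_left_mono)
      have "K \<le> K\<^sup>2" using K by (simp add: self_le_power)
      then show "K \<le> 1 + K\<^sup>2" by simp
    qed (use c1 in auto)
    finally show ?thesis using one_plus_sq_gt_0[of K] by (simp add: D_def pos_divide_le_eq)
  qed
  \<comment> \<open>The bound 1 / (2 K) keeps the phase due to the mean below 1/2 up to K s; the
    last bound does the same for the remainder, whose norm is at most 3 * 512 * K^3 * sqrt
    t.\<close>
  define \<delta> where "\<delta> = min (1 / 2) (min (1 / (2 * K)) ((1 / (3072 * K ^ 3))\<^sup>2))"
  have d: "\<delta> > 0" "\<delta> \<le> 1 / 2" "\<delta> \<le> 1 / (2 * K)" "\<delta> \<le> (1 / (3072 * K ^ 3))\<^sup>2"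
    using K by (auto simp: \<delta>_def)
  show ?thesis
  proof (rule that[of "c1 / (2 * pi)" \<delta>])
    show "c1 / (2 * pi) > 0" using c1 by simp
    show "\<delta> > 0" by (rule d)
    fix t :: real and M j :: nat
    assume t0: "0 < t" "t < \<delta>" and M: "1 / t \<le> real M" and mu: "\<bar>size_mean t M - real j\<bar> * size_scale t \<le> \<delta>"
    have t: "t \<le> 1 / 2" using t0 d by simp
    define s where "s = size_scale t"
    have s: "s > 0" using t0 by (simp add: s_def)
    have "sqrt t \<le> 1" using t by (simp add: real_sqrt_le_1_iff)
    then have "s \<le> 1 / 2 * 1" unfolding s_def using t t0 by (intro mult_mono) auto
    then have s1: "s \<le> pi" using pi_gt3 by simp
    have sq: "1536 * K ^ 3 * sqrt t \<le> 1 / 2"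
    proof -
      have "t \<le> (1 / (3072 * K ^ 3))\<^sup>2" using t0 d by linarith
      then have "sqrt t \<le> sqrt ((1 / (3072 * K ^ 3))\<^sup>2)" by (rule real_sqrt_le_mono)
      also have "\<dots> = 1 / (3072 * K ^ 3)" using K by (simp add: real_sqrt_abs)
      finally have "1536 * K ^ 3 * sqrt t \<le> 1536 * K ^ 3 * (1 / (3072 * K ^ 3))"
        using K by (intro mult_left_mono) auto
      also have "\<dots> = 1 / 2" using K by simp
      finally show ?thesis .
    qed
    let ?F = "\<lambda>\<theta>. size_cf t M \<theta> * cis (- (real j * \<theta>))"
    have main: "Re (?F \<theta>) \<ge> exp (- 512 * (\<theta> / s)\<^sup>2 - 1) * cos 1" if "\<bar>\<theta>\<bar> \<le> K * s" for \<theta>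
    proof -
      from size_cf_expansion[OF t0(1), of M \<theta>] obtain R where R: "norm R \<le> 3 * size_third t M * \<bar>\<theta>\<bar> ^ 3"
        and e: "size_cf t M \<theta> = exp (\<i> * of_real (size_mean t M * \<theta>) - of_real (size_var t M * \<theta>\<^sup>2 / 2) + R)"
        by blast
      have "norm R \<le> 3 * (512 / t ^ 4) * (K * s) ^ 3"
        using that K s by (intro order_trans[OF R] mult_mono mult_left_mono power_mono size_third_le t0) auto
      also have "\<dots> = 1536 * K ^ 3 * sqrt t"
      proof -
        have "s ^ 3 = t ^ 3 * (sqrt t)\<^sup>2 * sqrt t"
          by (simp add: s_def power_mult_distrib power2_eq_square power3_eq_cube)
        also have "\<dots> = t ^ 4 * sqrt t" using t0 by (simp add: eval_nat_numeral)
        finally show ?thesis using t0 by (simp add: power_mult_distrib)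
      qed
      finally have R2: "norm R \<le> 1 / 2" using sq by linarith
      define b where "b = size_var t M * \<theta>\<^sup>2 / 2"
      have "size_var t M * \<theta>\<^sup>2 / 2 \<le> (1024 / t ^ 3) * \<theta>\<^sup>2 / 2"
        using size_var_le[OF t0(1), of M] by (intro divide_right_mono mult_right_mono) auto
      also have "\<dots> = 512 * (\<theta> / s)\<^sup>2"
        using t0 by (simp add: s_def power_divide size_scale_sq)
      finally have b: "b \<le> 512 * (\<theta> / s)\<^sup>2" by (simp add: b_def)
      have "?F \<theta> = exp (\<i> * of_real ((size_mean t M - real j) * \<theta>) - of_real b + R)"
        unfolding e cis_conv_exp b_def by (simp add: algebra_simps flip: exp_add)
      then have re: "Re (?F \<theta>) = exp (- b + Re R) * cos ((size_mean t M - real j) * \<theta> + Im R)"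
        by (simp add: Re_exp)
      have "\<bar>(size_mean t M - real j) * \<theta>\<bar> \<le> \<bar>size_mean t M - real j\<bar> * (K * s)"
        using that by (simp add: abs_mult mult_left_mono)
      also have "\<dots> = K * (\<bar>size_mean t M - real j\<bar> * s)" by simp
      also have "\<dots> \<le> K * (1 / (2 * K))"
        using mu d K unfolding s_def by (intro mult_left_mono) auto
      also have "\<dots> = 1 / 2" using K by simp
      finally have "\<bar>(size_mean t M - real j) * \<theta> + Im R\<bar> \<le> 1"
        using R2 abs_Im_le_cmod[of R] by linarith
      then have "cos 1 \<le> cos \<bar>(size_mean t M - real j) * \<theta> + Im R\<bar>"
        using pi_gt3 by (intro cos_monotone_0_pi_le) auto
      then have "cos 1 \<le> cos ((size_mean t M - real j) * \<theta> + Im R)" by (simp only: cos_abs_real)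
      moreover have "- 512 * (\<theta> / s)\<^sup>2 - 1 \<le> - b + Re R"
        using b R2 abs_Re_le_cmod[of R] by linarith
      ultimately show ?thesis unfolding re using cos1 by (intro mult_mono) auto
    qed
    define w where "w \<theta> = 1 / (1 + (0 + (1 / s) * \<theta>)\<^sup>2)" for \<theta> :: real
    \<comment> \<open>A minorant of the real part on the whole line. Subtracting the kernel also in
      the centre keeps its integral explicit: 2 s c1 - D pi s, which is at least c1 s.\<close>
    define g where "g \<theta> = c1 * indicator {-s..s} \<theta> - D * w \<theta>" for \<theta> :: real
    have g_int: "integrable lborel w"
      unfolding w_def using s by (intro lborel_integrable_real_affine integrable_inverse_1_plus_sq) auto
    have "pi = \<bar>1 / s\<bar> *\<^sub>R (\<integral>\<theta>. w \<theta> \<partial>lborel)"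
      unfolding w_def integral_inverse_1_plus_sq[symmetric] using s by (intro lborel_integral_real_affine) auto
    then have "(\<integral>\<theta>. w \<theta> \<partial>lborel) = pi * s"
      using s by (simp only: real_scaleR_def) (simp add: divide_simps mult_ac)
    then have g_val: "(\<integral>\<theta>. g \<theta> \<partial>lborel) = 2 * s * c1 - D * (pi * s)"
      unfolding g_def using g_int s by (subst Bochner_Integration.integral_diff) auto
    have "(\<integral>\<theta>. g \<theta> \<partial>lborel) \<le> (\<integral>\<theta>. Re (indicator {-pi..pi} \<theta> *\<^sub>R ?F \<theta>) \<partial>lborel)"
    proof (rule integral_mono)
      show "integrable lborel g"
        unfolding g_def using g_int integrable_real_indicator[of "{-s..s}" lborel]
        by (intro Bochner_Integration.integrable_diff integrable_mult_right) (auto simp: emeasure_lborel_Icc_eq)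
      show "integrable lborel (\<lambda>\<theta>. Re (indicator {-pi..pi} \<theta> *\<^sub>R ?F \<theta>))"
        using set_integrable_size_cf[OF t0(1), of M j] unfolding set_integrable_def by (rule integrable_Re)
      fix \<theta> :: real
      have neg: "g \<theta> \<le> 0" if "\<bar>\<theta>\<bar> > s"
        using that D one_plus_sq_gt_0[of "\<theta> / s"] by (auto simp: g_def w_def indicator_def)
      show "g \<theta> \<le> Re (indicator {-pi..pi} \<theta> *\<^sub>R ?F \<theta>)"
      proof (cases "\<bar>\<theta>\<bar> \<le> pi")
        case False
        then have "indicator {-pi..pi} \<theta> = (0 :: real)" by (auto simp: indicator_def)
        then show ?thesis using neg s1 False by simp
      next
        case True
        then have "indicator {-pi..pi} \<theta> = (1 :: real)" by (auto simp: indicator_def)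
        then have r: "Re (indicator {-pi..pi} \<theta> *\<^sub>R ?F \<theta>) = Re (?F \<theta>)" by simp
        consider "\<bar>\<theta>\<bar> \<le> s" | "s < \<bar>\<theta>\<bar>" "\<bar>\<theta>\<bar> \<le> K * s" | "\<bar>\<theta>\<bar> > K * s" by linarith
        then have "g \<theta> \<le> Re (?F \<theta>)"
        proof cases
          case 1
          have "(\<theta> / s)\<^sup>2 \<le> 1"
            using 1 s by (simp add: abs_square_le_1 abs_divide divide_le_eq_1)
          then have "c1 \<le> exp (- 512 * (\<theta> / s)\<^sup>2 - 1) * cos 1"
            unfolding c1_def using cos1 by (intro mult_right_mono) auto
          also have "\<dots> \<le> Re (?F \<theta>)"
          proof (rule main)
            show "\<bar>\<theta>\<bar> \<le> K * s" using 1 K s mult_right_mono[of 1 K s] by linarith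
          qed
          finally have "c1 \<le> Re (?F \<theta>)" .
          moreover have "g \<theta> \<le> c1"
          proof -
            have "0 \<le> D / (1 + (\<theta> / s)\<^sup>2)" using D one_plus_sq_gt_0[of "\<theta> / s"] by simp
            moreover from this have "- (D / (1 + (\<theta> / s)\<^sup>2)) \<le> c1" using c1 by linarith
            ultimately show ?thesis by (simp add: g_def w_def indicator_def)
          qed
          ultimately show ?thesis by linarith
        next
          case 2
          have "0 \<le> exp (- 512 * (\<theta> / s)\<^sup>2 - 1) * cos 1" using cos1 by simp
          with main[OF 2(2)] neg[OF 2(1)] show ?thesis by linarith
        next
          case 3
          let ?u = "\<theta> / s"
          have "s < \<bar>\<theta>\<bar>" using 3 K s mult_right_mono[of 1 K s] by linarith
          then have "g \<theta> = - (D / (1 + ?u\<^sup>2))"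
            by (auto simp: g_def w_def indicator_def)
          have "\<bar>?u\<bar> \<ge> K" using 3 s by (simp add: abs_divide pos_le_divide_eq)
          then have "\<bar>?u\<bar>\<^sup>2 \<ge> K\<^sup>2" using K by (intro power_mono) auto
          then have u: "1 + K\<^sup>2 \<le> 1 + ?u\<^sup>2" by (simp only: power2_abs add_le_cancel_left)
          have "norm (?F \<theta>) \<le> C / (1 + ?u\<^sup>2)\<^sup>2"
            using dec[OF t0(1) t M True] by (simp add: norm_mult s_def)
          also have "\<dots> = C / (1 + ?u\<^sup>2) / (1 + ?u\<^sup>2)" by (simp add: power2_eq_square)
          also have "\<dots> \<le> D / (1 + ?u\<^sup>2)"
            unfolding D_def using u C one_plus_sq_gt_0[of K] one_plus_sq_gt_0[of ?u]
            by (intro divide_right_mono divide_left_mono mult_pos_pos) auto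
          finally show ?thesis
            using abs_Re_le_cmod[of "?F \<theta>"] \<open>g \<theta> = - (D / (1 + ?u\<^sup>2))\<close> by linarith
        qed
        then show ?thesis by (simp only: r)
      qed
    qed
    also have "\<dots> = Re (LBINT \<theta>:{-pi..pi}. ?F \<theta>)"
      unfolding set_lebesgue_integral_def
      using set_integrable_size_cf[OF t0(1), of M j] unfolding set_integrable_def by (rule integral_Re)
    also have "\<dots> = 2 * pi * size_prob t M j"
      unfolding size_prob_fourier[OF t0(1)] by simp
    finally have "2 * s * c1 - D * (pi * s) \<le> 2 * pi * size_prob t M j" unfolding g_val .
    moreover have "D * pi * s \<le> c1 * s" using \<open>D * pi \<le> c1\<close> s by (intro mult_right_mono) auto
    ultimately have "c1 * s \<le> 2 * pi * size_prob t M j" by (simp add: mult_ac)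
    then show "c1 / (2 * pi) * size_scale t \<le> size_prob t M j"
      by (simp add: s_def pos_divide_le_eq mult_ac)
  qed
qed

section \<open>Ratios of pair counts\<close>

text \<open>This is \<open>1 / (B sqrt n)\<close>; at this parameter the total size has mean close to \<open>n\<close>.\<close>

definition mesh :: "nat \<Rightarrow> real" where
  "mesh n = pi / (sqrt 3 * sqrt (real n))"

lemma mesh_pos: "n > 0 \<Longrightarrow> mesh n > 0"
  by (simp add: mesh_def)

lemma mesh_sq: "n > 0 \<Longrightarrow> pi\<^sup>2 / (3 * (mesh n)\<^sup>2) = real n"
  by (simp add: mesh_def power_divide power_mult_distrib)

text \<open>Together with \<open>mesh_sq\<close> this eliminates n in favour of t, so that limits in
  n become limits of one real variable at 0 from the right, suitable for
  \<open>real_asymp\<close>.\<close>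

lemma size_times_mesh: "n > 0 \<Longrightarrow> real n * mesh n = pi\<^sup>2 / (3 * mesh n)"
  using mesh_sq[of n] mesh_pos[of n] by (simp add: field_simps power2_eq_square)

lemma mesh_at_right: "filterlim mesh (at_right 0) sequentially"
  unfolding mesh_def by real_asymp

lemma eventually_mesh: "eventually P (at_right 0) \<Longrightarrow> eventually (\<lambda>n. P (mesh n)) sequentially"
  using mesh_at_right by (simp add: filterlim_iff)

lemma tendsto_mesh: "(f \<longlongrightarrow> l) (at_right 0) \<Longrightarrow> (\<lambda>n. f (mesh n)) \<longlonglongrightarrow> l"
  by (rule filterlim_compose[OF _ mesh_at_right])

lemma eventually_mesh_small: "\<epsilon> > 0 \<Longrightarrow> eventually (\<lambda>n. mesh n < \<epsilon>) sequentially"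
  by (rule eventually_mesh) (auto simp: eventually_at_right_field)

lemma inverse_mesh_le:
  assumes "n > 0" "mesh n \<le> 1"
  shows "1 / mesh n \<le> real n"
proof -
  let ?t = "mesh n"
  have t: "?t > 0" by (rule mesh_pos) fact
  have "1 \<le> pi\<^sup>2 / 3" using power_mono[OF less_imp_le[OF pi_gt3], of 2] by simp
  then have "1 / ?t * 1 \<le> 1 / ?t * (pi\<^sup>2 / 3 / ?t)"
    using t assms(2) by (intro mult_left_mono) (auto simp: pos_le_divide_eq)
  also have "\<dots> = real n" using mesh_sq[OF assms(1)] by (simp add: power2_eq_square mult_ac)
  finally show ?thesis by simp
qed

text \<open>The mean misses n by O(t powr (-5/4)), which is negligible against t powr (-3/2), so
  \<open>size_prob_lower\<close> applies at n itself.\<close>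

lemma full_size_prob_lower:
  obtains c where "c > 0"
    "\<forall>\<^sub>F n in sequentially. size_prob (mesh n) n n \<ge> c * size_scale (mesh n)"
proof -
  obtain c \<delta> where c: "c > 0" "\<delta> > 0" and low:
    "\<And>t M j. 0 < t \<Longrightarrow> t < \<delta> \<Longrightarrow> 1 / t \<le> real M \<Longrightarrow> \<bar>size_mean t M - real j\<bar> * size_scale t \<le> \<delta> \<Longrightarrow>
       size_prob t M j \<ge> c * size_scale t"
    using size_prob_lower by blast
  obtain Z where Z: "\<And>t M. 0 < t \<Longrightarrow> 1 \<le> real M * t \<Longrightarrow>
    pi\<^sup>2 / (3 * t\<^sup>2) - Z * t powr (- 5 / 4) - 64 * exp (- (3 / 4 * (real M * t))) / t\<^sup>2 \<le> size_mean t M"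
    using size_mean_lower by blast
  have "((\<lambda>t::real. (Z * t powr (- 5 / 4) + 64 * exp (- (3 / 4 * (pi\<^sup>2 / (3 * t)))) / t\<^sup>2) * (t * sqrt t)) \<longlongrightarrow> 0) (at_right 0)"
    by real_asymp
  then have "\<forall>\<^sub>F t in at_right 0. (Z * t powr (- 5 / 4) + 64 * exp (- (3 / 4 * (pi\<^sup>2 / (3 * t)))) / t\<^sup>2) * (t * sqrt t) < \<delta>"
    using c by (intro order_tendstoD(2)) auto
  then have ev: "\<forall>\<^sub>F n in sequentially. (Z * mesh n powr (- 5 / 4) + 64 * exp (- (3 / 4 * (pi\<^sup>2 / (3 * mesh n)))) / (mesh n)\<^sup>2) * size_scale (mesh n) < \<delta>"
    by (rule eventually_mesh)
  show ?thesis
  proof (rule that[OF c(1)])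
    show "\<forall>\<^sub>F n in sequentially. size_prob (mesh n) n n \<ge> c * size_scale (mesh n)"
      using ev eventually_mesh_small[OF c(2)] eventually_mesh_small[OF zero_less_one] eventually_gt_at_top[of 0]
    proof eventually_elim
      case (elim n)
      let ?t = "mesh n"
      have t: "?t > 0" by (rule mesh_pos) fact
      have M: "1 / ?t \<le> real n" using elim by (intro inverse_mesh_le) auto
      then have M1: "1 \<le> real n * ?t" using t by (simp add: pos_divide_le_eq)
      have "size_mean ?t n \<le> real n" using size_mean_upper[OF t, of n] mesh_sq elim by simp
      moreover have "real n - Z * ?t powr (- 5 / 4) - 64 * exp (- (3 / 4 * (pi\<^sup>2 / (3 * ?t)))) / ?t\<^sup>2 \<le> size_mean ?t n"
        using Z[OF t M1] mesh_sq elim size_times_mesh by simp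
      ultimately have "\<bar>size_mean ?t n - real n\<bar> \<le> Z * ?t powr (- 5 / 4) + 64 * exp (- (3 / 4 * (pi\<^sup>2 / (3 * ?t)))) / ?t\<^sup>2"
        by linarith
      then have "\<bar>size_mean ?t n - real n\<bar> * size_scale ?t \<le> (Z * ?t powr (- 5 / 4) + 64 * exp (- (3 / 4 * (pi\<^sup>2 / (3 * ?t)))) / ?t\<^sup>2) * size_scale ?t"
        using t by (intro mult_right_mono) auto
      then show ?case using elim by (intro low[OF t _ M]) linarith+
    qed
  qed
qed

section \<open>The product over the large parts\<close>

definition tail_product :: "real \<Rightarrow> nat \<Rightarrow> nat \<Rightarrow> real" where
  "tail_product t M n = (\<Prod>k\<in>{M<..n}. 1 - exp (- (real k * t)))\<^sup>2"

lemma tail_product_eq: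
  assumes t: "t > 0" and M: "M \<le> n"
  shows "pair_weight t M = pair_weight t n * tail_product t M n"
proof -
  let ?f = "\<lambda>k. 1 - exp (- (real k * t))"
  have "{1..n} = {1..M} \<union> {M<..n}" using M by auto
  then have "(\<Prod>k=1..n. 1 / ?f k) = (\<Prod>k=1..M. 1 / ?f k) * (\<Prod>k\<in>{M<..n}. 1 / ?f k)"
    by (simp only:) (rule prod.union_disjoint, auto)
  moreover have "(\<Prod>k\<in>{M<..n}. 1 / ?f k) * (\<Prod>k\<in>{M<..n}. ?f k) = 1"
    unfolding prod.distrib[symmetric] using t by (intro prod.neutral) auto
  ultimately have "(\<Prod>k=1..n. 1 / ?f k) * (\<Prod>k\<in>{M<..n}. ?f k) = (\<Prod>k=1..M. 1 / ?f k)"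
    by simp
  then show ?thesis
    by (simp only: pair_weight_def tail_product_def power_mult_distrib[symmetric])
qed

text \<open>Both counts concern the same size n, so the exponential weights cancel.\<close>

lemma pair_count_ratio:
  assumes t: "t > 0" and M: "M \<le> n" and n: "n > 0"
  shows "real (pair_count M n) / real (pair_count n n)
    = size_prob t M n / size_prob t n n * tail_product t M n"
proof -
  have a: "real (pair_count n n) > 0" using pair_count_pos[OF n] by simp
  have w: "pair_weight t n > 0" by (rule pair_weight_pos[OF t])
  then have "tail_product t M n > 0"
    using pair_weight_pos[OF t, of M] unfolding tail_product_eq[OF t M] by (simp add: zero_less_mult_iff)
  then show ?thesis
    unfolding size_prob_def tail_product_eq[OF t M] using a w by simp
qed

definition tail_sum :: "real \<Rightarrow> nat \<Rightarrow> nat \<Rightarrow> real" where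
  "tail_sum t M n = (exp (- (real (Suc M) * t)) - exp (- (real (Suc n) * t))) / (1 - exp (- t))"

lemma tail_sum_eq:
  assumes t: "t > 0" and M: "M \<le> n"
  shows "(\<Sum>k\<in>{M<..n}. exp (- (real k * t))) = tail_sum t M n"
proof -
  have "1 - exp (- t) \<noteq> 0" using t by simp
  moreover have "(1 - exp (- t)) * (\<Sum>k\<in>{M<..n}. exp (- (real k * t)))
      = exp (- (real (Suc M) * t)) - exp (- (real (Suc n) * t))"
    using M
  proof (induction n rule: dec_induct)
    case (step n)
    have "{M<..Suc n} = insert (Suc n) {M<..n}" using step by auto
    then have "(\<Sum>k\<in>{M<..Suc n}. exp (- (real k * t))) = (\<Sum>k\<in>{M<..n}. exp (- (real k * t))) + exp (- (real (Suc n) * t))"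
      by simp
    moreover have "exp (- t) * exp (- (real (Suc n) * t)) = exp (- (real (Suc (Suc n)) * t))"
      by (simp add: algebra_simps flip: exp_add)
    ultimately show ?case using step.IH by (simp add: distrib_left left_diff_distrib)
  qed simp
  ultimately show ?thesis by (simp add: tail_sum_def field_simps)
qed

lemma tail_sum_le:
  assumes t: "t > 0"
  shows "tail_sum t M n \<le> exp (- (real (Suc M) * t)) / (1 - exp (- t))"
  unfolding tail_sum_def using t by (intro divide_right_mono) auto

text \<open>From exp (- y / (1 - y)) \<le> 1 - y \<le> exp (- y). The largest y, at k = M + 1,
  replaces the y in every denominator, which makes the exponent a multiple of
  \<open>tail_sum\<close>.\<close>

lemma tail_product_bounds:
  assumes t: "t > 0" and M: "M \<le> n"
  shows "tail_product t M n \<le> exp (- 2 * tail_sum t M n)"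
    and "exp (- 2 * tail_sum t M n / (1 - exp (- (real (Suc M) * t)))) \<le> tail_product t M n"
proof -
  let ?y = "\<lambda>k. exp (- (real k * t))"
  have sq: "exp (2 * x) = (exp x)\<^sup>2" for x :: real by (rule exp_double)
  have "(\<Prod>k\<in>{M<..n}. 1 - ?y k) \<le> (\<Prod>k\<in>{M<..n}. exp (- ?y k))"
  proof (intro prod_mono conjI)
    fix k
    show "1 - ?y k \<le> exp (- ?y k)" using exp_ge_add_one_self[of "- ?y k"] by simp
  qed (use t in auto)
  also have "\<dots> = exp (- tail_sum t M n)"
    by (simp add: tail_sum_eq[OF t M, symmetric] exp_sum[symmetric] sum_negf)
  finally have "(\<Prod>k\<in>{M<..n}. 1 - ?y k)\<^sup>2 \<le> (exp (- tail_sum t M n))\<^sup>2"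
    using t by (intro power_mono prod_nonneg) auto
  then show "tail_product t M n \<le> exp (- 2 * tail_sum t M n)"
    unfolding tail_product_def sq[symmetric] by simp
  let ?d = "1 - ?y (Suc M)"
  have d: "?d > 0" using t by simp
  have "exp (- tail_sum t M n / ?d) = (\<Prod>k\<in>{M<..n}. exp (- ?y k / ?d))"
    by (simp add: tail_sum_eq[OF t M, symmetric] exp_sum[symmetric] sum_negf sum_divide_distrib[symmetric])
  also have "\<dots> \<le> (\<Prod>k\<in>{M<..n}. 1 - ?y k)"
  proof (intro prod_mono conjI)
    fix k assume k: "k \<in> {M<..n}"
    have y1: "?y k < 1" using k t by simp
    have "real (Suc M) * t \<le> real k * t" using k t by (intro mult_right_mono) auto
    then have "?y k \<le> ?y (Suc M)" by simp
    then have "?y k / (1 - ?y k) \<le> ?y k / ?d" using d y1 by (intro divide_left_mono) auto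
    then have "exp (?y k / (1 - ?y k)) \<le> exp (?y k / ?d)" by simp
    moreover have "1 / (1 - ?y k) \<le> exp (?y k / (1 - ?y k))"
    proof -
      have "1 / (1 - y) = 1 + y / (1 - y)" if "y < 1" for y :: real
        using that by (simp add: divide_simps)
      from this[OF y1] show ?thesis using exp_ge_add_one_self[of "?y k / (1 - ?y k)"] by linarith
    qed
    ultimately have "1 / (1 - ?y k) \<le> exp (?y k / ?d)" by linarith
    then have "1 / exp (?y k / ?d) \<le> 1 - ?y k" using y1 by (simp add: field_simps)
    then show "exp (- ?y k / ?d) \<le> 1 - ?y k" by (simp add: exp_minus inverse_eq_divide)
  qed auto
  finally have "(exp (- tail_sum t M n / ?d))\<^sup>2 \<le> (\<Prod>k\<in>{M<..n}. 1 - ?y k)\<^sup>2"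
    by (intro power_mono) auto
  then show "exp (- 2 * tail_sum t M n / ?d) \<le> tail_product t M n"
    unfolding tail_product_def sq[symmetric] by simp
qed

text \<open>The hypothesis makes exp (- M t) = O(t), so the difference is O(t^3 * t powr (3/4) /
  t^2). Divided by \<open>size_scale\<close>, the order of the denominator, this leaves O(t powr
  (1/4)).\<close>

lemma size_prob_ratio_tendsto:
  assumes ev: "\<forall>\<^sub>F n in sequentially. M n \<le> n \<and> ln (1 / mesh n) - K \<le> real (M n) * mesh n"
  shows "(\<lambda>n. size_prob (mesh n) (M n) n / size_prob (mesh n) n n) \<longlonglongrightarrow> 1"
proof -
  obtain c where c: "c > 0" and low: "\<forall>\<^sub>F n in sequentially. size_prob (mesh n) n n \<ge> c * size_scale (mesh n)"
    using full_size_prob_lower by blast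
  obtain C where C: "C > 0" and dif:
    "\<And>t M M' j. 0 < t \<Longrightarrow> t \<le> 1 / 2 \<Longrightarrow> 1 / t \<le> real M \<Longrightarrow> M \<le> M' \<Longrightarrow>
       \<bar>size_prob t M j - size_prob t M' j\<bar> \<le> C * t ^ 3 * (\<Sum>k\<in>{M<..M'}. real k * occupation t k)"
    using size_prob_diff by blast
  define D where "D = C * 32 * exp (3 / 4 * K) / c"
  have "\<forall>\<^sub>F t::real in at_right 0. 1 \<le> ln (1 / t) - K" by real_asymp
  then have large: "\<forall>\<^sub>F n in sequentially. 1 \<le> ln (1 / mesh n) - K" by (rule eventually_mesh)
  have lim: "((\<lambda>t::real. D * (t * exp (- (3 / 4 * ln (1 / t))) / (t * sqrt t))) \<longlongrightarrow> 0) (at_right 0)"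
    by real_asymp
  have "(\<lambda>n. size_prob (mesh n) (M n) n / size_prob (mesh n) n n - 1) \<longlonglongrightarrow> 0"
  proof (rule tendsto_0_le[where K = 1, OF tendsto_mesh[OF lim]])
    show "\<forall>\<^sub>F n in sequentially. norm (size_prob (mesh n) (M n) n / size_prob (mesh n) n n - 1)
      \<le> norm (D * (mesh n * exp (- (3 / 4 * ln (1 / mesh n))) / (size_scale (mesh n)))) * 1"
      using ev low large eventually_mesh_small[of "1 / 2", simplified] eventually_gt_at_top[of 0]
    proof eventually_elim
      case (elim n)
      let ?t = "mesh n"
      have t: "?t > 0" by (rule mesh_pos) fact
      have M1: "1 \<le> real (M n) * ?t" using elim by linarith
      then have M2: "1 / ?t \<le> real (M n)" using t by (simp add: pos_divide_le_eq)
      have s: "c * size_scale ?t > 0" using t c by simp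
      have p: "size_prob ?t n n > 0" using s elim by linarith
      have "\<bar>size_prob ?t (M n) n - size_prob ?t n n\<bar> \<le> C * ?t ^ 3 * (\<Sum>k\<in>{M n<..n}. real k * occupation ?t k)"
        using elim by (intro dif t M2) auto
      also have "\<dots> \<le> C * ?t ^ 3 * (32 * exp (- (3 / 4 * (real (M n) * ?t))) / ?t\<^sup>2)"
        using C t by (intro mult_left_mono occupation_tail M1) auto
      also have "\<dots> \<le> C * ?t ^ 3 * (32 * exp (3 / 4 * K - 3 / 4 * ln (1 / ?t)) / ?t\<^sup>2)"
        using C t elim by (intro mult_left_mono divide_right_mono) auto
      also have "\<dots> = D * c * (?t * exp (- (3 / 4 * ln (1 / ?t))))"
      proof -
        have "exp (3 / 4 * K - 3 / 4 * ln (1 / ?t)) = exp (3 / 4 * K) * exp (- (3 / 4 * ln (1 / ?t)))"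
          by (simp flip: exp_add)
        moreover have "C * ?t ^ 3 * (32 * (x * y) / ?t\<^sup>2) = (C * 32 * x / c) * c * (?t * y)" for x y
          using t c by (simp add: power2_eq_square power3_eq_cube)
        ultimately show ?thesis by (simp only: D_def)
      qed
      finally have d: "\<bar>size_prob ?t (M n) n - size_prob ?t n n\<bar> \<le> D * c * (?t * exp (- (3 / 4 * ln (1 / ?t))))" .
      have "\<bar>size_prob ?t (M n) n / size_prob ?t n n - 1\<bar> = \<bar>size_prob ?t (M n) n - size_prob ?t n n\<bar> / size_prob ?t n n"
        using p by (simp add: field_simps)
      also have "\<dots> \<le> (D * c * (?t * exp (- (3 / 4 * ln (1 / ?t))))) / (c * size_scale ?t)"
        using d elim s by (intro frac_le) auto
      also have "\<dots> = D * (?t * exp (- (3 / 4 * ln (1 / ?t))) / size_scale ?t)"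
        using c by simp
      finally show ?case by simp
    qed
  qed
  then show ?thesis by (simp add: LIM_zero_iff)
qed

section \<open>Uniform bounds for counts\<close>

lemma pair_count_eq:
  "t > 0 \<Longrightarrow> real (pair_count M j) = size_prob t M j * pair_weight t M * exp (real j * t)"
  using pair_weight_pos[of t M] by (simp add: size_prob_def exp_minus)

text \<open>The exponential weight supplies exp (- s t). The local probabilities at n - s and at n
  are compared only up to a constant, uniformly in s because \<open>size_prob_upper\<close> holds at
  every size.\<close>

lemma shifted_pair_count_le:
  obtains C where "C > 0"
    "\<forall>\<^sub>F n in sequentially. \<forall>m\<le>n. \<forall>s.
       real (shifted_pair_count m n s) \<le> C * real (pair_count n n) * exp (- (real s * mesh n))"
proof -
  obtain c where c: "c > 0" and low: "\<forall>\<^sub>F n in sequentially. size_prob (mesh n) n n \<ge> c * size_scale (mesh n)"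
    using full_size_prob_lower by blast
  obtain C where C: "C > 0" and up:
    "\<And>t M j. 0 < t \<Longrightarrow> t \<le> 1 / 2 \<Longrightarrow> 1 / t \<le> real M \<Longrightarrow> size_prob t M j \<le> C * size_scale t"
    using size_prob_upper by blast
  show ?thesis
  proof (rule that[of "C / c"])
    show "\<forall>\<^sub>F n in sequentially. \<forall>m\<le>n. \<forall>s.
       real (shifted_pair_count m n s) \<le> C / c * real (pair_count n n) * exp (- (real s * mesh n))"
      using low eventually_mesh_small[of "1 / 2", simplified] eventually_gt_at_top[of 0]
    proof eventually_elim
      case (elim n)
      let ?t = "mesh n"
      have t: "?t > 0" by (rule mesh_pos) fact
      have n: "1 / ?t \<le> real n" using elim by (intro inverse_mesh_le) auto
      show ?case
      proof (intro allI impI)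
        fix m s assume m: "m \<le> n"
        show "real (shifted_pair_count m n s) \<le> C / c * real (pair_count n n) * exp (- (real s * ?t))"
        proof (cases "s \<le> n")
          case True
          have "size_prob ?t n (n - s) \<le> C / c * (c * size_scale ?t)"
            using up[OF t _ n, of "n - s"] elim c by simp
          also have "\<dots> \<le> C / c * size_prob ?t n n"
            using elim C c by (intro mult_left_mono) auto
          finally have p: "size_prob ?t n (n - s) \<le> C / c * size_prob ?t n n" .
          have "real (shifted_pair_count m n s) \<le> real (pair_count n (n - s))"
            using pair_count_mono[OF m] True by (simp add: shifted_pair_count_def)
          also have "\<dots> = size_prob ?t n (n - s) * pair_weight ?t n * exp (real (n - s) * ?t)"
            by (rule pair_count_eq[OF t])
          also have "\<dots> \<le> C / c * size_prob ?t n n * pair_weight ?t n * exp (real (n - s) * ?t)"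
            using p pair_weight_pos[OF t, of n] by (intro mult_right_mono) auto
          also have "exp (real (n - s) * ?t) = exp (real n * ?t) * exp (- (real s * ?t))"
            using True by (simp add: of_nat_diff left_diff_distrib flip: exp_add)
          also have "C / c * size_prob ?t n n * pair_weight ?t n * (exp (real n * ?t) * exp (- (real s * ?t)))
              = C / c * real (pair_count n n) * exp (- (real s * ?t))"
            by (simp add: pair_count_eq[OF t, of n n])
          finally show ?thesis .
        qed (use C c in \<open>simp add: shifted_pair_count_def\<close>)
      qed
    qed
  qed (use C c in simp)
qed

lemma one_minus_exp_ge:
  fixes t :: real
  assumes "0 \<le> t" "t \<le> 1"
  shows "1 - exp (- t) \<ge> t / 2"
proof -
  have "exp (- t) \<le> 1 / (1 + t)"
    using exp_ge_add_one_self[of t] assms by (simp add: exp_minus field_simps)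
  also have "\<dots> \<le> 1 - t / 2"
    using assms mult_right_mono[of t 1 t] by (simp add: field_simps)
  finally show ?thesis by simp
qed

lemma floor_bounds:
  assumes "x \<ge> (0::real)"
  shows "real (nat \<lfloor>x\<rfloor>) \<le> x" "x \<le> real (nat \<lfloor>x\<rfloor>) + 1" "x \<le> real (Suc (nat \<lfloor>x\<rfloor>))"
proof -
  have e: "real (nat \<lfloor>x\<rfloor>) = of_int \<lfloor>x\<rfloor>" using assms by simp
  show "real (nat \<lfloor>x\<rfloor>) \<le> x" "x \<le> real (nat \<lfloor>x\<rfloor>) + 1" "x \<le> real (Suc (nat \<lfloor>x\<rfloor>))"
    unfolding of_nat_Suc e using floor_correct[of x] by linarith+
qed

text \<open>\<open>size_prob_upper\<close> needs parts up to 1 / t, whereas x may be smaller. The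
  bound on the parts is therefore raised to the \<open>M\<close> below, which keeps (M + 1) t \<le>
  x t + 2 and so costs only the factor exp (- 2) in the exponent.\<close>

lemma pair_count_le:
  obtains C where "C > 0"
    "\<forall>\<^sub>F n in sequentially. \<forall>x\<ge>0. nat \<lfloor>x\<rfloor> \<le> n \<longrightarrow>
       real (pair_count (nat \<lfloor>x\<rfloor>) n) \<le> C * real (pair_count n n) * exp (- (2 * exp (- 2) * exp (- (x * mesh n)) / mesh n))"
proof -
  obtain c where c: "c > 0" and low: "\<forall>\<^sub>F n in sequentially. size_prob (mesh n) n n \<ge> c * size_scale (mesh n)"
    using full_size_prob_lower by blast
  obtain C where C: "C > 0" and up:
    "\<And>t M j. 0 < t \<Longrightarrow> t \<le> 1 / 2 \<Longrightarrow> 1 / t \<le> real M \<Longrightarrow> size_prob t M j \<le> C * size_scale t"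
    using size_prob_upper by blast
  have "((\<lambda>t::real. exp (- (pi\<^sup>2 / (3 * t) + t)) / (1 - exp (- t))) \<longlongrightarrow> 0) (at_right 0)"
    by real_asymp
  then have "\<forall>\<^sub>F t in at_right (0::real). exp (- (pi\<^sup>2 / (3 * t) + t)) / (1 - exp (- t)) < 1"
    by (intro order_tendstoD(2)) auto
  then have small: "\<forall>\<^sub>F n in sequentially. exp (- (pi\<^sup>2 / (3 * mesh n) + mesh n)) / (1 - exp (- mesh n)) < 1"
    by (rule eventually_mesh)
  have "\<forall>\<^sub>F t in at_right (0::real). 1 / t + 1 \<le> pi\<^sup>2 / (3 * t\<^sup>2)" by real_asymp
  then have le_n: "\<forall>\<^sub>F n in sequentially. 1 / mesh n + 1 \<le> pi\<^sup>2 / (3 * (mesh n)\<^sup>2)" by (rule eventually_mesh)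
  show ?thesis
  proof (rule that[of "C / c * exp 2"])
    show "\<forall>\<^sub>F n in sequentially. \<forall>x\<ge>0. nat \<lfloor>x\<rfloor> \<le> n \<longrightarrow>
       real (pair_count (nat \<lfloor>x\<rfloor>) n) \<le> C / c * exp 2 * real (pair_count n n) * exp (- (2 * exp (- 2) * exp (- (x * mesh n)) / mesh n))"
      using low small le_n eventually_mesh_small[of "1 / 2", simplified] eventually_gt_at_top[of 0]
    proof eventually_elim
      case (elim n)
      let ?t = "mesh n"
      have t: "?t > 0" by (rule mesh_pos) fact
      have size: "real n * ?t = pi\<^sup>2 / (3 * ?t)" using elim size_times_mesh by simp
      define N where "N = nat \<lfloor>1 / ?t\<rfloor> + 1"
      have "real N = real (nat \<lfloor>1 / ?t\<rfloor>) + 1" by (simp only: N_def of_nat_add of_nat_1)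
      then have N: "1 / ?t \<le> real N" "real N \<le> 1 / ?t + 1"
        using floor_bounds(1,2)[of "1 / ?t"] t by (simp_all only: zero_le_divide_1_iff less_imp_le add_le_cancel_right)
      have Nn: "N \<le> n" using N(2) elim mesh_sq[of n] by simp
      show ?case
      proof (intro allI impI)
        fix x :: real assume x: "x \<ge> 0" and Mn: "nat \<lfloor>x\<rfloor> \<le> n"
        define M where "M = max (nat \<lfloor>x\<rfloor>) N"
        have M: "M \<le> n" "1 / ?t \<le> real M" using Mn Nn N by (auto simp: M_def)
        have M1: "real (Suc M) * ?t \<le> x * ?t + 2"
        proof (cases "nat \<lfloor>x\<rfloor> \<ge> N")
          case True
          have "real (Suc M) \<le> x + 1" using True floor_bounds[OF x] by (simp add: M_def)
          then have "real (Suc M) * ?t \<le> (x + 1) * ?t" using t by (intro mult_right_mono) auto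
          then show ?thesis using elim by (simp add: distrib_right)
        next
          case False
          then have "real (Suc M) \<le> 1 / ?t + 2" using N by (simp add: M_def)
          then have "real (Suc M) * ?t \<le> (1 / ?t + 2) * ?t" using t by (intro mult_right_mono) auto
          also have "\<dots> = 1 + 2 * ?t" using t by (simp add: distrib_right)
          also have "\<dots> \<le> x * ?t + 2" using elim x t by (simp add: add_increasing)
          finally show ?thesis .
        qed
        \<comment> \<open>The boundary term of \<open>tail_sum\<close> at n is below 1 by
          \<open>small\<close>; doubled in the exponent, this 1 becomes the factor
          \<open>exp 2\<close> of the constant.\<close>
        have "exp (- 2) * exp (- (x * ?t)) / ?t - 1 \<le> tail_sum ?t M n"
        proof -
          have "exp (- 2) * exp (- (x * ?t)) \<le> exp (- (real (Suc M) * ?t))"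
            using M1 by (simp flip: exp_add)
          moreover have "1 - exp (- ?t) \<le> ?t" using exp_ge_add_one_self[of "- ?t"] by simp
          ultimately have "exp (- 2) * exp (- (x * ?t)) / ?t \<le> exp (- (real (Suc M) * ?t)) / (1 - exp (- ?t))"
            using t by (intro frac_le) auto
          moreover have "real (Suc n) * ?t = pi\<^sup>2 / (3 * ?t) + ?t" using size by (simp add: distrib_right)
          ultimately show ?thesis
            using elim by (simp add: tail_sum_def diff_divide_distrib)
        qed
        then have ts: "- 2 * tail_sum ?t M n \<le> 2 + - (2 * exp (- 2) * exp (- (x * ?t)) / ?t)" by simp
        have s: "c * size_scale ?t > 0" using t c by simp
        have "real (pair_count (nat \<lfloor>x\<rfloor>) n) \<le> real (pair_count M n)"
          using pair_count_mono[of "nat \<lfloor>x\<rfloor>" M n] by (simp add: M_def)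
        also have "\<dots> = real (pair_count n n) * (size_prob ?t M n / size_prob ?t n n * tail_product ?t M n)"
          using pair_count_ratio[OF t M(1)] elim pair_count_pos[of n n] by (simp add: field_simps)
        also have "\<dots> \<le> real (pair_count n n) * (C / c * exp (- 2 * tail_sum ?t M n))"
        proof (intro mult_left_mono mult_mono)
          have "size_prob ?t M n / size_prob ?t n n \<le> (C * size_scale ?t) / (c * size_scale ?t)"
            using up[OF t _ M(2), of n] elim s size_prob_nonneg[OF t] C t by (intro frac_le) auto
          then show "size_prob ?t M n / size_prob ?t n n \<le> C / c" using t by simp
          show "tail_product ?t M n \<le> exp (- 2 * tail_sum ?t M n)"
            by (rule tail_product_bounds[OF t M(1)])
        qed (use C c size_prob_nonneg[OF t] in \<open>auto simp: tail_product_def\<close>)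
        also have "\<dots> \<le> real (pair_count n n) * (C / c * exp (2 + - (2 * exp (- 2) * exp (- (x * ?t)) / ?t)))"
          using C c ts by (intro mult_left_mono) auto
        also have "\<dots> = C / c * exp 2 * real (pair_count n n) * exp (- (2 * exp (- 2) * exp (- (x * ?t)) / ?t))"
          unfolding exp_add by (simp only: mult_ac)
        finally show "real (pair_count (nat \<lfloor>x\<rfloor>) n) \<le> C / c * exp 2 * real (pair_count n n) * exp (- (2 * exp (- 2) * exp (- (x * ?t)) / ?t))" .
      qed
    qed
  qed (use C c in simp)
qed

text \<open>The value of the peak whose normalisation is \<open>v\<close>, for \<open>t = mesh n\<close>.\<close>

definition cutoff :: "real \<Rightarrow> real \<Rightarrow> real" where
  "cutoff t v = (ln (2 / t) + v) / t"

lemma cutoff_times: "t > 0 \<Longrightarrow> cutoff t v * t = ln (2 / t) + v"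
  by (simp add: cutoff_def)

lemma exp_cutoff:
  assumes "t > 0"
  shows "exp (- (cutoff t v * t)) = t / 2 * exp (- v)"
proof -
  have "exp (- (cutoff t v * t)) = inverse (exp (ln (2 / t))) * exp (- v)"
    unfolding cutoff_times[OF assms] by (simp add: exp_minus[symmetric] flip: exp_add)
  then show ?thesis using assms by simp
qed

lemma eventually_cutoff:
  "\<forall>\<^sub>F n in sequentially. 0 \<le> cutoff (mesh n) v \<and> cutoff (mesh n) v \<le> real n"
proof -
  have "\<forall>\<^sub>F t in at_right (0::real). 0 \<le> (ln (2 / t) + v) / t" by real_asymp
  moreover have "\<forall>\<^sub>F t in at_right (0::real). (ln (2 / t) + v) / t \<le> pi\<^sup>2 / (3 * t\<^sup>2)" by real_asymp
  ultimately have "\<forall>\<^sub>F n in sequentially. 0 \<le> cutoff (mesh n) v"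
    "\<forall>\<^sub>F n in sequentially. cutoff (mesh n) v \<le> pi\<^sup>2 / (3 * (mesh n)\<^sup>2)"
    unfolding cutoff_def by (auto dest: eventually_mesh)
  then show ?thesis
    using eventually_gt_at_top[of 0] by eventually_elim (simp add: mesh_sq)
qed

section \<open>Limits at the Gumbel cutoff\<close>

lemma tail_sum_cutoff_tendsto:
  "(\<lambda>n. tail_sum (mesh n) (nat \<lfloor>cutoff (mesh n) v\<rfloor>) n) \<longlonglongrightarrow> exp (- v) / 2"
proof -
  let ?L = "\<lambda>t::real. (exp (- t) * (t / 2 * exp (- v)) - exp (- (pi\<^sup>2 / (3 * t) + t))) / (1 - exp (- t))"
  let ?U = "\<lambda>t::real. (t / 2 * exp (- v)) / (1 - exp (- t))"
  have "(?L \<longlongrightarrow> exp (- v) / 2) (at_right 0)" "(?U \<longlongrightarrow> exp (- v) / 2) (at_right 0)"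
    by real_asymp+
  note lims = this[THEN tendsto_mesh]
  have "\<forall>\<^sub>F n in sequentially. ?L (mesh n) \<le> tail_sum (mesh n) (nat \<lfloor>cutoff (mesh n) v\<rfloor>) n \<and>
     tail_sum (mesh n) (nat \<lfloor>cutoff (mesh n) v\<rfloor>) n \<le> ?U (mesh n)"
    using eventually_cutoff[of v] eventually_gt_at_top[of 0]
  proof eventually_elim
    case (elim n)
    let ?t = "mesh n" and ?x = "cutoff (mesh n) v"
    let ?M = "nat \<lfloor>?x\<rfloor>"
    have t: "?t > 0" by (rule mesh_pos) fact
    have fl: "real ?M \<le> ?x" "?x \<le> real (Suc ?M)" using floor_bounds[of ?x] elim by blast+
    have "real (Suc ?M) * ?t \<le> (?x + 1) * ?t" using fl t by (intro mult_right_mono) auto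
    then have "exp (- ((?x + 1) * ?t)) \<le> exp (- (real (Suc ?M) * ?t))" by simp
    moreover have "exp (- ((?x + 1) * ?t)) = exp (- ?t) * (?t / 2 * exp (- v))"
      unfolding exp_cutoff[OF t, symmetric] by (simp add: distrib_right flip: exp_add)
    ultimately have lo: "exp (- ?t) * (?t / 2 * exp (- v)) \<le> exp (- (real (Suc ?M) * ?t))" by simp
    have "?x * ?t \<le> real (Suc ?M) * ?t" using fl t by (intro mult_right_mono) auto
    then have "exp (- (real (Suc ?M) * ?t)) \<le> exp (- (?x * ?t))" by simp
    then have hi: "exp (- (real (Suc ?M) * ?t)) \<le> ?t / 2 * exp (- v)" unfolding exp_cutoff[OF t] .
    have "real (Suc n) * ?t = pi\<^sup>2 / (3 * ?t) + ?t" using elim by (simp add: distrib_right size_times_mesh)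
    then have "?L ?t \<le> tail_sum ?t ?M n"
      unfolding tail_sum_def using lo t by (intro divide_right_mono) auto
    moreover have "tail_sum ?t ?M n \<le> ?U ?t"
      using hi t by (intro order_trans[OF tail_sum_le[OF t]] divide_right_mono) auto
    ultimately show ?case by simp
  qed
  then show ?thesis
    by (intro tendsto_sandwich[OF _ _ lims]) (auto elim: eventually_mono)
qed

lemma pair_count_ratio_tendsto:
  "(\<lambda>n. real (pair_count (nat \<lfloor>cutoff (mesh n) v\<rfloor>) n) / real (pair_count n n)) \<longlonglongrightarrow> exp (- exp (- v))"
proof -
  define M where "M n = nat \<lfloor>cutoff (mesh n) v\<rfloor>" for n
  have ev: "\<forall>\<^sub>F n in sequentially. M n \<le> n \<and> ln (2 / mesh n) + v \<le> real (Suc (M n)) * mesh n"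
    using eventually_cutoff[of v] eventually_gt_at_top[of 0]
  proof eventually_elim
    case (elim n)
    have t: "mesh n > 0" by (rule mesh_pos) fact
    have fl: "real (M n) \<le> cutoff (mesh n) v" "cutoff (mesh n) v \<le> real (Suc (M n))"
      unfolding M_def using floor_bounds[of "cutoff (mesh n) v"] elim by blast+
    show ?case
      using fl elim mult_right_mono[OF fl(2), of "mesh n"] t by (simp add: cutoff_times)
  qed
  \<comment> \<open>K = 1 - v works: rounding the cutoff down lowers M t by at most t < 1.\<close>
  have prob: "(\<lambda>n. size_prob (mesh n) (M n) n / size_prob (mesh n) n n) \<longlonglongrightarrow> 1"
  proof (rule size_prob_ratio_tendsto)
    show "\<forall>\<^sub>F n in sequentially. M n \<le> n \<and> ln (1 / mesh n) - (1 - v) \<le> real (M n) * mesh n"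
      using ev eventually_mesh_small[OF zero_less_one] eventually_gt_at_top[of 0]
    proof eventually_elim
      case (elim n)
      have t: "mesh n > 0" by (rule mesh_pos) fact
      have "ln (1 / mesh n) \<le> ln (2 / mesh n)" using t by (simp add: ln_div)
      then show ?case using elim by (simp add: distrib_right)
    qed
  qed
  have ts: "(\<lambda>n. tail_sum (mesh n) (M n) n) \<longlonglongrightarrow> exp (- v) / 2"
    unfolding M_def by (rule tail_sum_cutoff_tendsto)
  have "((\<lambda>t::real. t / 2 * exp (- v)) \<longlongrightarrow> 0) (at_right 0)" by real_asymp
  then have "(\<lambda>n. mesh n / 2 * exp (- v)) \<longlonglongrightarrow> 0" by (rule tendsto_mesh)
  then have y: "(\<lambda>n. exp (- (real (Suc (M n)) * mesh n))) \<longlonglongrightarrow> 0"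
  proof (rule Lim_null_comparison[rotated])
    show "\<forall>\<^sub>F n in sequentially. norm (exp (- (real (Suc (M n)) * mesh n))) \<le> mesh n / 2 * exp (- v)"
      using ev eventually_gt_at_top[of 0]
    proof eventually_elim
      case (elim n)
      have t: "mesh n > 0" by (rule mesh_pos) fact
      show ?case unfolding exp_cutoff[OF t, symmetric] using elim cutoff_times[OF t] by simp
    qed
  qed
  have prod: "(\<lambda>n. tail_product (mesh n) (M n) n) \<longlonglongrightarrow> exp (- exp (- v))"
  proof (rule tendsto_sandwich)
    show "\<forall>\<^sub>F n in sequentially. exp (- 2 * tail_sum (mesh n) (M n) n / (1 - exp (- (real (Suc (M n)) * mesh n)))) \<le> tail_product (mesh n) (M n) n"
      using ev eventually_gt_at_top[of 0] by eventually_elim (intro tail_product_bounds mesh_pos, auto)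
    show "\<forall>\<^sub>F n in sequentially. tail_product (mesh n) (M n) n \<le> exp (- 2 * tail_sum (mesh n) (M n) n)"
      using ev eventually_gt_at_top[of 0] by eventually_elim (intro tail_product_bounds mesh_pos, auto)
    show "(\<lambda>n. exp (- 2 * tail_sum (mesh n) (M n) n)) \<longlonglongrightarrow> exp (- exp (- v))"
      by (rule tendsto_eq_intros ts refl | simp)+
    show "(\<lambda>n. exp (- 2 * tail_sum (mesh n) (M n) n / (1 - exp (- (real (Suc (M n)) * mesh n))))) \<longlonglongrightarrow> exp (- exp (- v))"
      by (rule tendsto_eq_intros ts y refl | simp)+
  qed
  have "\<forall>\<^sub>F n in sequentially. size_prob (mesh n) (M n) n / size_prob (mesh n) n n * tail_product (mesh n) (M n) n
      = real (pair_count (M n) n) / real (pair_count n n)"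
    using ev eventually_gt_at_top[of 0] by eventually_elim (intro pair_count_ratio[symmetric] mesh_pos, auto)
  then have "(\<lambda>n. real (pair_count (M n) n) / real (pair_count n n)) \<longlonglongrightarrow> 1 * exp (- exp (- v))"
    by (rule Lim_transform_eventually[OF tendsto_mult[OF prob prod]])
  then show ?thesis by (simp add: M_def)
qed

lemma tie_count_negligible: "(\<lambda>n. real (tie_count n n) / real (pair_count n n)) \<longlonglongrightarrow> 0"
proof -
  obtain C where C: "C > 0" and shift: "\<forall>\<^sub>F n in sequentially. \<forall>m\<le>n. \<forall>s.
       real (shifted_pair_count m n s) \<le> C * real (pair_count n n) * exp (- (real s * mesh n))"
    using shifted_pair_count_le by blast
  obtain D where D: "D > 0" and small: "\<forall>\<^sub>F n in sequentially. \<forall>x\<ge>0. nat \<lfloor>x\<rfloor> \<le> n \<longrightarrow>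
       real (pair_count (nat \<lfloor>x\<rfloor>) n) \<le> D * real (pair_count n n) * exp (- (2 * exp (- 2) * exp (- (x * mesh n)) / mesh n))"
    using pair_count_le by blast
  \<comment> \<open>The threshold for m is \<open>?u t / t\<close>. Below it the pair count is at
    most of relative size exp (- c t powr (-1/4)); above it the ties contribute O(t powr (3/2) / t).
    Any factor strictly between 1/2 and 1 would do in place of 3/4.\<close>
  let ?u = "\<lambda>t::real. 3 / 4 * ln (1 / t)"
  have "\<forall>\<^sub>F t in at_right (0::real). 0 \<le> ?u t / t" by real_asymp
  moreover have "\<forall>\<^sub>F t in at_right (0::real). ?u t / t \<le> pi\<^sup>2 / (3 * t\<^sup>2)" by real_asymp
  ultimately have x: "\<forall>\<^sub>F n in sequentially. 0 \<le> ?u (mesh n) / mesh n"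
    "\<forall>\<^sub>F n in sequentially. ?u (mesh n) / mesh n \<le> pi\<^sup>2 / (3 * (mesh n)\<^sup>2)"
    by (auto dest: eventually_mesh)
  let ?g = "\<lambda>t::real. D * exp (- (2 * exp (- 2) * exp (- ?u t) / t)) + C * (exp (- (2 * ?u t)) / (1 - exp (- (2 * t))))"
  have "(?g \<longlongrightarrow> 0) (at_right 0)" by real_asymp
  then have "(\<lambda>n. ?g (mesh n)) \<longlonglongrightarrow> 0" by (rule tendsto_mesh)
  then show ?thesis
  proof (rule Lim_null_comparison[rotated])
    show "\<forall>\<^sub>F n in sequentially. norm (real (tie_count n n) / real (pair_count n n)) \<le> ?g (mesh n)"
      using shift small x eventually_gt_at_top[of 0]
    proof eventually_elim
      case (elim n)
      let ?t = "mesh n" and ?a = "real (pair_count n n)"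
      have t: "?t > 0" by (rule mesh_pos) fact
      have a: "?a > 0" using elim pair_count_pos by simp
      define x where "x = ?u ?t / ?t"
      define M where "M = nat \<lfloor>x\<rfloor>"
      have x: "0 \<le> x" "x \<le> real n" "x * ?t = ?u ?t"
        using elim t mesh_sq[of n] by (auto simp: x_def)
      have fl: "real M \<le> x" "x \<le> real (Suc M)" unfolding M_def using floor_bounds[OF x(1)] by blast+
      have M: "M \<le> n" using fl x by linarith
      have "{1..n} = {1..M} \<union> {M<..n}" using M by auto
      then have "tie_count n n = tie_count n M + (\<Sum>m\<in>{M<..n}. shifted_pair_count m n (2 * m))"
        unfolding tie_count_def by (simp only:) (rule sum.union_disjoint, auto)
      moreover have "real (tie_count n M) \<le> D * ?a * exp (- (2 * exp (- 2) * exp (- ?u ?t) / ?t))"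
      proof -
        have "tie_count n M \<le> pair_count M n" using elim by (intro tie_count_le) auto
        moreover have "real (pair_count M n) \<le> D * ?a * exp (- (2 * exp (- 2) * exp (- ?u ?t) / ?t))"
          using elim(2) x M unfolding M_def by (metis (no_types, lifting))
        ultimately show ?thesis by linarith
      qed
      moreover have "real (\<Sum>m\<in>{M<..n}. shifted_pair_count m n (2 * m)) \<le> C * ?a * (exp (- (2 * ?u ?t)) / (1 - exp (- (2 * ?t))))"
      proof -
        have "real (\<Sum>m\<in>{M<..n}. shifted_pair_count m n (2 * m)) \<le> (\<Sum>m\<in>{M<..n}. C * ?a * exp (- (real (2 * m) * ?t)))"
          unfolding of_nat_sum
        proof (intro sum_mono)
          fix m assume "m \<in> {M<..n}"
          then show "real (shifted_pair_count m n (2 * m)) \<le> C * ?a * exp (- (real (2 * m) * ?t))"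
            using elim(1) by (meson greaterThanAtMost_iff)
        qed
        also have "\<dots> = C * ?a * (\<Sum>m\<in>{M<..n}. exp (- (real m * (2 * ?t))))"
          by (simp add: sum_distrib_left mult_ac)
        also have "(\<Sum>m\<in>{M<..n}. exp (- (real m * (2 * ?t)))) = tail_sum (2 * ?t) M n"
          using t M by (intro tail_sum_eq) auto
        also have "C * ?a * tail_sum (2 * ?t) M n \<le> C * ?a * (exp (- (2 * ?u ?t)) / (1 - exp (- (2 * ?t))))"
        proof (intro mult_left_mono order_trans[OF tail_sum_le] divide_right_mono)
          have "x * (2 * ?t) \<le> real (Suc M) * (2 * ?t)" using fl t by (intro mult_right_mono) auto
          then have "2 * ?u ?t \<le> real (Suc M) * (2 * ?t)" using x(3) by simp
          then show "exp (- (real (Suc M) * (2 * ?t))) \<le> exp (- (2 * ?u ?t))" by simp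
        qed (use t a C in auto)
        finally show ?thesis .
      qed
      ultimately have "real (tie_count n n) \<le> D * ?a * exp (- (2 * exp (- 2) * exp (- ?u ?t) / ?t)) + C * ?a * (exp (- (2 * ?u ?t)) / (1 - exp (- (2 * ?t))))"
        by linarith
      also have "\<dots> = ?a * ?g ?t" by (simp add: algebra_simps)
      finally show ?case using a by (simp add: pos_divide_le_eq mult.commute)
    qed
  qed
qed

section \<open>The distribution function of the peak\<close>

definition peak_cdf :: "nat \<Rightarrow> real \<Rightarrow> real" where
  "peak_cdf n v = measure_pmf.prob (unimodal_pmf n) {l. real (peak l) \<le> cutoff (mesh n) v}"

lemma peak_le_size: "l \<in> unimodal_seqs n \<Longrightarrow> peak l \<le> n"
  by (auto simp: unimodal_seqs_def seq_size_def)

lemma two_card_unimodal_seqs: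
  assumes "n > 0"
  shows "2 * real (card (unimodal_seqs n)) = real (pair_count n n) + real (tie_count n n)"
proof -
  have "{l \<in> unimodal_seqs n. peak l \<le> n} = unimodal_seqs n" by (auto dest: peak_le_size)
  then show ?thesis using two_peak_le[OF assms, of n] by simp
qed

lemma peak_cdf_eq_card:
  assumes n: "n > 0"
  shows "peak_cdf n v = real (card {l \<in> unimodal_seqs n. real (peak l) \<le> cutoff (mesh n) v}) / real (card (unimodal_seqs n))"
proof -
  have "unimodal_seqs n \<inter> {l. real (peak l) \<le> cutoff (mesh n) v} = {l \<in> unimodal_seqs n. real (peak l) \<le> cutoff (mesh n) v}"
    by auto
  then show ?thesis
    unfolding peak_cdf_def unimodal_pmf_def
    by (simp add: measure_pmf_of_set[OF unimodal_seqs_nonempty[OF n] finite_unimodal_seqs])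
qed

lemma peak_cdf_eq_0:
  assumes n: "n > 0" and v: "cutoff (mesh n) v < 0"
  shows "peak_cdf n v = 0"
proof -
  have "\<not> real (peak l) \<le> cutoff (mesh n) v" for l using v by (meson less_le_trans not_le of_nat_0_le_iff)
  then show ?thesis unfolding peak_cdf_def by simp
qed

lemma card_peak_le_floor:
  assumes x: "x \<ge> 0"
  shows "card {l \<in> unimodal_seqs n. real (peak l) \<le> x} = card {l \<in> unimodal_seqs n. peak l \<le> nat \<lfloor>x\<rfloor>}"
  using x by (simp add: le_nat_floor le_nat_iff le_floor_iff)

lemma peak_cdf_eq:
  assumes n: "n > 0" and v: "cutoff (mesh n) v \<ge> 0"
  defines "M \<equiv> nat \<lfloor>cutoff (mesh n) v\<rfloor>"
  shows "peak_cdf n v = (real (pair_count M n) + real (tie_count n M)) / (real (pair_count n n) + real (tie_count n n))"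
proof -
  have "peak_cdf n v = (2 * real (card {l \<in> unimodal_seqs n. peak l \<le> M})) / (2 * real (card (unimodal_seqs n)))"
    unfolding peak_cdf_eq_card[OF n] card_peak_le_floor[OF v] M_def by simp
  then show ?thesis unfolding two_peak_le[OF n] two_card_unimodal_seqs[OF n] .
qed

lemma peak_cdf_tendsto: "(\<lambda>n. peak_cdf n v) \<longlonglongrightarrow> exp (- exp (- v))"
proof -
  define M where "M n = nat \<lfloor>cutoff (mesh n) v\<rfloor>" for n
  let ?a = "\<lambda>n. real (pair_count n n)"
  have A: "(\<lambda>n. real (pair_count (M n) n) / ?a n) \<longlonglongrightarrow> exp (- exp (- v))"
    unfolding M_def by (rule pair_count_ratio_tendsto)
  have ev: "\<forall>\<^sub>F n in sequentially. M n \<le> n \<and> cutoff (mesh n) v \<ge> 0 \<and> n > 0"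
    using eventually_cutoff[of v] eventually_gt_at_top[of 0]
  proof eventually_elim
    case (elim n)
    have "real (M n) \<le> real n" 
      unfolding M_def using floor_bounds(1)[of "cutoff (mesh n) v"] elim by linarith
    then show ?case using elim by simp
  qed
  have T: "(\<lambda>n. real (tie_count n (M n)) / ?a n) \<longlonglongrightarrow> 0"
  proof (rule Lim_null_comparison[OF _ tie_count_negligible])
    show "\<forall>\<^sub>F n in sequentially. norm (real (tie_count n (M n)) / ?a n) \<le> real (tie_count n n) / ?a n"
      using ev by eventually_elim (auto intro!: divide_right_mono tie_count_mono)
  qed
  have "(\<lambda>n. (real (pair_count (M n) n) / ?a n + real (tie_count n (M n)) / ?a n) / (1 + real (tie_count n n) / ?a n))
      \<longlonglongrightarrow> (exp (- exp (- v)) + 0) / (1 + 0)"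
    by (intro tendsto_intros A T tie_count_negligible) auto
  then have "(\<lambda>n. (real (pair_count (M n) n) / ?a n + real (tie_count n (M n)) / ?a n) / (1 + real (tie_count n n) / ?a n))
      \<longlonglongrightarrow> exp (- exp (- v))" by simp
  moreover have "\<forall>\<^sub>F n in sequentially. (real (pair_count (M n) n) / ?a n + real (tie_count n (M n)) / ?a n) / (1 + real (tie_count n n) / ?a n) = peak_cdf n v"
    using ev
  proof eventually_elim
    case (elim n)
    have a: "?a n > 0" using elim pair_count_pos by simp
    have "(x / ?a n + y / ?a n) / (1 + z / ?a n) = (x + y) / (?a n + z)" for x y z
      using a by (simp add: add_divide_distrib[symmetric] divide_simps)
    then show ?case using elim peak_cdf_eq[of n v] by (simp add: M_def)
  qed
  ultimately show ?thesis by (rule Lim_transform_eventually)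
qed

text \<open>A union bound over the peaks m > M, each contributing at most a constant times exp (- m
  t). Uniformity in v is what the mean requires; pointwise convergence would not give it.\<close>

lemma peak_cdf_upper_tail:
  obtains C where "C > 0"
    "\<forall>\<^sub>F n in sequentially. \<forall>v\<ge>0. 1 - peak_cdf n v \<le> C * exp (- v)"
proof -
  obtain C where C: "C > 0" and shift: "\<forall>\<^sub>F n in sequentially. \<forall>m\<le>n. \<forall>s.
       real (shifted_pair_count m n s) \<le> C * real (pair_count n n) * exp (- (real s * mesh n))"
    using shifted_pair_count_le by blast
  show ?thesis
  proof (rule that[of "2 * C"])
    show "\<forall>\<^sub>F n in sequentially. \<forall>v\<ge>0. 1 - peak_cdf n v \<le> 2 * C * exp (- v)"
      using shift eventually_mesh_small[OF zero_less_one] eventually_gt_at_top[of 0]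
    proof eventually_elim
      case (elim n)
      let ?t = "mesh n" and ?a = "real (pair_count n n)"
      have t: "?t > 0" by (rule mesh_pos) fact
      have a: "?a > 0" using elim pair_count_pos by simp
      show ?case
      proof (intro allI impI)
        fix v :: real assume v: "v \<ge> 0"
        let ?x = "cutoff ?t v"
        have "ln (2 / ?t) \<ge> 0" using t elim by (intro ln_ge_zero) (simp add: field_simps)
        then have x: "?x \<ge> 0" using v t by (simp add: cutoff_def)
        define M where "M = nat \<lfloor>?x\<rfloor>"
        let ?U = "real (card (unimodal_seqs n))"
        have U: "?U \<ge> ?a / 2" using two_card_unimodal_seqs[of n] elim by simp
        have "1 - peak_cdf n v = (?U - real (card {l \<in> unimodal_seqs n. peak l \<le> M})) / ?U"
          unfolding peak_cdf_eq_card[OF elim(3)] card_peak_le_floor[OF x] M_def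
          using U a by (simp add: diff_divide_distrib)
        moreover have "?U - real (card {l \<in> unimodal_seqs n. peak l \<le> M}) \<le> C * ?a * (?t / 2 * exp (- v) / (1 - exp (- ?t)))"
        proof (cases "M \<le> n")
          \<comment> \<open>As v is unbounded, the cutoff may exceed n; then no sequence has a
            larger peak.\<close>
          case False
          then have "{l \<in> unimodal_seqs n. peak l \<le> M} = unimodal_seqs n" by (auto dest: peak_le_size)
          then show ?thesis using C a t by simp
        next
          case True
          have "{l \<in> unimodal_seqs n. peak l \<le> n} = unimodal_seqs n" by (auto dest: peak_le_size)
          then have "?U = real (\<Sum>m=1..n. peak_count n m)" using card_peak_le[of n n] by simp
          also have "{1..n} = {1..M} \<union> {M<..n}" using True by auto
          also have "(\<Sum>m\<in>{1..M} \<union> {M<..n}. peak_count n m) = (\<Sum>m=1..M. peak_count n m) + (\<Sum>m\<in>{M<..n}. peak_count n m)"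
            by (rule sum.union_disjoint) auto
          finally have "?U - real (card {l \<in> unimodal_seqs n. peak l \<le> M}) = (\<Sum>m\<in>{M<..n}. real (peak_count n m))"
            unfolding card_peak_le by simp
          also have "\<dots> \<le> (\<Sum>m\<in>{M<..n}. C * ?a * exp (- (real m * ?t)))"
          proof (intro sum_mono)
            fix m assume "m \<in> {M<..n}"
            then have "m > 0" "m \<le> n" by auto
            then show "real (peak_count n m) \<le> C * ?a * exp (- (real m * ?t))"
              using elim(1) by (simp add: peak_count_eq)
          qed
          also have "\<dots> = C * ?a * tail_sum ?t M n"
            by (simp add: sum_distrib_left tail_sum_eq[OF t True, symmetric])
          also have "\<dots> \<le> C * ?a * (?t / 2 * exp (- v) / (1 - exp (- ?t)))"
          proof (intro mult_left_mono order_trans[OF tail_sum_le[OF t]] divide_right_mono)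
            have "?x * ?t \<le> real (Suc M) * ?t"
              unfolding M_def using floor_bounds(3)[OF x] t by (intro mult_right_mono) auto
            then show "exp (- (real (Suc M) * ?t)) \<le> ?t / 2 * exp (- v)"
              unfolding exp_cutoff[OF t, symmetric] by simp
          qed (use t C a in auto)
          finally show ?thesis .
        qed
        ultimately have "1 - peak_cdf n v \<le> C * ?a * (?t / 2 * exp (- v) / (1 - exp (- ?t))) / ?U"
          by (simp only: divide_right_mono of_nat_0_le_iff)
        also have "\<dots> \<le> C * ?a * (?t / 2 * exp (- v) / (?t / 2)) / (?a / 2)"
          using U a C t elim one_minus_exp_ge[of ?t]
          by (intro frac_le mult_left_mono divide_left_mono mult_pos_pos) auto
        also have "\<dots> = 2 * C * exp (- v)" using t a by simp
        finally show "1 - peak_cdf n v \<le> 2 * C * exp (- v)" .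
      qed
    qed
  qed (use C in simp)
qed

text \<open>Ties at most double the numerator, so \<open>pair_count_le\<close> applies while the
  cutoff is nonnegative. Below that the distribution function vanishes because peaks are
  nonnegative.\<close>

lemma peak_cdf_lower_tail:
  obtains C where "C > 0"
    "\<forall>\<^sub>F n in sequentially. \<forall>v\<le>0. peak_cdf n v \<le> C * exp (- (exp (- 2) * exp (- v)))"
proof -
  obtain D where D: "D > 0" and small: "\<forall>\<^sub>F n in sequentially. \<forall>x\<ge>0. nat \<lfloor>x\<rfloor> \<le> n \<longrightarrow>
       real (pair_count (nat \<lfloor>x\<rfloor>) n) \<le> D * real (pair_count n n) * exp (- (2 * exp (- 2) * exp (- (x * mesh n)) / mesh n))"
    using pair_count_le by blast
  show ?thesis
  proof (rule that[of "2 * D"])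
    show "\<forall>\<^sub>F n in sequentially. \<forall>v\<le>0. peak_cdf n v \<le> 2 * D * exp (- (exp (- 2) * exp (- v)))"
      using small eventually_cutoff[of 0] eventually_gt_at_top[of 0]
    proof eventually_elim
      case (elim n)
      let ?t = "mesh n" and ?a = "real (pair_count n n)"
      have t: "?t > 0" by (rule mesh_pos) fact
      have a: "?a > 0" using elim pair_count_pos by simp
      show ?case
      proof (intro allI impI)
        fix v :: real assume v: "v \<le> 0"
        let ?x = "cutoff ?t v"
        show "peak_cdf n v \<le> 2 * D * exp (- (exp (- 2) * exp (- v)))"
        proof (cases "?x < 0")
          case True
          then show ?thesis using peak_cdf_eq_0[OF elim(3)] D by simp
        next
          case False
          then have x: "?x \<ge> 0" by simp
          define M where "M = nat \<lfloor>?x\<rfloor>"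
          have "?x \<le> cutoff ?t 0" unfolding cutoff_def using v t by (intro divide_right_mono) auto
          then have "real M \<le> real n" unfolding M_def using floor_bounds(1)[OF x] elim by linarith
          then have Mn: "M \<le> n" by simp
          have "peak_cdf n v = (real (pair_count M n) + real (tie_count n M)) / (?a + real (tie_count n n))"
            unfolding M_def by (rule peak_cdf_eq[OF elim(3) x])
          also have "\<dots> \<le> 2 * real (pair_count M n) / ?a"
            using tie_count_le[OF elim(3), of M] a by (intro frac_le) auto
          also have "\<dots> \<le> 2 * (D * ?a * exp (- (2 * exp (- 2) * exp (- (?x * ?t)) / ?t))) / ?a"
            using elim(1) x Mn a unfolding M_def by (intro divide_right_mono mult_left_mono) auto
          also have "\<dots> = 2 * D * exp (- (2 * exp (- 2) * exp (- (?x * ?t)) / ?t))" using a by simp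
          also have "2 * exp (- 2) * exp (- (?x * ?t)) / ?t = exp (- 2) * exp (- v)"
            unfolding exp_cutoff[OF t] using t by simp
          finally show ?thesis .
        qed
      qed
    qed
  qed (use D in simp)
qed

lemma integrable_exp_minus_abs:
  assumes "c > (0::real)"
  shows "integrable lborel (\<lambda>v. exp (- (c * \<bar>v\<bar>)))"
proof (rule Bochner_Integration.integrable_bound)
  define m where "m = min 1 (c\<^sup>2 / 2)"
  have m: "m > 0" using assms by (simp add: m_def)
  show "integrable lborel (\<lambda>v. 1 / m * (1 / (1 + v\<^sup>2)))"
    by (intro integrable_mult_right integrable_inverse_1_plus_sq)
  show "AE v in lborel. norm (exp (- (c * \<bar>v\<bar>))) \<le> norm (1 / m * (1 / (1 + v\<^sup>2)))"
  proof (intro AE_I2)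
    fix v :: real
    have "m * (1 + v\<^sup>2) \<le> 1 + c * \<bar>v\<bar> + (c * \<bar>v\<bar>)\<^sup>2 / 2"
    proof -
      have "m * v\<^sup>2 \<le> c\<^sup>2 / 2 * v\<^sup>2" by (intro mult_right_mono) (auto simp: m_def)
      moreover have "m \<le> 1" by (simp add: m_def)
      moreover have "c * \<bar>v\<bar> \<ge> 0" using assms by simp
      moreover have "(c * \<bar>v\<bar>)\<^sup>2 / 2 = c\<^sup>2 / 2 * v\<^sup>2" by (simp add: power_mult_distrib)
      ultimately show ?thesis unfolding distrib_left by linarith
    qed
    also have "\<dots> \<le> exp (c * \<bar>v\<bar>)" using assms by (intro exp_lower_Taylor_quadratic) auto
    finally have "m * (1 + v\<^sup>2) \<le> exp (c * \<bar>v\<bar>)" .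
    moreover have "m * (1 + v\<^sup>2) > 0" using m one_plus_sq_gt_0[of v] by simp
    ultimately have "1 / exp (c * \<bar>v\<bar>) \<le> 1 / (m * (1 + v\<^sup>2))"
      by (rule divide_left_mono[OF _ zero_le_one mult_pos_pos[OF exp_gt_zero]])
    then show "norm (exp (- (c * \<bar>v\<bar>))) \<le> norm (1 / m * (1 / (1 + v\<^sup>2)))"
      using m one_plus_sq_gt_0[of v] by (simp add: exp_minus inverse_eq_divide)
  qed
qed simp

section \<open>The mean of the Gumbel distribution\<close>

text \<open>The maximum of \<open>n\<close> independent standard exponential variables, minus \<open>ln n\<close>, tends to the Gumbel
  distribution, and its mean is \<open>harm n - ln n\<close>.\<close>

definition max_exp_cdf :: "nat \<Rightarrow> real \<Rightarrow> real" where
  "max_exp_cdf n v = (if v \<ge> - ln (real n) then (1 - exp (- v) / real n) ^ n else 0)"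

lemma exp_div_le_1: "n > 0 \<Longrightarrow> v \<ge> - ln (real n) \<Longrightarrow> exp (- v) / real n \<le> 1"
  using exp_le_cancel_iff[of "- v" "ln (real n)"] by (simp add: divide_le_eq_1)

text \<open>For q = 1 - exp (- v) / n the derivative of q is 1 - q, so 1 - q^n = (1 - q) (1 + q +
  ... + q^(n-1)) has the antiderivative \<open>F\<close>, which rises from 0 at - ln n to
  \<open>harm n\<close>. The term ln n is the length of the interval from - ln n to 0.\<close>

lemma max_exp_cdf_mean:
  assumes n: "n > 0"
  shows "has_bochner_integral lborel (\<lambda>v. indicator {0..} v - max_exp_cdf n v) (harm n - ln (real n))"
proof -
  let ?q = "\<lambda>v. 1 - exp (- v) / real n"
  define F where "F v = (\<Sum>k<n. ?q v ^ Suc k / real (Suc k))" for v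
  let ?a = "- ln (real n)"
  have nn: "(\<integral>\<^sup>+v. ennreal (1 - ?q v ^ n) * indicator {?a..} v \<partial>lborel) = harm n - F ?a"
  proof (rule nn_integral_FTC_atLeast)
    fix v :: real assume v: "?a \<le> v"
    have "DERIV F v :> (\<Sum>k<n. exp (- v) / real n * ?q v ^ k)"
      unfolding F_def
    proof (rule DERIV_sum)
      fix k
      show "DERIV (\<lambda>v. ?q v ^ Suc k / real (Suc k)) v :> exp (- v) / real n * ?q v ^ k"
      proof (rule DERIV_cong)
        have "DERIV ?q v :> exp (- v) / real n"
          using n by (auto intro!: derivative_eq_intros)
        then show "DERIV (\<lambda>v. ?q v ^ Suc k / real (Suc k)) v :>
            of_nat (Suc k) * (exp (- v) / real n * ?q v ^ (Suc k - Suc 0)) / real (Suc k)"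
          by (intro DERIV_cdivide DERIV_power)
      qed (simp del: of_nat_Suc)
    qed
    moreover have "(\<Sum>k<n. exp (- v) / real n * ?q v ^ k) = 1 - ?q v ^ n"
      by (simp add: one_diff_power_eq sum_distrib_left)
    ultimately show "DERIV F v :> 1 - ?q v ^ n" by simp
    show "0 \<le> 1 - ?q v ^ n" using exp_div_le_1[OF n v] by (simp add: power_le_one)
  next
    have "(?q \<longlongrightarrow> 1) at_top" using n by real_asymp
    then have "(F \<longlongrightarrow> (\<Sum>k<n. 1 ^ Suc k / real (Suc k))) at_top"
      unfolding F_def by (intro tendsto_sum tendsto_divide tendsto_power tendsto_const) auto
    then show "(F \<longlongrightarrow> harm n) at_top"
      by (simp add: harm_altdef inverse_eq_divide)
  qed simp
  have "F ?a = 0" using n by (simp add: F_def exp_minus)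
  then have A: "has_bochner_integral lborel (\<lambda>v. indicator {?a..} v * (1 - ?q v ^ n)) (harm n)"
  proof (intro has_bochner_integral_nn_integral)
    have "ennreal (indicator {?a..} v * (1 - ?q v ^ n)) = ennreal (1 - ?q v ^ n) * indicator {?a..} v" for v
      by (simp split: split_indicator)
    then show "(\<integral>\<^sup>+v. ennreal (indicator {?a..} v * (1 - ?q v ^ n)) \<partial>lborel) = ennreal (harm n)"
      using nn \<open>F ?a = 0\<close> by simp
    show "AE v in lborel. 0 \<le> indicator {?a..} v * (1 - ?q v ^ n)"
      using exp_div_le_1[OF n] by (intro AE_I2) (auto split: split_indicator simp: power_le_one)
  qed (auto simp: harm_nonneg)
  have "ln (real n) \<ge> 0" using n by simp
  then have B: "has_bochner_integral lborel (indicator {?a..<0} :: real \<Rightarrow> real) (ln (real n))"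
    using has_bochner_integral_real_indicator[of "{?a..<0}" lborel] by simp
  have "indicator {?a..} v * (1 - ?q v ^ n) - indicator {?a..<0} v = indicator {0..} v - max_exp_cdf n v" for v
  proof -
    obtain L where "ln (real n) = L" "L \<ge> 0" using \<open>ln (real n) \<ge> 0\<close> by blast
    then show ?thesis by (simp add: max_exp_cdf_def split: split_indicator)
  qed
  then show ?thesis using has_bochner_integral_diff[OF A B] by simp
qed

lemma exp_neg_exp_le: "v \<le> 0 \<Longrightarrow> exp (- exp (- v)) \<le> exp (- \<bar>v\<bar> :: real)"
  using exp_ge_add_one_self[of "- v"] by simp

text \<open>Bernoulli's inequality for v \<ge> 0, and 1 - y \<le> exp (- y) for negative v.\<close>

lemma max_exp_cdf_bound:
  assumes n: "n > 0"
  shows "\<bar>indicator {0..} v - max_exp_cdf n v\<bar> \<le> exp (- \<bar>v\<bar>)"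
proof -
  let ?y = "exp (- v) / real n"
  have n0: "ln (real n) \<ge> 0" using n by simp
  show ?thesis
  proof (cases "v \<ge> 0")
    case True
    then have v: "v \<ge> - ln (real n)" using n0 by linarith
    have y: "?y \<le> 1" by (rule exp_div_le_1[OF n v])
    have "1 + real n * (- ?y) \<le> (1 + - ?y) ^ n" using y by (intro Bernoulli_inequality) auto
    then have "1 - exp (- v) \<le> (1 - ?y) ^ n" using n by simp
    moreover have "(1 - ?y) ^ n \<le> 1" using y by (intro power_le_one) auto
    ultimately show ?thesis using True v by (simp add: max_exp_cdf_def)
  next
    case False
    show ?thesis
    proof (cases "v \<ge> - ln (real n)")
      case True
      have y: "?y \<le> 1" by (rule exp_div_le_1[OF n True])
      have "(1 - ?y) ^ n \<le> exp (- ?y) ^ n"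
        using y exp_ge_add_one_self[of "- ?y"] by (intro power_mono) auto
      also have "\<dots> = exp (- exp (- v))" using n by (simp flip: exp_of_nat_mult)
      also have "\<dots> \<le> exp (- \<bar>v\<bar>)" using False by (intro exp_neg_exp_le) auto
      finally show ?thesis using False True y by (simp add: max_exp_cdf_def)
    qed (use False in \<open>simp add: max_exp_cdf_def\<close>)
  qed
qed

lemma max_exp_cdf_tendsto: "(\<lambda>n. max_exp_cdf n v) \<longlonglongrightarrow> exp (- exp (- v))"
proof (rule Lim_transform_eventually)
  show "(\<lambda>n. (1 + (- exp (- v)) / real n) ^ n) \<longlonglongrightarrow> exp (- exp (- v))"
    by (rule tendsto_exp_limit_sequentially)
  have "\<forall>\<^sub>F n in sequentially. - ln (real n) \<le> v" by real_asymp
  then show "\<forall>\<^sub>F n in sequentially. (1 + (- exp (- v)) / real n) ^ n = max_exp_cdf n v"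
    by eventually_elim (simp add: max_exp_cdf_def)
qed

lemma integral_tendsto_dominated:
  fixes f :: "nat \<Rightarrow> real \<Rightarrow> real"
  assumes "\<And>n. n > 0 \<Longrightarrow> f n \<in> borel_measurable lborel" "g \<in> borel_measurable lborel"
    and "integrable lborel w" "\<And>v. (\<lambda>n. f n v) \<longlonglongrightarrow> g v"
    and bound: "\<forall>\<^sub>F n in sequentially. \<forall>v. \<bar>f n v\<bar> \<le> w v"
  shows "(\<lambda>n. integral\<^sup>L lborel (f n)) \<longlonglongrightarrow> integral\<^sup>L lborel g"
proof -
  from bound obtain N where N: "\<And>n v. n \<ge> N \<Longrightarrow> \<bar>f n v\<bar> \<le> w v"
    unfolding eventually_sequentially by blast
  \<comment> \<open>The shift by \<open>Suc N\<close> passes the threshold of the bound and also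
    excludes index 0, where measurability is not assumed.\<close>
  have "(\<lambda>n. integral\<^sup>L lborel (f (n + Suc N))) \<longlonglongrightarrow> integral\<^sup>L lborel g"
    by (rule integral_dominated_convergence[where w = w])
       (use assms N in \<open>auto intro!: AE_I2 LIMSEQ_ignore_initial_segment simp del: add_Suc_right\<close>)
  then show ?thesis by (rule LIMSEQ_offset)
qed

lemma gumbel_mean: "(\<integral>v. indicator {0..} v - exp (- exp (- v)) \<partial>lborel) = (euler_mascheroni :: real)"
proof -
  let ?f = "\<lambda>n v. indicator {0..} v - max_exp_cdf n v"
  have "(\<lambda>n. integral\<^sup>L lborel (?f n)) \<longlonglongrightarrow> (\<integral>v. indicator {0..} v - exp (- exp (- v)) \<partial>lborel)"
  proof (rule integral_tendsto_dominated[where w = "\<lambda>v. exp (- (1 * \<bar>v\<bar>))"])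
    show "?f n \<in> borel_measurable lborel" if "n > 0" for n
      using max_exp_cdf_mean[OF that] by (auto dest: borel_measurable_has_bochner_integral)
    show "integrable lborel (\<lambda>v::real. exp (- (1 * \<bar>v\<bar>)))" by (rule integrable_exp_minus_abs) simp
    show "(\<lambda>n. ?f n v) \<longlonglongrightarrow> indicator {0..} v - exp (- exp (- v))" for v
      by (intro tendsto_intros max_exp_cdf_tendsto)
    show "\<forall>\<^sub>F n in sequentially. \<forall>v. \<bar>?f n v\<bar> \<le> exp (- (1 * \<bar>v\<bar>))"
      using eventually_gt_at_top[of 0] by eventually_elim (use max_exp_cdf_bound in auto)
  qed simp
  moreover have "\<forall>\<^sub>F n in sequentially. harm n - ln (real n) = integral\<^sup>L lborel (?f n)"
    using eventually_gt_at_top[of 0]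
    by eventually_elim (use max_exp_cdf_mean in \<open>simp add: has_bochner_integral_iff\<close>)
  then have "(\<lambda>n. integral\<^sup>L lborel (?f n)) \<longlonglongrightarrow> euler_mascheroni"
    by (rule Lim_transform_eventually[OF euler_mascheroni_LIMSEQ])
  ultimately show ?thesis by (rule LIMSEQ_unique)
qed

section \<open>The mean of the peak\<close>

text \<open>The case of a constant Y = y, of either sign, in E(Y) = integral of (1[v \<ge> 0] - P(Y
  \<le> v)). Averaging over the finite set of sequences gives \<open>peak_mean\<close>.\<close>

lemma integral_indicator_diff:
  fixes y :: real
  shows "has_bochner_integral lborel (\<lambda>v. indicator {0..} v - indicator {y..} v) y"
proof -
  have "has_bochner_integral lborel (\<lambda>v. indicator {0..<y} v - indicator {y..<0} v :: real)
      (measure lborel {0..<y} - measure lborel {y..<0})"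
    by (intro has_bochner_integral_diff has_bochner_integral_real_indicator emeasure_bounded_finite) auto
  moreover have "measure lborel {0..<y} - measure lborel {y..<0} = y"
    by (cases "y \<ge> 0") auto
  moreover have "indicator {0..<y} v - indicator {y..<0} v = (indicator {0..} v - indicator {y..} v :: real)" for v
    by (auto split: split_indicator)
  ultimately show ?thesis by simp
qed

lemma peak_mean:
  assumes n: "n > 0"
  shows "has_bochner_integral lborel (\<lambda>v. indicator {0..} v - peak_cdf n v)
    (mesh n * measure_pmf.expectation (unimodal_pmf n) (\<lambda>l. real (peak l)) - ln (2 / mesh n))"
proof -
  let ?S = "unimodal_seqs n" and ?t = "mesh n"
  have t: "?t > 0" by (rule mesh_pos) fact
  let ?U = "real (card ?S)"
  have U: "?U > 0" using unimodal_seqs_nonempty[OF n] finite_unimodal_seqs[of n] by (simp add: card_gt_0_iff)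
  define Y where "Y l = ?t * real (peak l) - ln (2 / ?t)" for l
  have "has_bochner_integral lborel (\<lambda>v. (\<Sum>l\<in>?S. indicator {0..} v - indicator {Y l..} v) / ?U) ((\<Sum>l\<in>?S. Y l) / ?U)"
    by (intro has_bochner_integral_divide_zero has_bochner_integral_sum integral_indicator_diff)
  moreover have "(\<Sum>l\<in>?S. Y l) / ?U = ?t * measure_pmf.expectation (unimodal_pmf n) (\<lambda>l. real (peak l)) - ln (2 / ?t)"
    unfolding unimodal_pmf_def integral_pmf_of_set[OF unimodal_seqs_nonempty[OF n] finite_unimodal_seqs] Y_def
    using U by (simp add: sum_subtractf sum_distrib_left[symmetric] diff_divide_distrib)
  moreover have "(\<Sum>l\<in>?S. indicator {0..} v - indicator {Y l..} v) / ?U = indicator {0..} v - peak_cdf n v" for v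
  proof -
    have "Y l \<le> v \<longleftrightarrow> real (peak l) \<le> cutoff ?t v" for l
      using t by (simp add: Y_def cutoff_def pos_le_divide_eq algebra_simps)
    then have "(\<Sum>l\<in>?S. indicator {Y l..} v) = (\<Sum>l\<in>?S. if real (peak l) \<le> cutoff ?t v then 1 else 0 :: real)"
      by (intro sum.cong) (auto simp: indicator_def)
    also have "\<dots> = real (card {l \<in> ?S. real (peak l) \<le> cutoff ?t v})"
      using finite_unimodal_seqs[of n] by (simp add: sum.If_cases Int_def)
    finally show ?thesis
      unfolding peak_cdf_eq_card[OF n] using U by (simp add: sum_subtractf diff_divide_distrib)
  qed
  ultimately show ?thesis by simp
qed

lemma peak_mean_tendsto:
  "(\<lambda>n. mesh n * measure_pmf.expectation (unimodal_pmf n) (\<lambda>l. real (peak l)) - ln (2 / mesh n)) \<longlonglongrightarrow> euler_mascheroni"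
proof -
  let ?f = "\<lambda>n v. indicator {0..} v - peak_cdf n v"
  obtain C where C: "C > 0" and up: "\<forall>\<^sub>F n in sequentially. \<forall>v\<ge>0. 1 - peak_cdf n v \<le> C * exp (- v)"
    using peak_cdf_upper_tail by blast
  obtain D where D: "D > 0" and lo: "\<forall>\<^sub>F n in sequentially. \<forall>v\<le>0. peak_cdf n v \<le> D * exp (- (exp (- 2) * exp (- v)))"
    using peak_cdf_lower_tail by blast
  let ?w = "\<lambda>v. C * exp (- (1 * \<bar>v\<bar>)) + D * exp (- (exp (- 2) * \<bar>v\<bar>))"
  have "(\<lambda>n. integral\<^sup>L lborel (?f n)) \<longlonglongrightarrow> (\<integral>v. indicator {0..} v - exp (- exp (- v)) \<partial>lborel)"
  proof (rule integral_tendsto_dominated[where w = ?w])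
    show "?f n \<in> borel_measurable lborel" if "n > 0" for n
      using peak_mean[OF that] by (auto dest: borel_measurable_has_bochner_integral)
    show "integrable lborel ?w"
      by (intro Bochner_Integration.integrable_add integrable_mult_right integrable_exp_minus_abs) auto
    show "(\<lambda>n. ?f n v) \<longlonglongrightarrow> indicator {0..} v - exp (- exp (- v))" for v
      by (intro tendsto_intros peak_cdf_tendsto)
    show "\<forall>\<^sub>F n in sequentially. \<forall>v. \<bar>?f n v\<bar> \<le> ?w v"
      using up lo
    proof eventually_elim
      case (elim n)
      show ?case
      proof
        fix v :: real
        have p: "0 \<le> peak_cdf n v" "peak_cdf n v \<le> 1" by (simp_all add: peak_cdf_def)
        show "\<bar>?f n v\<bar> \<le> ?w v"
        proof (cases "v \<ge> 0")
          case True
          then have "1 - peak_cdf n v \<le> C * exp (- v)" using elim by blast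
          then show ?thesis using True p D by (simp add: add_increasing2)
        next
          case False
          have "peak_cdf n v \<le> D * exp (- (exp (- 2) * exp (- v)))" using elim False by simp
          also have "\<dots> \<le> D * exp (- (exp (- 2) * \<bar>v\<bar>))"
          proof -
            have "\<bar>v\<bar> \<le> exp (- v)" using False exp_ge_add_one_self[of "- v"] by linarith
            then have "exp (- 2) * \<bar>v\<bar> \<le> exp (- 2) * exp (- v)" by (intro mult_left_mono) auto
            then show ?thesis using D by (intro mult_left_mono) auto
          qed
          finally show ?thesis using False p C by (simp add: add_increasing)
        qed
      qed
    qed
  qed simp
  moreover have "\<forall>\<^sub>F n in sequentially. integral\<^sup>L lborel (?f n) =
      mesh n * measure_pmf.expectation (unimodal_pmf n) (\<lambda>l. real (peak l)) - ln (2 / mesh n)"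
    using eventually_gt_at_top[of 0]
    by eventually_elim (use peak_mean in \<open>simp add: has_bochner_integral_iff\<close>)
  ultimately show ?thesis
    unfolding gumbel_mean by (rule Lim_transform_eventually)
qed

theorem theorem1p3:
  fixes B :: real
  assumes "B = sqrt 3 / pi"
  shows "(\<forall>v::real.
           (\<lambda>n. measure_pmf.prob (unimodal_pmf n)
                  {l. (real (peak l) - B * sqrt (real n) * ln (2 * B * sqrt (real n)))
                        / (B * sqrt (real n)) \<le> v})
           \<longlonglongrightarrow> exp (- exp (- v))) \<and>
         (\<exists>\<epsilon> :: nat \<Rightarrow> real. \<epsilon> \<in> o(\<lambda>_. 1) \<and>
           (\<forall>n\<ge>1. measure_pmf.expectation (unimodal_pmf n) (\<lambda>l. real (peak l)) =
              B * sqrt (real n) * ln (2 * B * sqrt (real n)) +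
              B * euler_mascheroni * sqrt (real n) * (1 + \<epsilon> n)))"
proof (intro conjI allI)
  \<comment> \<open>True for n = 0 as well, where division by zero makes both sides 0.\<close>
  have scale: "B * sqrt (real n) = 1 / mesh n" for n
    by (simp add: mesh_def assms)
  have scale2: "2 * B * sqrt (real n) = 2 / mesh n" for n
    unfolding mult.assoc scale by simp
  show "(\<lambda>n. measure_pmf.prob (unimodal_pmf n)
                  {l. (real (peak l) - B * sqrt (real n) * ln (2 * B * sqrt (real n)))
                        / (B * sqrt (real n)) \<le> v}) \<longlonglongrightarrow> exp (- exp (- v))" for v
  proof (rule Lim_transform_eventually[OF peak_cdf_tendsto])
    show "\<forall>\<^sub>F n in sequentially. peak_cdf n v = measure_pmf.prob (unimodal_pmf n)
                  {l. (real (peak l) - B * sqrt (real n) * ln (2 * B * sqrt (real n)))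
                        / (B * sqrt (real n)) \<le> v}"
      using eventually_gt_at_top[of 0]
    proof eventually_elim
      case (elim n)
      have t: "mesh n > 0" by (rule mesh_pos) fact
      have "(real (peak l) - 1 / mesh n * ln (2 / mesh n)) / (1 / mesh n) \<le> v
          \<longleftrightarrow> real (peak l) \<le> cutoff (mesh n) v" for l
      proof -
        have "(real (peak l) - 1 / mesh n * ln (2 / mesh n)) / (1 / mesh n) = real (peak l) * mesh n - ln (2 / mesh n)"
          using t by (simp add: left_diff_distrib)
        then show ?thesis using t by (simp add: cutoff_def pos_le_divide_eq algebra_simps)
      qed
      then show ?case unfolding scale scale2 peak_cdf_def by simp
    qed
  qed
  define E where "E n = measure_pmf.expectation (unimodal_pmf n) (\<lambda>l. real (peak l))" for n
  \<comment> \<open>Obtained by solving the claimed identity for the error term, so the identity is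
    exact for every n \<ge> 1; dividing by the Euler-Mascheroni constant is legitimate since it is
    positive.\<close>
  define \<epsilon> where "\<epsilon> n = (mesh n * E n - ln (2 / mesh n)) / euler_mascheroni - 1" for n
  have g: "euler_mascheroni > (0::real)" by (rule euler_mascheroni_pos)
  have "\<epsilon> \<longlonglongrightarrow> euler_mascheroni / euler_mascheroni - 1"
    unfolding \<epsilon>_def E_def using g by (intro tendsto_intros peak_mean_tendsto) auto
  then have "\<epsilon> \<in> o(\<lambda>_. 1)" using g by (intro smalloI_tendsto) auto
  moreover have "E n = B * sqrt (real n) * ln (2 * B * sqrt (real n)) +
              B * euler_mascheroni * sqrt (real n) * (1 + \<epsilon> n)" if "n \<ge> 1" for n
  proof -
    have t: "mesh n > 0" using that by (intro mesh_pos) auto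
    have "B * euler_mascheroni * sqrt (real n) * (1 + \<epsilon> n) = (B * sqrt (real n)) * (euler_mascheroni * (1 + \<epsilon> n))"
      by (simp only: mult_ac)
    also have "euler_mascheroni * (1 + \<epsilon> n) = mesh n * E n - ln (2 / mesh n)"
      using g by (simp add: \<epsilon>_def)
    finally show ?thesis unfolding scale scale2 using t by (simp add: field_simps)
  qed
  ultimately show "\<exists>\<epsilon> :: nat \<Rightarrow> real. \<epsilon> \<in> o(\<lambda>_. 1) \<and>
           (\<forall>n\<ge>1. measure_pmf.expectation (unimodal_pmf n) (\<lambda>l. real (peak l)) =
              B * sqrt (real n) * ln (2 * B * sqrt (real n)) +
              B * euler_mascheroni * sqrt (real n) * (1 + \<epsilon> n))"
    unfolding E_def by blast
qed

end
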